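(* Let $n,p,m\ge 1$ be integers with $mp\le n$, let $A\in\mathbb{R}^{n\times n}$ be symmetric positive definite, and let $B\in\mathbb{R}^{n\times p}$ have orthonormal columns. Assume that $m$ steps of the block Lanczos iteration for $(A,B)$ run without breakdown or deflation, and let $\mathcal{F}_m(s)$ (block Gauss quadrature), $\widetilde{\mathcal{F}}_m(s)$ (block Gauss--Radau quadrature) and, for a symmetric positive definite $\boldsymbol{\phi}\in\mathbb{R}^{p\times p}$, $\widehat{\mathcal{F}}^{\boldsymbol{\phi}}_m(s)$ (Kreĭn--Nudelman quadrature) be the $p\times p$ matrix-valued functions defined in the context. Then for every symmetric positive definite $\boldsymbol{\phi}\in\mathbb{R}^{p\times p}$ (i.e. $0<\boldsymbol{\phi}<\infty$): 1. $\widehat{\mathcal{F}}^{\boldsymbol{\phi}}_m(s)$ is a (matrix-valued) Stieltjes function with the branch cut on $\mathbb{R}_-=(-\infty,0)$. 2. For all $s\in\mathbb{R}_+=(0,\infty)$ the two-sided bound $$\mathcal{F}_m(s)<\widehat{\mathcal{F}}^{\boldsymbol{\phi}}_m(s)<\widetilde{\mathcal{F}}_m(s)$$ holds in the Löwner order.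
   Context: **Order.** For real symmetric matrices, $G_1<G_2$ means that $G_2-G_1$ is positive definite (Löwner order). **Square root.** $\sqrt{s}$ is the principal branch on $\mathbb{C}\setminus(-\infty,0]$, so $\operatorname{Re}\sqrt{s}>0$. **Stieltjes function.** A $p\times p$ matrix-valued function $\mathcal{G}$ on $\mathbb{C}\setminus(-\infty,0]$ is a Stieltjes function if $$\mathcal{G}(s)=C+\int_{[0,\infty)}\frac{d\boldsymbol{\mu}(\lambda)}{\lambda+s},$$ with $C$ a constant real symmetric positive semidefinite matrix and $\boldsymbol{\mu}$ a real symmetric positive semidefinite matrix-valued Borel measure on $[0,\infty)$ with $\int_{[0,\infty)} (1+\lambda)^{-1}\,d\boldsymbol{\mu}(\lambda)$ finite. It has its branch cut on $\mathbb{R}_-=(-\infty,0)$ if it is holomorphic on $\mathbb{C}\setminus(-\infty,0]$ and does not extend continuously across any point of $(-\infty,0)$ (in particular, it is not the restriction of a meromorphic function on $\mathbb{C}$). **Block Lanczos iteration.** Set $Q_1=B$, $W=AQ_1$, $\boldsymbol{\alpha}_1=Q_1^TW$, $W\leftarrow W-Q_1\boldsymbol{\alpha}_1$. For $i=2,\dots,m$: compute the QR decomposition $Q_i\boldsymbol{\beta}_i=W$ ($Q_i\in\mathbb{R}^{n\times p}$ with orthonormal columns, $\boldsymbol{\beta}_i\in\mathbb{R}^{p\times p}$), set $W=AQ_i-Q_{i-1}\boldsymbol{\beta}_i^T$, $\boldsymbol{\alpha}_i=Q_i^TW$, $W\leftarrow W-Q_i\boldsymbol{\alpha}_i$. "Without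 breakdown or deflation" means that all $\boldsymbol{\beta}_i$, $i=2,\dots,m$, are nonsingular. Let $T_m\in\mathbb{R}^{mp\times mp}$ be the symmetric positive definite block tridiagonal matrix with diagonal blocks $\boldsymbol{\alpha}_1,\dots,\boldsymbol{\alpha}_m$, subdiagonal blocks $\boldsymbol{\beta}_2,\dots,\boldsymbol{\beta}_m$ (block $(i,i-1)$ is $\boldsymbol{\beta}_i$) and superdiagonal blocks $\boldsymbol{\beta}_2^T,\dots,\boldsymbol{\beta}_m^T$. **Stieltjes parameters.** Define $p\times p$ matrices by $\hat{\boldsymbol{\kappa}}_1=I_p$, $\boldsymbol{\gamma}_1^{-1}=\boldsymbol{\alpha}_1$, and for $i=2,\dots,m$ $$\hat{\boldsymbol{\kappa}}_i^{-1}=-\boldsymbol{\gamma}_{i-1}\hat{\boldsymbol{\kappa}}_{i-1}^T\boldsymbol{\beta}_i^T,\qquad \boldsymbol{\gamma}_i^{-1}=\hat{\boldsymbol{\kappa}}_i^T\boldsymbol{\alpha}_i\hat{\boldsymbol{\kappa}}_i-\boldsymbol{\gamma}_{i-1}^{-1}.$$ In the absence of breakdown all $\hat{\boldsymbol{\kappa}}_i$ are nonsingular and all $\boldsymbol{\gamma}_i$ are symmetric positive definite. **The three quadratures.** Let $E_1=[I_p,0,\dots,0]^T$ and $E_m=[0,\dots,0,I_p]^T$ be in $\mathbb{R}^{mp\times p}$. - Block Gauss: $\mathcal{F}_m(s)=E_1^T(T_m+sI)^{-1}E_1$. - Kreĭn--Nudelman: $\widehat{\mathcal{F}}^{\boldsymbol{\phi}}_m(s)=E_1^T\big(\widehat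 T_m^{\boldsymbol{\phi}}(s)+sI\big)^{-1}E_1$ for $s\in\mathbb{C}\setminus(-\infty,0]$, where $\widehat T_m^{\boldsymbol{\phi}}(s)=T_m-E_m\,\delta\boldsymbol{\alpha}_m^{\boldsymbol{\phi}}(s)\,E_m^T$ and $$\delta\boldsymbol{\alpha}_m^{\boldsymbol{\phi}}(s)=\hat{\boldsymbol{\kappa}}_m^{-T}\boldsymbol{\gamma}_m^{-1}\big(\boldsymbol{\gamma}_m^{-1}+\sqrt{s}\,\boldsymbol{\phi}\big)^{-1}\boldsymbol{\gamma}_m^{-1}\hat{\boldsymbol{\kappa}}_m^{-1}.$$ - Block Gauss--Radau: $\widetilde{\mathcal{F}}_m(s)=E_1^T(\widetilde T_m+sI)^{-1}E_1$, where $\widetilde T_m=T_m-E_m\,\hat{\boldsymbol{\kappa}}_m^{-T}\boldsymbol{\gamma}_m^{-1}\hat{\boldsymbol{\kappa}}_m^{-1}E_m^T$; equivalently $\widetilde{\mathcal{F}}_m(s)=\lim_{\boldsymbol{\phi}\to0}\widehat{\mathcal{F}}_m^{\boldsymbol{\phi}}(s)$. *)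

theory Defs
  imports
    "HOL-Analysis.Analysis"
    "Jordan_Normal_Form.Gauss_Jordan_Elimination"
begin

section \<open>Matrices\<close>

text \<open>Only applied to nonsingular matrices; unspecified on singular ones.\<close>

abbreviation minv :: "'a::field mat \<Rightarrow> 'a mat" where
  "minv M \<equiv> the (mat_inverse M)"

abbreviation cmat :: "real mat \<Rightarrow> complex mat" where
  "cmat \<equiv> map_mat complex_of_real"

definition sym_pos_def :: "nat \<Rightarrow> real mat \<Rightarrow> bool" where
  "sym_pos_def n M \<longleftrightarrow> M \<in> carrier_mat n n \<and> transpose_mat M = M \<and>
     (\<forall>v \<in> carrier_vec n. v \<noteq> 0\<^sub>v n \<longrightarrow> 0 < scalar_prod v (M *\<^sub>v v))"

definition sym_pos_semidef :: "nat \<Rightarrow> real mat \<Rightarrow> bool" where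
  "sym_pos_semidef n M \<longleftrightarrow> M \<in> carrier_mat n n \<and> transpose_mat M = M \<and>
     (\<forall>v \<in> carrier_vec n. 0 \<le> scalar_prod v (M *\<^sub>v v))"

definition loewner_less :: "nat \<Rightarrow> real mat \<Rightarrow> real mat \<Rightarrow> bool" where
  "loewner_less n M N \<longleftrightarrow>
     M \<in> carrier_mat n n \<and> transpose_mat M = M \<and>
     N \<in> carrier_mat n n \<and> transpose_mat N = N \<and> sym_pos_def n (N - M)"


section \<open>Matrix-valued measures and Stieltjes functions\<close>

text \<open>The measures on \<open>[0,\<infinity>)\<close> below may have infinite total mass, but they are finite on
  bounded sets, since \<open>1 / (1 + \<lambda>)\<close> is required to be integrable.  They are therefore
  given as matrix-valued set functions on the bounded Borel subsets of \<open>[0,\<infinity>)\<close>.\<close>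

definition bounded_borel :: "real set set" where
  "bounded_borel = {E \<in> sets borel. E \<subseteq> {0..} \<and> bounded E}"

definition psd_matrix_measure :: "nat \<Rightarrow> (real set \<Rightarrow> real mat) \<Rightarrow> bool" where
  "psd_matrix_measure p \<mu> \<longleftrightarrow>
     (\<forall>E \<in> bounded_borel. sym_pos_semidef p (\<mu> E)) \<and>
     (\<forall>E :: nat \<Rightarrow> real set.
        range E \<subseteq> bounded_borel \<longrightarrow> disjoint_family E \<longrightarrow> (\<Union>k. E k) \<in> bounded_borel \<longrightarrow>
        (\<forall>i<p. \<forall>j<p. (\<lambda>k. \<mu> (E k) $$ (i,j)) sums (\<mu> (\<Union>k. E k) $$ (i,j))))"

text \<open>The positive scalar Borel measure \<open>E \<mapsto> x\<^sup>T \<mu>(E) x\<close>.  It is extended to unbounded sets by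
  exhaustion, and to Borel subsets of the whole line with no mass outside \<open>[0,\<infinity>)\<close>.\<close>

definition quadratic_measure :: "(real set \<Rightarrow> real mat) \<Rightarrow> real vec \<Rightarrow> real measure" where
  "quadratic_measure \<mu> x =
     measure_of UNIV (sets borel)
       (\<lambda>E. SUP N::nat. ennreal (scalar_prod x (\<mu> (E \<inter> {0..real N}) *\<^sub>v x)))"

text \<open>The entry \<open>\<mu>\<^sub>i\<^sub>j\<close> is a difference of two positive measures by polarization:
  \<open>4 \<mu>\<^sub>i\<^sub>j(E) = (e\<^sub>i + e\<^sub>j)\<^sup>T \<mu>(E) (e\<^sub>i + e\<^sub>j) - (e\<^sub>i - e\<^sub>j)\<^sup>T \<mu>(E) (e\<^sub>i - e\<^sub>j)\<close>;
  the integral against \<open>\<mu>\<close> is taken entrywise.\<close>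

definition matrix_integral ::
  "nat \<Rightarrow> (real set \<Rightarrow> real mat) \<Rightarrow> (real \<Rightarrow> complex) \<Rightarrow> complex mat" where
  "matrix_integral p \<mu> f = mat p p (\<lambda>(i,j).
     ((LINT t|quadratic_measure \<mu> (unit_vec p i + unit_vec p j). f t) -
      (LINT t|quadratic_measure \<mu> (unit_vec p i - unit_vec p j). f t)) / 4)"

definition stieltjes_function :: "nat \<Rightarrow> (complex \<Rightarrow> complex mat) \<Rightarrow> bool" where
  "stieltjes_function p G \<longleftrightarrow> (\<exists>C \<mu>.
     sym_pos_semidef p C \<and> psd_matrix_measure p \<mu> \<and>
     (\<forall>x \<in> carrier_vec p. integrable (quadratic_measure \<mu> x) (\<lambda>t. 1 / (1 + t))) \<and>
     (\<forall>s \<in> - \<real>\<^sub>\<le>\<^sub>0. G s =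
        cmat C + matrix_integral p \<mu> (\<lambda>t. 1 / (complex_of_real t + s))))"

text \<open>The second conjunct: at no \<open>x < 0\<close> can a value be assigned that makes \<open>G\<close> continuous on
  the slit plane together with \<open>x\<close>.\<close>

definition branch_cut_on_negative_reals :: "nat \<Rightarrow> (complex \<Rightarrow> complex mat) \<Rightarrow> bool" where
  "branch_cut_on_negative_reals p G \<longleftrightarrow>
     (\<forall>i<p. \<forall>j<p. (\<lambda>s. G s $$ (i,j)) holomorphic_on (- \<real>\<^sub>\<le>\<^sub>0)) \<and>
     (\<forall>x::real. x < 0 \<longrightarrow>
        \<not> (\<exists>L \<in> carrier_mat p p. \<forall>i<p. \<forall>j<p.
             ((\<lambda>s. G s $$ (i,j)) \<longlongrightarrow> L $$ (i,j)) (at (complex_of_real x) within - \<real>\<^sub>\<le>\<^sub>0)))"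


section \<open>Block Lanczos iteration\<close>

text \<open>All sequences are indexed from \<open>1\<close>, and values outside \<open>{1..m}\<close> (for \<open>\<beta>\<close>: outside
  \<open>{2..m}\<close>) are irrelevant.  \<open>lanczos_W A Q \<beta> i\<close> is the content of the variable \<open>W\<close> in step \<open>i\<close> at
  the moment \<open>\<alpha> i\<close> is computed; subtracting \<open>Q i * \<alpha> i\<close> gives its content at the end of step
  \<open>i\<close>.\<close>

definition lanczos_W ::
  "real mat \<Rightarrow> (nat \<Rightarrow> real mat) \<Rightarrow> (nat \<Rightarrow> real mat) \<Rightarrow> nat \<Rightarrow> real mat" where
  "lanczos_W A Q \<beta> i =
     (if i = 1 then A * Q 1 else A * Q i - Q (i - 1) * transpose_mat (\<beta> i))"

text \<open>The factor \<open>\<beta> i\<close> in the QR decomposition is an arbitrary \<open>p \<times> p\<close> matrix; upper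
  triangularity is not demanded.\<close>

definition block_lanczos ::
  "nat \<Rightarrow> nat \<Rightarrow> nat \<Rightarrow> real mat \<Rightarrow> real mat \<Rightarrow>
   (nat \<Rightarrow> real mat) \<Rightarrow> (nat \<Rightarrow> real mat) \<Rightarrow> (nat \<Rightarrow> real mat) \<Rightarrow> bool" where
  "block_lanczos n p m A B Q \<alpha> \<beta> \<longleftrightarrow>
     Q 1 = B \<and>
     (\<forall>i \<in> {1..m}. \<alpha> i = transpose_mat (Q i) * lanczos_W A Q \<beta> i) \<and>
     (\<forall>i \<in> {2..m}.
        Q i \<in> carrier_mat n p \<and> transpose_mat (Q i) * Q i = 1\<^sub>m p \<and> \<beta> i \<in> carrier_mat p p \<and>
        Q i * \<beta> i = lanczos_W A Q \<beta> (i - 1) - Q (i - 1) * \<alpha> (i - 1))"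

definition block_tridiag ::
  "nat \<Rightarrow> nat \<Rightarrow> (nat \<Rightarrow> real mat) \<Rightarrow> (nat \<Rightarrow> real mat) \<Rightarrow> real mat" where
  "block_tridiag m p \<alpha> \<beta> = mat (m * p) (m * p) (\<lambda>(r,c).
     let i = r div p + 1; j = c div p + 1; a = r mod p; b = c mod p in
       if i = j then \<alpha> i $$ (a,b)
       else if i = j + 1 then \<beta> i $$ (a,b)
       else if j = i + 1 then transpose_mat (\<beta> j) $$ (a,b)
       else 0)"

definition block_unit :: "nat \<Rightarrow> nat \<Rightarrow> nat \<Rightarrow> 'a::{zero,one} mat" where
  "block_unit m p i = mat (m * p) p (\<lambda>(r,c). if r = (i - 1) * p + c then 1 else 0)"

text \<open>The Stieltjes parameters; the values at index \<open>0\<close> are dummies.\<close>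

fun kappa_hat :: "nat \<Rightarrow> (nat \<Rightarrow> real mat) \<Rightarrow> (nat \<Rightarrow> real mat) \<Rightarrow> nat \<Rightarrow> real mat"
  and gamma :: "nat \<Rightarrow> (nat \<Rightarrow> real mat) \<Rightarrow> (nat \<Rightarrow> real mat) \<Rightarrow> nat \<Rightarrow> real mat" where
  "kappa_hat p \<alpha> \<beta> 0 = 1\<^sub>m p"
| "kappa_hat p \<alpha> \<beta> (Suc 0) = 1\<^sub>m p"
| "kappa_hat p \<alpha> \<beta> (Suc (Suc i)) =
     minv (- (gamma p \<alpha> \<beta> (Suc i) * transpose_mat (kappa_hat p \<alpha> \<beta> (Suc i)) *
              transpose_mat (\<beta> (Suc (Suc i)))))"
| "gamma p \<alpha> \<beta> 0 = 1\<^sub>m p"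
| "gamma p \<alpha> \<beta> (Suc 0) = minv (\<alpha> 1)"
| "gamma p \<alpha> \<beta> (Suc (Suc i)) =
     minv (transpose_mat (kappa_hat p \<alpha> \<beta> (Suc (Suc i))) * \<alpha> (Suc (Suc i)) *
             kappa_hat p \<alpha> \<beta> (Suc (Suc i)) - minv (gamma p \<alpha> \<beta> (Suc i)))"


section \<open>The three quadratures\<close>

definition resolvent_corner :: "nat \<Rightarrow> nat \<Rightarrow> complex mat \<Rightarrow> complex \<Rightarrow> complex mat" where
  "resolvent_corner m p T s =
     transpose_mat (block_unit m p 1) * minv (T + s \<cdot>\<^sub>m 1\<^sub>m (m * p)) * block_unit m p 1"

definition block_gauss ::
  "nat \<Rightarrow> nat \<Rightarrow> (nat \<Rightarrow> real mat) \<Rightarrow> (nat \<Rightarrow> real mat) \<Rightarrow> complex \<Rightarrow> complex mat" where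
  "block_gauss m p \<alpha> \<beta> s = resolvent_corner m p (cmat (block_tridiag m p \<alpha> \<beta>)) s"

definition delta_alpha ::
  "nat \<Rightarrow> nat \<Rightarrow> (nat \<Rightarrow> real mat) \<Rightarrow> (nat \<Rightarrow> real mat) \<Rightarrow> real mat \<Rightarrow> complex \<Rightarrow> complex mat" where
  "delta_alpha m p \<alpha> \<beta> \<phi> s =
     (let \<kappa>inv = cmat (minv (kappa_hat p \<alpha> \<beta> m)); \<gamma>inv = cmat (minv (gamma p \<alpha> \<beta> m)) in
        transpose_mat \<kappa>inv * \<gamma>inv * minv (\<gamma>inv + csqrt s \<cdot>\<^sub>m cmat \<phi>) * \<gamma>inv * \<kappa>inv)"

definition krein_nudelman ::
  "nat \<Rightarrow> nat \<Rightarrow> (nat \<Rightarrow> real mat) \<Rightarrow> (nat \<Rightarrow> real mat) \<Rightarrow> real mat \<Rightarrow> complex \<Rightarrow> complex mat" where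
  "krein_nudelman m p \<alpha> \<beta> \<phi> s =
     resolvent_corner m p
       (cmat (block_tridiag m p \<alpha> \<beta>) -
        block_unit m p m * delta_alpha m p \<alpha> \<beta> \<phi> s * transpose_mat (block_unit m p m)) s"

definition block_gauss_radau ::
  "nat \<Rightarrow> nat \<Rightarrow> (nat \<Rightarrow> real mat) \<Rightarrow> (nat \<Rightarrow> real mat) \<Rightarrow> complex \<Rightarrow> complex mat" where
  "block_gauss_radau m p \<alpha> \<beta> s =
     (let \<kappa>inv = minv (kappa_hat p \<alpha> \<beta> m) in
        resolvent_corner m p
          (cmat (block_tridiag m p \<alpha> \<beta> -
             block_unit m p m * (transpose_mat \<kappa>inv * minv (gamma p \<alpha> \<beta> m) * \<kappa>inv) *
             transpose_mat (block_unit m p m))) s)"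

end

theory Submission
  imports Defs "Jordan_Normal_Form.Determinant" "HOL-Complex_Analysis.Cauchy_Integral_Formula"
begin

unbundle no vec_syntax

text \<open>
  Everything becomes transparent in the variable \<open>z = sqrt s\<close>, which ranges over the right
  half-plane.  In the coordinates \<open>u\<^sub>i = \<kappa>\<^sub>i v\<^sub>i\<close> the block tridiagonal system with right-hand side in
  the first block is a ladder of first-order relations with coefficients \<open>K\<^sub>i = \<kappa>\<^sub>i\<^sup>T \<kappa>\<^sub>i\<close> and \<open>\<gamma>\<^sub>i\<close>, and
  eliminating the unknowns from the last rung upwards shows that each of the three quadratures
  is \<open>h(z) / z\<close>, where \<open>h\<close> is a finite matrix continued fraction
  \<open>h(z) = (z K\<^sub>1 + (z \<gamma>\<^sub>1 + (z K\<^sub>2 + \<dots> (z K\<^sub>m + (z \<gamma>\<^sub>m + X)\<^sup>-\<^sup>1)\<^sup>-\<^sup>1 \<dots>)\<^sup>-\<^sup>1)\<^sup>-\<^sup>1)\<^sup>-\<^sup>1\<close>.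
  The Krein--Nudelman quadrature has the terminal value \<open>X = \<phi>\<^sup>-\<^sup>1\<close>, the Gauss quadrature has
  \<open>X = 0\<close>, and the Gauss--Radau quadrature drops the rung \<open>\<gamma>\<^sub>m\<close> and starts from \<open>0\<close> one level
  higher (\<open>krein_nudelman_eq\<close>, \<open>gauss_eq\<close>, \<open>gauss_radau_eq\<close>).

  All \<open>K\<^sub>i\<close> and \<open>\<gamma>\<^sub>i\<close> are positive definite.  For \<open>\<gamma>\<^sub>i\<close> this is because
  \<open>\<gamma>\<^sub>i\<^sup>-\<^sup>1 = Z\<^sub>i\<^sup>T A Z\<^sub>i\<close> with \<open>Z\<^sub>i = Q\<^sub>1 \<kappa>\<^sub>1 + \<dots> + Q\<^sub>i \<kappa>\<^sub>i\<close>, an identity that rests on the orthogonality of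
  the Lanczos blocks (\<open>stieltjes_parameters\<close>).

  The two-sided bound: for \<open>z > 0\<close> every step \<open>X \<mapsto> (z M + X)\<^sup>-\<^sup>1\<close> reverses the Loewner order
  strictly.  The full ladder has an even number of steps, so \<open>0 < \<phi>\<^sup>-\<^sup>1\<close> gives Gauss below
  Krein--Nudelman.  The ladder without \<open>\<gamma>\<^sub>m\<close> has an odd number, so \<open>0 < (z \<gamma>\<^sub>m + \<phi>\<^sup>-\<^sup>1)\<^sup>-\<^sup>1\<close> gives
  Krein--Nudelman below Gauss--Radau (\<open>contfrac_strict_mono\<close>).

  The Stieltjes property: the same steps preserve positive definiteness of the Hermitian part on
  the closed half-plane \<open>Re z \<ge> 0\<close>, the point \<open>0\<close> included since \<open>\<phi>\<^sup>-\<^sup>1\<close> is positive definite.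
  Hence \<open>h\<close> has no pole there, and Cauchy's formula yields
  \<open>h(w) / w = 2/\<pi> \<integral>\<^sub>0\<^sup>\<infinity> Re h(iy) / (y\<^sup>2 + w\<^sup>2) dy\<close>.  With \<open>t = y\<^sup>2\<close> and \<open>s = w\<^sup>2\<close> this is a Stieltjes
  integral, whose measure is the image of \<open>2/\<pi> Re h(iy) dy\<close> under squaring.  Finally, the limits
  of \<open>h(z) / z\<close> at \<open>s = -y\<^sup>2\<close> from the two sides of the negative axis are \<open>h(iy) / (iy)\<close> and its
  conjugate.  They differ because \<open>Re h(iy)\<close> is positive definite, so the cut is genuine.
\<close>

abbreviation at_infinity_right :: "complex filter" where
  "at_infinity_right \<equiv> inf at_infinity (principal {z. 0 \<le> Re z})"

section \<open>A Poisson formula in the right half-plane\<close>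

text \<open>Cauchy's formula on the rectangle \<open>[0,n] \<times> [-n,n]\<close> for \<open>2 h(z) / (z + w)\<close>, which is regular in the
  right half-plane and takes the value \<open>h(w) / w\<close> at \<open>w\<close>.  On the three sides away from the imaginary
  axis the integrand is \<open>o(1/n)\<close>, so only the side on the axis survives in the limit.\<close>

lemma half_plane_cauchy_limit:
  fixes h :: "complex \<Rightarrow> complex"
  assumes cont: "continuous_on {z. 0 \<le> Re z} h"
    and holo: "h holomorphic_on {z. 0 < Re z}"
    and decay: "((\<lambda>z. h z / z) \<longlongrightarrow> 0) at_infinity_right"
    and w: "0 < Re w"
  shows "(\<lambda>n. integral {- real n..real n} (\<lambda>y. h (Complex 0 y) / (of_real (y\<^sup>2) + w\<^sup>2)))
           \<longlonglongrightarrow> pi * h w / w"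
proof -
  \<comment> \<open>Here \<open>F z = 2 h z / (z\<^sup>2 - w\<^sup>2)\<close>, which is \<open>o(1/|z|)\<close> because \<open>h z = o(z)\<close>.\<close>
  define F where "F z = 2 * h z / (z + w) / (z - w)" for z
  define I where "I N = integral {- N..N} (\<lambda>y. h (Complex 0 y) / (of_real (y\<^sup>2) + w\<^sup>2))" for N :: real
  have w0: "w \<noteq> 0" using w by auto
  have nz: "z + w \<noteq> 0" if "0 \<le> Re z" for z
  proof
    assume "z + w = 0"
    then have "Re z + Re w = 0" by (metis plus_complex.sel(1) zero_complex.sel(1))
    then show False using that w by auto
  qed
  have contF: "continuous_on ({z. 0 \<le> Re z} - {w}) F"
    unfolding F_def
    by (intro continuous_intros continuous_on_subset[OF cont]) (use nz in auto)
  have main: "norm (pi * h w / w - I N) \<le> 8 * e"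
    if e: "e > 0" and N: "N > 2 * cmod w" "N > 0"
      and small: "\<And>z. 0 \<le> Re z \<Longrightarrow> N \<le> cmod z \<Longrightarrow> cmod (h z / z) \<le> e" for N e :: real
  proof -
    define a1 a2 a3 a4 where "a1 = Complex 0 (-N)" and "a2 = Complex N (-N)"
      and "a3 = Complex N N" and "a4 = Complex 0 N"
    have rp: "rectpath a1 a3 = linepath a1 a2 +++ linepath a2 a3 +++ linepath a3 a4 +++ linepath a4 a1"
      by (simp add: rectpath_def Let_def a1_def a2_def a3_def a4_def)
    have cw: "\<bar>Re w\<bar> < N" "\<bar>Im w\<bar> < N"
      using abs_Re_le_cmod[of w] abs_Im_le_cmod[of w] N norm_ge_zero[of w] by linarith+
    have wbox: "w \<in> box a1 a3"
      using cw w by (auto simp: in_box_complex_iff a1_def a3_def)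
    have wn: "winding_number (rectpath a1 a3) w = 1"
      by (rule winding_number_rectpath[OF wbox])
    have sub: "path_image (rectpath a1 a3) \<subseteq> {z. 0 \<le> Re z} - {w}"
    proof -
      have "path_image (rectpath a1 a3) \<subseteq> cbox a1 a3 - box a1 a3"
        using N by (subst path_image_rectpath_cbox_minus_box) (auto simp: a1_def a3_def)
      then show ?thesis using wbox by (force simp: in_cbox_complex_iff a1_def)
    qed
    have int: "interior {z. 0 \<le> Re z} = {z. 0 < Re z}"
      using interior_halfspace_ge[of "1::complex" 0] by (simp add: inner_complex_def)
    have cv: "convex {z. 0 \<le> Re z}"
      using convex_halfspace_Re_ge[of 0] by simp
    have ci: "((\<lambda>z. 2 * h z / (z + w) / (z - w)) has_contour_integral
         (2 * pi * \<i> * winding_number (rectpath a1 a3) w * (2 * h w / (w + w)))) (rectpath a1 a3)"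
    proof (rule Cauchy_integral_formula_weak[where S = "{z. 0 \<le> Re z}" and k = "{}"])
      show "continuous_on {z. 0 \<le> Re z} (\<lambda>z. 2 * h z / (z + w))"
        by (intro continuous_intros cont) (use nz in auto)
      have "(\<lambda>z. 2 * h z / (z + w)) holomorphic_on {z. 0 < Re z}"
        by (intro holomorphic_intros holo) (use nz in force)
      then show "(\<lambda>z. 2 * h z / (z + w)) field_differentiable at x"
        if "x \<in> interior {z. 0 \<le> Re z} - {}" for x
        using that holomorphic_on_imp_differentiable_at[OF _ open_halfspace_Re_gt[of 0]] int by auto
    qed (use cv int w sub in auto)
    have ciF: "(F has_contour_integral (2 * pi * \<i> * (h w / w))) (rectpath a1 a3)"
      using ci wn w0 by (simp add: F_def[abs_def])
    have segs: "closed_segment a1 a2 \<subseteq> {z. 0 \<le> Re z} - {w}" "closed_segment a2 a3 \<subseteq> {z. 0 \<le> Re z} - {w}"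
      "closed_segment a3 a4 \<subseteq> {z. 0 \<le> Re z} - {w}" "closed_segment a4 a1 \<subseteq> {z. 0 \<le> Re z} - {w}"
      using sub unfolding rp by (auto simp: path_image_join)
    have fi: "F contour_integrable_on linepath a b"
      if "closed_segment a b \<subseteq> {z. 0 \<le> Re z} - {w}" for a b
      by (rule contour_integrable_continuous_linepath[OF continuous_on_subset[OF contF that]])
    have split: "2 * pi * \<i> * (h w / w) = contour_integral (linepath a1 a2) F
        + contour_integral (linepath a2 a3) F + contour_integral (linepath a3 a4) F
        + contour_integral (linepath a4 a1) F"
      using contour_integral_unique[OF ciF] fi segs unfolding rp by (simp add: add.assoc)
    \<comment> \<open>As \<open>|w| < |z| / 2\<close>, the denominator is at least \<open>|z|\<^sup>2 / 2\<close>.\<close>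
    have bd: "cmod (F z) \<le> 4 * e / N" if z: "0 \<le> Re z" "N \<le> cmod z" for z
    proof -
      have zn: "cmod z > 0" using z N by linarith
      have hz: "cmod (h z) \<le> e * cmod z"
        using small[OF z] zn by (simp add: norm_divide field_simps)
      have cz: "cmod w < cmod z / 2" using z N by linarith
      have "(cmod w)\<^sup>2 \<le> (cmod z / 2)\<^sup>2" using cz by (intro power_mono) auto
      then have "4 * (cmod w)\<^sup>2 \<le> (cmod z)\<^sup>2"
        by (simp add: power_divide)
      then have "(cmod z)\<^sup>2 / 2 \<le> (cmod z)\<^sup>2 - (cmod w)\<^sup>2"
        using zero_le_power2[of "cmod w"] by linarith
      also have "\<dots> \<le> cmod (z\<^sup>2 - w\<^sup>2)"
        using norm_triangle_ineq2[of "z\<^sup>2" "w\<^sup>2"] by (simp add: norm_power)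
      finally have d: "(cmod z)\<^sup>2 / 2 \<le> cmod (z\<^sup>2 - w\<^sup>2)" .
      have "F z = 2 * h z / (z\<^sup>2 - w\<^sup>2)"
        by (simp add: F_def power2_eq_square algebra_simps)
      then have "cmod (F z) = 2 * cmod (h z) / cmod (z\<^sup>2 - w\<^sup>2)"
        by (simp add: norm_divide norm_mult)
      also have "\<dots> \<le> 2 * (e * cmod z) / ((cmod z)\<^sup>2 / 2)"
        using hz d zn e by (intro frac_le) auto
      also have "\<dots> = 4 * e / cmod z" using zn by (simp add: power2_eq_square)
      also have "\<dots> \<le> 4 * e / N" using z N e zn by (intro divide_left_mono mult_pos_pos) auto
      finally show ?thesis .
    qed
    have seg_bound: "cmod (contour_integral (linepath a b) F) \<le> 4 * e / N * cmod (b - a)"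
      if "closed_segment a b \<subseteq> {z. 0 \<le> Re z} - {w}" "\<And>z. z \<in> closed_segment a b \<Longrightarrow> N \<le> cmod z" for a b
      by (rule contour_integral_bound_linepath[OF fi[OF that(1)]]) (use that bd e N in auto)
    have b1: "cmod (contour_integral (linepath a1 a2) F) \<le> 4 * e / N * N"
    proof -
      have "cmod (a2 - a1) = N"
        using N by (simp add: a1_def a2_def cmod_def)
      moreover have "N \<le> cmod z" if "z \<in> closed_segment a1 a2" for z
        using that N abs_Im_le_cmod[of z] by (auto simp: a1_def a2_def closed_segment_same_Im)
      ultimately show ?thesis using seg_bound[OF segs(1)] by simp
    qed
    have b2: "cmod (contour_integral (linepath a2 a3) F) \<le> 4 * e / N * (2 * N)"
    proof -
      have "cmod (a3 - a2) = 2 * N"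
        using N by (simp add: a2_def a3_def cmod_def real_sqrt_mult)
      moreover have "N \<le> cmod z" if "z \<in> closed_segment a2 a3" for z
        using that N abs_Re_le_cmod[of z] by (auto simp: a2_def a3_def closed_segment_same_Re)
      ultimately show ?thesis using seg_bound[OF segs(2)] by simp
    qed
    have b3: "cmod (contour_integral (linepath a3 a4) F) \<le> 4 * e / N * N"
    proof -
      have "cmod (a4 - a3) = N"
        using N by (simp add: a3_def a4_def cmod_def)
      moreover have "N \<le> cmod z" if "z \<in> closed_segment a3 a4" for z
        using that N abs_Im_le_cmod[of z] by (auto simp: a3_def a4_def closed_segment_same_Im)
      ultimately show ?thesis using seg_bound[OF segs(3)] by simp
    qed
    have "contour_integral (linepath a4 a1) F = - contour_integral (linepath a1 a4) F"
      using fi segs(4) by (intro contour_integral_reverse_linepath continuous_on_subset[OF contF]) auto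
    also have "contour_integral (linepath a1 a4) F = \<i> * integral {-N..N} (\<lambda>y. F (Complex 0 y))"
      by (rule contour_integral_linepath_same_Re) (use N in \<open>auto simp: a1_def a4_def\<close>)
    also have "(\<lambda>y. F (Complex 0 y)) = (\<lambda>y. (- 2) * (h (Complex 0 y) / (of_real (y\<^sup>2) + w\<^sup>2)))"
    proof
      fix y
      have "(Complex 0 y + w) * (Complex 0 y - w) = - (of_real (y\<^sup>2) + w\<^sup>2)"
        by (simp add: complex_eq_iff power2_eq_square algebra_simps)
      then show "F (Complex 0 y) = (- 2) * (h (Complex 0 y) / (of_real (y\<^sup>2) + w\<^sup>2))"
        unfolding F_def divide_divide_eq_left by (simp only: divide_minus_right) simp
    qed
    also have "integral {-N..N} \<dots> = (-2) * I N"
      unfolding I_def by (rule integral_mult_right)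
    finally have left: "contour_integral (linepath a4 a1) F = 2 * \<i> * I N" by simp
    have "2 * \<i> * (pi * h w / w - I N) = contour_integral (linepath a1 a2) F
        + contour_integral (linepath a2 a3) F + contour_integral (linepath a3 a4) F"
      using split left by (simp add: algebra_simps)
    then have "cmod (2 * \<i> * (pi * h w / w - I N)) \<le> 4 * e / N * N + 4 * e / N * (2 * N) + 4 * e / N * N"
      using b1 b2 b3 by (smt (verit) norm_triangle_ineq)
    then show ?thesis using N e by (simp add: norm_mult)
  qed
  show ?thesis
  proof (rule LIMSEQ_I)
    fix r :: real assume r: "r > 0"
    have "\<forall>\<^sub>F z in at_infinity_right. dist (h z / z) 0 < r / 16"
      using tendstoD[OF decay, of "r / 16"] r by auto
    then obtain R where R: "\<And>z. cmod z \<ge> R \<Longrightarrow> 0 \<le> Re z \<Longrightarrow> cmod (h z / z) < r / 16"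
      by (auto simp: eventually_inf_principal eventually_at_infinity)
    obtain n0 :: nat where n0: "real n0 > max R (max (2 * cmod w) 0)"
      using reals_Archimedean2 by blast
    have "cmod (integral {- real n..real n} (\<lambda>y. h (Complex 0 y) / (of_real (y\<^sup>2) + w\<^sup>2)) - pi * h w / w) < r"
      if "n \<ge> n0" for n
    proof -
      have "R < real n" "2 * cmod w < real n" "0 < real n"
        using n0 that of_nat_mono[of n0 n, where ?'a = real] by linarith+
      then have "norm (pi * h w / w - I (real n)) \<le> 8 * (r / 16)"
        using r R by (intro main) (auto intro!: less_imp_le)
      then show ?thesis using r by (simp add: I_def norm_minus_commute)
    qed
    then show "\<exists>no. \<forall>n\<ge>no. norm (integral {- real n..real n} (\<lambda>y. h (Complex 0 y) / (of_real (y\<^sup>2) + w\<^sup>2)) - pi * h w / w) < r"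
      by blast
  qed
qed

lemma continuous_on_imaginary_axis:
  assumes "continuous_on {z. 0 \<le> Re z} h"
  shows "continuous_on S (\<lambda>y. h (Complex 0 y))"
proof -
  have "continuous_on S (\<lambda>y. Complex 0 y)"
    by (simp add: Complex_eq continuous_intros)
  then show ?thesis
    by (rule continuous_on_compose2[OF assms]) auto
qed

text \<open>The factorization \<open>y\<^sup>2 + w\<^sup>2 = (w - iy) (w + iy)\<close> keeps the kernel bounded for fixed \<open>w\<close>.\<close>

lemma norm_square_sum_ge:
  assumes "0 < Re w"
  shows "(Re w)\<^sup>2 \<le> cmod (of_real (y\<^sup>2) + w\<^sup>2)"
proof -
  have "complex_of_real (y\<^sup>2) + w\<^sup>2 = (w - Complex 0 y) * (w + Complex 0 y)"
    by (simp add: complex_eq_iff power2_eq_square algebra_simps)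
  moreover have "Re w \<le> cmod (w - Complex 0 y)" "Re w \<le> cmod (w + Complex 0 y)"
    using complex_Re_le_cmod[of "w - Complex 0 y"] complex_Re_le_cmod[of "w + Complex 0 y"] by auto
  ultimately show ?thesis
    using assms by (simp add: norm_mult power2_eq_square mult_mono)
qed

lemma tendsto_indicator_exhaustion:
  fixes c :: "'a::real_normed_vector"
  shows "(\<lambda>n. indicator {0..real n} y *\<^sub>R c) \<longlonglongrightarrow> indicator {0..} y *\<^sub>R c"
proof (rule tendsto_eventually)
  obtain n0 where n0: "y \<le> real n0" using real_arch_simple by blast
  show "\<forall>\<^sub>F n in sequentially. indicator {0..real n} y *\<^sub>R c = indicator {0..} y *\<^sub>R c"
    using eventually_ge_at_top[of n0] by eventually_elim (use n0 in \<open>auto simp: indicator_def\<close>)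
qed

context
  fixes h :: "complex \<Rightarrow> complex"
  assumes cont: "continuous_on {z. 0 \<le> Re z} h"
    and holo: "h holomorphic_on {z. 0 < Re z}"
    and decay: "((\<lambda>z. h z / z) \<longlongrightarrow> 0) at_infinity_right"
    and sym: "\<And>z. 0 \<le> Re z \<Longrightarrow> h (cnj z) = cnj (h z)"
begin

text \<open>Folding the integral over \<open>[-n,n]\<close> at \<open>0\<close> adds \<open>h\<close> at conjugate points, which leaves twice the
  real part of \<open>h\<close>.\<close>

lemma half_plane_poisson_limit:
  assumes w: "0 < Re w"
  shows "(\<lambda>n. LINT y|lborel. indicator {0..real n} y *\<^sub>R
             (complex_of_real (Re (h (Complex 0 y))) / (of_real (y\<^sup>2) + w\<^sup>2)))
           \<longlonglongrightarrow> pi / 2 * (h w / w)"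
proof -
  let ?f = "\<lambda>y. h (Complex 0 y) / (of_real (y\<^sup>2) + w\<^sup>2)"
  let ?g = "\<lambda>y. complex_of_real (Re (h (Complex 0 y))) / (of_real (y\<^sup>2) + w\<^sup>2)"
  have nz: "complex_of_real (y\<^sup>2) + w\<^sup>2 \<noteq> 0" for y
    using norm_square_sum_ge[OF w, of y] w by auto
  have conth: "continuous_on S (\<lambda>y. h (Complex 0 y))" for S
    by (rule continuous_on_imaginary_axis[OF cont])
  have contf: "continuous_on S ?f" for S
    by (intro continuous_intros conth) (use nz in auto)
  have contg: "continuous_on S ?g" for S
    by (intro continuous_intros conth) (use nz in auto)
  have fint: "?f integrable_on {a..b}" and fint': "(\<lambda>y. ?f (- y)) integrable_on {a..b}" for a b
    by (rule integrable_continuous_real, rule contf)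
      (rule integrable_continuous_real, rule continuous_on_compose2[OF contf[of UNIV]],
        auto intro: continuous_intros)
  have "integral {- real n..real n} ?f = 2 * (LINT y|lborel. indicator {0..real n} y *\<^sub>R ?g y)" for n
  proof -
    have "integral {- real n..real n} ?f = integral {- real n..0} ?f + integral {0..real n} ?f"
      by (rule Henstock_Kurzweil_Integration.integral_combine[symmetric, OF _ _ fint]) auto
    also have "integral {- real n..0} ?f = integral {0..real n} (\<lambda>y. ?f (- y))"
      using Henstock_Kurzweil_Integration.integral_reflect_real[of "real n" 0 "\<lambda>y. ?f (- y)"] by simp
    also have "\<dots> + integral {0..real n} ?f = integral {0..real n} (\<lambda>y. ?f (- y) + ?f y)"
      by (rule Henstock_Kurzweil_Integration.integral_add[symmetric, OF fint' fint])
    also have "(\<lambda>y. ?f (- y) + ?f y) = (\<lambda>y. 2 * ?g y)"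
    proof
      fix y
      have "h (Complex 0 (- y)) + h (Complex 0 y) = 2 * complex_of_real (Re (h (Complex 0 y)))"
        using sym[of "Complex 0 y"] by (simp add: complex_eq_iff complex_cnj)
      then show "?f (- y) + ?f y = 2 * ?g y"
        by (simp add: add_divide_distrib[symmetric])
    qed
    also have "integral {0..real n} \<dots> = 2 * integral {0..real n} ?g"
      by (rule integral_mult_right)
    also have "integral {0..real n} ?g = (LINT y|lborel. indicator {0..real n} y *\<^sub>R ?g y)"
      using set_borel_integral_eq_integral(2)[OF borel_integrable_atLeastAtMost'[OF contg[of "{0..real n}"]]]
      by (simp add: set_lebesgue_integral_def)
    finally show ?thesis .
  qed
  moreover have "(\<lambda>n. 1 / 2 * integral {- real n..real n} ?f) \<longlonglongrightarrow> 1 / 2 * (pi * h w / w)"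
    by (intro tendsto_intros half_plane_cauchy_limit[OF cont holo decay w])
  ultimately show ?thesis by simp
qed

text \<open>For \<open>w = 1\<close> the truncated integrals of the nonnegative function increase to a finite limit, so
  monotone convergence gives integrability.\<close>

lemma half_plane_poisson_integrable:
  assumes pos: "\<And>y. 0 \<le> Re (h (Complex 0 y))"
  shows "integrable lborel (\<lambda>y. indicator {0..} y *\<^sub>R (Re (h (Complex 0 y)) / (1 + y\<^sup>2)))"
proof -
  let ?g = "\<lambda>y. Re (h (Complex 0 y)) / (1 + y\<^sup>2)"
  have conth: "continuous_on S (\<lambda>y. h (Complex 0 y))" for S
    by (rule continuous_on_imaginary_axis[OF cont])
  have contg: "continuous_on S ?g" for S
    by (intro continuous_intros conth) (simp add: add_nonneg_eq_0_iff)
  have [measurable]: "?g \<in> borel_measurable borel"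
    using contg by (rule borel_measurable_continuous_onI)
  have "(\<lambda>n. Re (LINT y|lborel. indicator {0..real n} y *\<^sub>R
             (complex_of_real (Re (h (Complex 0 y))) / (of_real (y\<^sup>2) + 1\<^sup>2))))
           \<longlonglongrightarrow> Re (pi / 2 * (h 1 / 1))"
    by (intro tendsto_Re half_plane_poisson_limit) auto
  also have "(\<lambda>n. Re (LINT y|lborel. indicator {0..real n} y *\<^sub>R
             (complex_of_real (Re (h (Complex 0 y))) / (of_real (y\<^sup>2) + 1\<^sup>2)))) =
      (\<lambda>n. LINT y|lborel. indicator {0..real n} y *\<^sub>R ?g y)"
  proof
    fix n
    have "(\<lambda>y. indicator {0..real n} y *\<^sub>R (complex_of_real (Re (h (Complex 0 y))) / (of_real (y\<^sup>2) + 1\<^sup>2)))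
      = (\<lambda>y. complex_of_real (indicator {0..real n} y *\<^sub>R ?g y))"
      by (auto simp: fun_eq_iff scaleR_conv_of_real add.commute)
    then show "Re (LINT y|lborel. indicator {0..real n} y *\<^sub>R
             (complex_of_real (Re (h (Complex 0 y))) / (of_real (y\<^sup>2) + 1\<^sup>2))) =
      (LINT y|lborel. indicator {0..real n} y *\<^sub>R ?g y)"
      by (simp only: integral_complex_of_real Re_complex_of_real)
  qed
  finally have lim: "(\<lambda>n. LINT y|lborel. indicator {0..real n} y *\<^sub>R ?g y) \<longlonglongrightarrow> Re (pi / 2 * (h 1 / 1))" .
  show ?thesis
  proof (rule integrable_monotone_convergence[OF _ _ _ lim])
    show "integrable lborel (\<lambda>y. indicator {0..real n} y *\<^sub>R ?g y)" for n
      using borel_integrable_atLeastAtMost'[OF contg] unfolding set_integrable_def .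
    show "AE y in lborel. mono (\<lambda>n. indicator {0..real n} y *\<^sub>R ?g y)"
      using pos by (intro AE_I2 monoI) (auto simp: indicator_def add_nonneg_pos)
    show "AE y in lborel. (\<lambda>n. indicator {0..real n} y *\<^sub>R ?g y) \<longlonglongrightarrow> indicator {0..} y *\<^sub>R ?g y"
      by (intro AE_I2 tendsto_indicator_exhaustion)
  qed measurable
qed

text \<open>The kernel at \<open>w\<close> is bounded by a multiple \<open>C\<close> of the kernel at \<open>1\<close>, so dominated convergence
  applies.\<close>

lemma half_plane_poisson_formula:
  assumes pos: "\<And>y. 0 \<le> Re (h (Complex 0 y))"
    and w: "0 < Re w"
  shows "(LINT y|lborel. indicator {0..} y *\<^sub>R
             (complex_of_real (Re (h (Complex 0 y))) / (of_real (y\<^sup>2) + w\<^sup>2))) = pi / 2 * (h w / w)"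
    and "integrable lborel (\<lambda>y. indicator {0..} y *\<^sub>R
             (complex_of_real (Re (h (Complex 0 y))) / (of_real (y\<^sup>2) + w\<^sup>2)))"
proof -
  let ?r = "\<lambda>y. Re (h (Complex 0 y))"
  let ?g = "\<lambda>y. complex_of_real (?r y) / (of_real (y\<^sup>2) + w\<^sup>2)"
  define C where "C = 2 + (2 + 2 * cmod (w\<^sup>2)) / (Re w)\<^sup>2"
  have d: "(Re w)\<^sup>2 \<le> cmod (of_real (y\<^sup>2) + w\<^sup>2)" for y
    by (rule norm_square_sum_ge[OF w])
  \<comment> \<open>The first summand of \<open>C\<close> serves large \<open>y\<close>, the second one bounded \<open>y\<close>.\<close>
  have C: "1 + y\<^sup>2 \<le> C * cmod (of_real (y\<^sup>2) + w\<^sup>2)" for y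
  proof (cases "1 + 2 * cmod (w\<^sup>2) \<le> y\<^sup>2")
    case True
    have "y\<^sup>2 - cmod (w\<^sup>2) \<le> cmod (of_real (y\<^sup>2) + w\<^sup>2)"
      using norm_diff_ineq[of "complex_of_real (y\<^sup>2)" "w\<^sup>2"] by (simp del: of_real_power)
    then have "1 + y\<^sup>2 \<le> 2 * cmod (of_real (y\<^sup>2) + w\<^sup>2)" using True by linarith
    also have "\<dots> \<le> C * cmod (of_real (y\<^sup>2) + w\<^sup>2)"
      unfolding C_def by (intro mult_right_mono) auto
    finally show ?thesis .
  next
    case False
    then have "1 + y\<^sup>2 \<le> (2 + 2 * cmod (w\<^sup>2)) / (Re w)\<^sup>2 * (Re w)\<^sup>2" using w by simp
    also have "\<dots> \<le> C * cmod (of_real (y\<^sup>2) + w\<^sup>2)"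
      unfolding C_def by (intro mult_mono d) auto
    finally show ?thesis .
  qed
  have conth: "continuous_on UNIV (\<lambda>y. h (Complex 0 y))"
    by (rule continuous_on_imaginary_axis[OF cont])
  then have [measurable]: "?r \<in> borel_measurable borel"
    by (intro borel_measurable_continuous_onI continuous_intros)
  have bound: "norm (?g y) \<le> C * (?r y / (1 + y\<^sup>2))" for y
  proof -
    have c: "cmod (of_real (y\<^sup>2) + w\<^sup>2) > 0"
      using less_le_trans[OF _ d[of y], of 0] w by simp
    have "?r y * (1 + y\<^sup>2) \<le> ?r y * (C * cmod (of_real (y\<^sup>2) + w\<^sup>2))"
      using pos C by (intro mult_left_mono)
    moreover have "1 + y\<^sup>2 > 0" by (simp add: add_pos_nonneg)
    ultimately show ?thesis using c pos[of y] by (simp add: norm_divide field_simps del: of_real_power)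
  qed
  have domi: "integrable lborel (\<lambda>y. C * (indicator {0..} y *\<^sub>R (?r y / (1 + y\<^sup>2))))"
    by (intro integrable_mult_right half_plane_poisson_integrable[OF pos])
  have lim: "AE y in lborel. (\<lambda>n. indicator {0..real n} y *\<^sub>R ?g y) \<longlonglongrightarrow> indicator {0..} y *\<^sub>R ?g y"
    by (intro AE_I2 tendsto_indicator_exhaustion)
  have le: "AE y in lborel. norm (indicator {0..real n} y *\<^sub>R ?g y)
      \<le> C * (indicator {0..} y *\<^sub>R (?r y / (1 + y\<^sup>2)))" for n
    using bound order_trans[OF norm_ge_zero bound] by (intro AE_I2) (simp add: indicator_def)
  have m1: "(\<lambda>y. indicator {0..} y *\<^sub>R ?g y) \<in> borel_measurable lborel" by measurable
  have m2: "(\<lambda>y. indicator {0..real n} y *\<^sub>R ?g y) \<in> borel_measurable lborel" for n by measurable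
  show "integrable lborel (\<lambda>y. indicator {0..} y *\<^sub>R ?g y)"
    by (rule integrable_dominated_convergence[OF m1 m2 domi lim le])
  have "(\<lambda>n. LINT y|lborel. indicator {0..real n} y *\<^sub>R ?g y) \<longlonglongrightarrow> (LINT y|lborel. indicator {0..} y *\<^sub>R ?g y)"
    by (rule integral_dominated_convergence[OF m1 m2 domi lim le])
  from LIMSEQ_unique[OF this half_plane_poisson_limit[OF w]]
  show "(LINT y|lborel. indicator {0..} y *\<^sub>R ?g y) = pi / 2 * (h w / w)" by simp
qed

end

section \<open>Matrix measures pushed forward by squaring\<close>

definition square_preimage :: "real set \<Rightarrow> real set" where
  "square_preimage E = {y. 0 \<le> y \<and> y\<^sup>2 \<in> E}"

text \<open>The image under \<open>y \<mapsto> y\<^sup>2\<close> of the matrix measure with density \<open>S\<close> on \<open>[0,\<infinity>)\<close>.  Keeping \<open>y\<close> as the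
  integration variable avoids the singular density \<open>S(sqrt t) / (2 sqrt t)\<close>.\<close>

definition square_pushforward :: "nat \<Rightarrow> (real \<Rightarrow> real mat) \<Rightarrow> real set \<Rightarrow> real mat" where
  "square_pushforward p S E = mat p p (\<lambda>(i,j).
     LINT y|lborel. indicator (square_preimage E) y *\<^sub>R S y $$ (i,j))"

definition quadratic_form :: "nat \<Rightarrow> 'a::comm_semiring_1 mat \<Rightarrow> (nat \<Rightarrow> 'a) \<Rightarrow> 'a" where
  "quadratic_form p M x = (\<Sum>i<p. \<Sum>j<p. x i * x j * M $$ (i,j))"

lemma scalar_prod_mult_vec_eq_quadratic_form:
  assumes "M \<in> carrier_mat p p" "x \<in> carrier_vec p"
  shows "scalar_prod x (M *\<^sub>v x) = quadratic_form p M (\<lambda>i. x $ i)"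
  using assms
  by (auto simp: scalar_prod_def quadratic_form_def sum_distrib_left atLeast0LessThan ac_simps intro!: sum.cong)

lemma square_preimage_borel: "E \<in> sets borel \<Longrightarrow> square_preimage E \<in> sets borel"
proof -
  assume [measurable]: "E \<in> sets borel"
  have "Measurable.pred borel (\<lambda>y. 0 \<le> y \<and> y\<^sup>2 \<in> E)" by measurable
  then show ?thesis unfolding square_preimage_def by (simp add: pred_def)
qed

lemma square_preimage_bounded:
  assumes "bounded E"
  obtains c where "square_preimage E \<subseteq> {0..c}"
proof -
  obtain b where b: "\<And>t. t \<in> E \<Longrightarrow> \<bar>t\<bar> \<le> b"
    using assms by (auto simp: bounded_real)
  have "y \<le> sqrt b" if "0 \<le> y" "y\<^sup>2 \<in> E" for y
    using b[OF that(2)] by (intro real_le_rsqrt) auto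
  then show ?thesis by (intro that[of "sqrt b"]) (auto simp: square_preimage_def)
qed

lemma integrable_on_square_preimage:
  fixes f :: "real \<Rightarrow> real"
  assumes "continuous_on UNIV f" and "E \<in> bounded_borel"
  shows "integrable lborel (\<lambda>y. indicator (square_preimage E) y *\<^sub>R f y)"
proof -
  from assms(2) obtain c where c: "square_preimage E \<subseteq> {0..c}"
    using square_preimage_bounded by (auto simp: bounded_borel_def)
  have "set_integrable lborel {0..c} f"
    by (rule borel_integrable_atLeastAtMost'[OF continuous_on_subset[OF assms(1)]]) auto
  then have "set_integrable lborel (square_preimage E) f"
    by (rule set_integrable_subset)
      (use c square_preimage_borel assms(2) in \<open>auto simp: bounded_borel_def\<close>)
  then show ?thesis by (simp add: set_integrable_def)
qed

lemma quadratic_form_square_pushforward: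
  assumes S: "\<And>i j. i < p \<Longrightarrow> j < p \<Longrightarrow> continuous_on UNIV (\<lambda>y. S y $$ (i,j))"
    and E: "E \<in> bounded_borel" and x: "x \<in> carrier_vec p"
  shows "scalar_prod x (square_pushforward p S E *\<^sub>v x) =
    (LINT y|lborel. indicator (square_preimage E) y *\<^sub>R quadratic_form p (S y) (\<lambda>i. x $ i))"
proof -
  have int: "integrable lborel (\<lambda>y. indicator (square_preimage E) y *\<^sub>R S y $$ (i,j))" if "i < p" "j < p" for i j
    by (rule integrable_on_square_preimage[OF S E]) (use that in auto)
  have "scalar_prod x (square_pushforward p S E *\<^sub>v x) =
     (\<Sum>i<p. \<Sum>j<p. x $ i * x $ j * (LINT y|lborel. indicator (square_preimage E) y *\<^sub>R S y $$ (i,j)))"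
    by (subst scalar_prod_mult_vec_eq_quadratic_form[OF _ x])
      (auto simp: square_pushforward_def quadratic_form_def)
  also have "\<dots> = (LINT y|lborel. (\<Sum>i<p. \<Sum>j<p. x $ i * x $ j * (indicator (square_preimage E) y *\<^sub>R S y $$ (i,j))))"
    using int by (subst Bochner_Integration.integral_sum, force)
      (auto intro!: sum.cong simp: Bochner_Integration.integral_sum)
  also have "\<dots> = (LINT y|lborel. indicator (square_preimage E) y *\<^sub>R quadratic_form p (S y) (\<lambda>i. x $ i))"
    by (intro Bochner_Integration.integral_cong)
       (auto simp: quadratic_form_def sum_distrib_left ac_simps)
  finally show ?thesis .
qed

lemma continuous_on_quadratic_form:
  fixes S :: "real \<Rightarrow> real mat"
  assumes S: "\<And>i j. i < p \<Longrightarrow> j < p \<Longrightarrow> continuous_on UNIV (\<lambda>y. S y $$ (i,j))"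
  shows "continuous_on UNIV (\<lambda>y. quadratic_form p (S y) x)"
  unfolding quadratic_form_def by (intro continuous_intros S) auto

text \<open>Countable additivity holds entrywise by dominated convergence, even though the entries of \<open>S\<close>
  may change sign, because they are integrable over preimages of bounded sets.\<close>

lemma psd_matrix_measure_square_pushforward:
  assumes S: "\<And>i j. i < p \<Longrightarrow> j < p \<Longrightarrow> continuous_on UNIV (\<lambda>y. S y $$ (i,j))"
    and sym: "\<And>y i j. i < p \<Longrightarrow> j < p \<Longrightarrow> S y $$ (i,j) = S y $$ (j,i)"
    and psd: "\<And>y x. 0 \<le> quadratic_form p (S y) x"
  shows "psd_matrix_measure p (square_pushforward p S)"
  unfolding psd_matrix_measure_def
proof (intro conjI ballI allI impI)
  fix E assume E: "E \<in> bounded_borel"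
  show "sym_pos_semidef p (square_pushforward p S E)"
    unfolding sym_pos_semidef_def
  proof (intro conjI ballI)
    show "square_pushforward p S E \<in> carrier_mat p p"
      by (simp add: square_pushforward_def)
    show "(square_pushforward p S E)\<^sup>T = square_pushforward p S E"
      by (rule eq_matI) (auto simp: square_pushforward_def sym intro!: Bochner_Integration.integral_cong)
    show "0 \<le> scalar_prod x (square_pushforward p S E *\<^sub>v x)" if x: "x \<in> carrier_vec p" for x
      by (subst quadratic_form_square_pushforward[OF S E x]) (assumption+,
        intro Bochner_Integration.integral_nonneg, auto simp: psd)
  qed
next
  fix E :: "nat \<Rightarrow> real set" and i j
  assume E: "range E \<subseteq> bounded_borel" and disj: "disjoint_family E"
    and U: "(\<Union>k. E k) \<in> bounded_borel" and ij: "i < p" "j < p"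
  let ?A = "\<lambda>k. square_preimage (E k)" and ?f = "\<lambda>y. S y $$ (i,j)"
  have int: "integrable lborel (\<lambda>y. indicator (square_preimage F) y *\<^sub>R ?f y)" if "F \<in> bounded_borel" for F
    by (rule integrable_on_square_preimage[OF S that]) (use ij in auto)
  have UA: "square_preimage (\<Union>k. E k) = (\<Union>k. ?A k)"
    by (auto simp: square_preimage_def)
  have dA: "disjoint_family ?A"
    using disj by (fastforce simp: disjoint_family_on_def square_preimage_def)
  have sumA: "(\<Sum>k<n. indicator (?A k) y :: real) = indicator (\<Union>k<n. ?A k) y" for n y
    by (rule indicator_UN_disjoint[symmetric]) (use dA in \<open>auto simp: disjoint_family_on_def\<close>)
  have "(\<lambda>n. LINT y|lborel. (\<Sum>k<n. indicator (?A k) y *\<^sub>R ?f y))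
      \<longlonglongrightarrow> (LINT y|lborel. indicator (\<Union>k. ?A k) y *\<^sub>R ?f y)"
  proof (rule integral_dominated_convergence[where w = "\<lambda>y. norm (indicator (\<Union>k. ?A k) y *\<^sub>R ?f y)"])
    show "integrable lborel (\<lambda>y. norm (indicator (\<Union>k. ?A k) y *\<^sub>R ?f y))"
      using int[OF U] UA by (intro integrable_norm) simp
    show "(\<lambda>y. indicator (\<Union>k. ?A k) y *\<^sub>R ?f y) \<in> borel_measurable lborel"
      using int[OF U] UA by (intro borel_measurable_integrable) simp
    show "(\<lambda>y. \<Sum>k<n. indicator (?A k) y *\<^sub>R ?f y) \<in> borel_measurable lborel" for n
      using E by (intro borel_measurable_sum borel_measurable_integrable int) auto
    show "AE y in lborel. (\<lambda>n. \<Sum>k<n. indicator (?A k) y *\<^sub>R ?f y) \<longlonglongrightarrow> indicator (\<Union>k. ?A k) y *\<^sub>R ?f y"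
    proof (rule AE_I2)
      fix y :: real
      have "(\<lambda>k. indicator (?A k) y :: real) sums indicator (\<Union>k. ?A k) y"
        by (rule indicator_sums) (use dA in \<open>auto simp: disjoint_family_on_def\<close>)
      then have "(\<lambda>k. indicator (?A k) y *\<^sub>R ?f y) sums (indicator (\<Union>k. ?A k) y *\<^sub>R ?f y)"
        by (rule sums_scaleR_left)
      then show "(\<lambda>n. \<Sum>k<n. indicator (?A k) y *\<^sub>R ?f y) \<longlonglongrightarrow> indicator (\<Union>k. ?A k) y *\<^sub>R ?f y"
        by (simp add: sums_def)
    qed
    show "AE y in lborel. norm (\<Sum>k<n. indicator (?A k) y *\<^sub>R ?f y) \<le> norm (indicator (\<Union>k. ?A k) y *\<^sub>R ?f y)" for n
    proof (rule AE_I2)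
      fix y
      have "(\<Sum>k<n. indicator (?A k) y *\<^sub>R ?f y) = indicator (\<Union>k<n. ?A k) y *\<^sub>R ?f y"
        by (simp only: scaleR_left.sum[symmetric] sumA)
      then show "norm (\<Sum>k<n. indicator (?A k) y *\<^sub>R ?f y) \<le> norm (indicator (\<Union>k. ?A k) y *\<^sub>R ?f y)"
        by (auto simp: indicator_def)
    qed
  qed
  moreover have "(LINT y|lborel. (\<Sum>k<n. indicator (?A k) y *\<^sub>R ?f y)) =
      (\<Sum>k<n. LINT y|lborel. indicator (?A k) y *\<^sub>R ?f y)" for n
    by (intro Bochner_Integration.integral_sum int) (use E in auto)
  ultimately show "(\<lambda>k. square_pushforward p S (E k) $$ (i,j)) sums (square_pushforward p S (\<Union>k. E k) $$ (i,j))"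
    using ij by (simp add: sums_def square_pushforward_def UA)
qed

text \<open>The exhaustion by \<open>[0,N]\<close> in the definition of the quadratic measure is monotone convergence for
  the nonnegative density \<open>x\<^sup>T S x\<close>.\<close>

lemma quadratic_measure_square_pushforward:
  assumes S: "\<And>i j. i < p \<Longrightarrow> j < p \<Longrightarrow> continuous_on UNIV (\<lambda>y. S y $$ (i,j))"
    and psd: "\<And>y x. 0 \<le> quadratic_form p (S y) x"
    and x: "x \<in> carrier_vec p"
  shows "quadratic_measure (square_pushforward p S) x =
     distr (density lborel (\<lambda>y. ennreal (indicator {0..} y * quadratic_form p (S y) (\<lambda>i. x $ i))))
       borel (\<lambda>y. y\<^sup>2)" (is "_ = ?D")
proof -
  let ?q = "\<lambda>y. quadratic_form p (S y) (\<lambda>i. x $ i)"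
  have cq: "continuous_on UNIV ?q" by (rule continuous_on_quadratic_form[OF S])
  then have [measurable]: "?q \<in> borel_measurable borel"
    by (rule borel_measurable_continuous_onI)
  have eq: "(SUP N::nat. ennreal (scalar_prod x (square_pushforward p S (E \<inter> {0..real N}) *\<^sub>v x))) = emeasure ?D E"
    if E[measurable]: "E \<in> sets borel" for E
  proof -
    let ?A = "\<lambda>N::nat. square_preimage (E \<inter> {0..real N})"
    have bb: "E \<inter> {0..real N} \<in> bounded_borel" for N
      by (auto simp: bounded_borel_def intro: bounded_subset[OF bounded_closed_interval[of 0 "real N"]])
    have [measurable]: "?A N \<in> sets borel" for N
      by (rule square_preimage_borel) simp
    have "ennreal (scalar_prod x (square_pushforward p S (E \<inter> {0..real N}) *\<^sub>v x)) =
      (\<integral>\<^sup>+y. ennreal (indicator (?A N) y *\<^sub>R ?q y) \<partial>lborel)" for N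
      by (subst quadratic_form_square_pushforward[OF S bb x], assumption+, rule nn_integral_eq_integral[symmetric, OF integrable_on_square_preimage[OF cq bb]])
        (auto simp: psd)
    then have "(SUP N::nat. ennreal (scalar_prod x (square_pushforward p S (E \<inter> {0..real N}) *\<^sub>v x))) =
      (SUP N::nat. \<integral>\<^sup>+y. ennreal (indicator (?A N) y *\<^sub>R ?q y) \<partial>lborel)" by simp
    also have "\<dots> = (\<integral>\<^sup>+y. (SUP N::nat. ennreal (indicator (?A N) y *\<^sub>R ?q y)) \<partial>lborel)"
    proof (rule nn_integral_monotone_convergence_SUP[symmetric])
      show "incseq (\<lambda>N y. ennreal (indicator (?A N) y *\<^sub>R ?q y))"
        by (intro incseq_SucI le_funI ennreal_leI)
          (auto simp: indicator_def square_preimage_def psd)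
    qed measurable
    also have "\<dots> = (\<integral>\<^sup>+y. ennreal (indicator {0..} y * ?q y) * indicator ((\<lambda>y. y\<^sup>2) -` E) y \<partial>lborel)"
    proof (rule nn_integral_cong)
      fix y :: real
      obtain N0 :: nat where N0: "y\<^sup>2 \<le> real N0" using real_arch_simple by blast
      show "(SUP N::nat. ennreal (indicator (?A N) y *\<^sub>R ?q y)) =
        ennreal (indicator {0..} y * ?q y) * indicator ((\<lambda>y. y\<^sup>2) -` E) y"
      proof (rule antisym)
        show "(SUP N::nat. ennreal (indicator (?A N) y *\<^sub>R ?q y)) \<le>
          ennreal (indicator {0..} y * ?q y) * indicator ((\<lambda>y. y\<^sup>2) -` E) y"
          by (intro SUP_least) (auto simp: indicator_def square_preimage_def)
        have "ennreal (indicator {0..} y * ?q y) * indicator ((\<lambda>y. y\<^sup>2) -` E) y =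
           ennreal (indicator (?A N0) y *\<^sub>R ?q y)"
          using N0 by (auto simp: indicator_def square_preimage_def)
        also have "\<dots> \<le> (SUP N::nat. ennreal (indicator (?A N) y *\<^sub>R ?q y))"
          by (rule SUP_upper) simp
        finally show "ennreal (indicator {0..} y * ?q y) * indicator ((\<lambda>y. y\<^sup>2) -` E) y
          \<le> (SUP N::nat. ennreal (indicator (?A N) y *\<^sub>R ?q y))" .
      qed
    qed
    also have "\<dots> = emeasure ?D E"
    proof -
      have "(\<lambda>y::real. y\<^sup>2) -` E \<in> sets borel"
        using measurable_sets[of "\<lambda>y::real. y\<^sup>2" borel borel E] by simp
      then show ?thesis
        by (subst emeasure_distr, simp, simp, subst emeasure_density) auto
    qed
    finally show ?thesis .
  qed
  have "quadratic_measure (square_pushforward p S) x = measure_of UNIV (sets borel) (emeasure ?D)"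
    unfolding quadratic_measure_def
    by (rule measure_of_eq) (use eq sets.sigma_sets_eq[of "borel :: real measure"] in auto)
  also have "\<dots> = ?D" using measure_of_of_measure[of ?D] by simp
  finally show ?thesis .
qed

section \<open>Positive real matrix functions of the square root\<close>

lemma quadratic_form_polarization:
  fixes M :: "'a::comm_ring_1 mat"
  assumes "i < p" "j < p" "M $$ (i,j) = M $$ (j,i)"
  shows "quadratic_form p M (\<lambda>k. (if k = i then 1 else 0) + (if k = j then 1 else 0)) -
         quadratic_form p M (\<lambda>k. (if k = i then 1 else 0) - (if k = j then 1 else 0)) = 4 * M $$ (i,j)"
proof -
  have delta: "(\<Sum>k<p. (if k = l then 1 else 0) * f k) = f l" if "l < p" for l and f :: "nat \<Rightarrow> 'a"
    using that by (simp add: if_distrib[of "\<lambda>x. x * _"] cong: if_cong)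
  have "quadratic_form p M (\<lambda>k. (if k = i then 1 else 0) + (if k = j then 1 else 0)) -
         quadratic_form p M (\<lambda>k. (if k = i then 1 else 0) - (if k = j then 1 else 0)) =
     (\<Sum>k<p. \<Sum>l<p. (if k = i then 1 else 0) * ((if l = j then 1 else 0) * (2 * M $$ (k,l)))) +
     (\<Sum>k<p. \<Sum>l<p. (if k = j then 1 else 0) * ((if l = i then 1 else 0) * (2 * M $$ (k,l))))"
    unfolding quadratic_form_def sum_subtractf[symmetric] sum.distrib[symmetric]
    by (intro sum.cong refl) (simp add: algebra_simps)
  also have "\<dots> = 2 * M $$ (i,j) + 2 * M $$ (j,i)"
    by (simp only: sum_distrib_left[symmetric] delta assms(1,2))
  finally show ?thesis using assms(3) by simp
qed

lemma Re_quadratic_form: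
  "Re (quadratic_form p M (\<lambda>i. complex_of_real (x i))) = quadratic_form p (map_mat Re M) x"
  if "M \<in> carrier_mat p p"
  using that by (auto simp: quadratic_form_def intro!: sum.cong)

lemma quadratic_form_cong: "(\<And>i. i < p \<Longrightarrow> x i = y i) \<Longrightarrow> quadratic_form p M x = quadratic_form p M y"
  by (simp add: quadratic_form_def)

lemma Re_csqrt_pos:
  assumes "s \<notin> \<real>\<^sub>\<le>\<^sub>0"
  shows "0 < Re (csqrt s)"
proof (rule ccontr)
  assume "\<not> 0 < Re (csqrt s)"
  then have "Re (csqrt s) = 0" using Re_csqrt[of s] by simp
  moreover have "w\<^sup>2 \<in> \<real>\<^sub>\<le>\<^sub>0" if "Re w = 0" for w
    using that by (simp add: complex_nonpos_Reals_iff Re_power2 Im_power2)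
  ultimately have "(csqrt s)\<^sup>2 \<in> \<real>\<^sub>\<le>\<^sub>0" by blast
  then show False using assms by simp
qed

text \<open>The Poisson formula applies to \<open>x\<^sup>T H x\<close> for each real vector \<open>x\<close> and gives the quadratic measures;
  polarization recovers the entries of \<open>H\<close>.  The constant term of the representation is \<open>0\<close> because
  \<open>H(z) / z\<close> vanishes at infinity.\<close>

theorem stieltjes_function_if_positive_real:
  fixes H :: "complex \<Rightarrow> complex mat"
  assumes carr: "\<And>z. H z \<in> carrier_mat p p"
    and cont: "\<And>i j. i < p \<Longrightarrow> j < p \<Longrightarrow> continuous_on {z. 0 \<le> Re z} (\<lambda>z. H z $$ (i,j))"
    and holo: "\<And>i j. i < p \<Longrightarrow> j < p \<Longrightarrow> (\<lambda>z. H z $$ (i,j)) holomorphic_on {z. 0 < Re z}"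
    and decay: "\<And>i j. i < p \<Longrightarrow> j < p \<Longrightarrow>
      ((\<lambda>z. H z $$ (i,j) / z) \<longlongrightarrow> 0) at_infinity_right"
    and cnj: "\<And>z i j. 0 \<le> Re z \<Longrightarrow> i < p \<Longrightarrow> j < p \<Longrightarrow> H (cnj z) $$ (i,j) = cnj (H z $$ (i,j))"
    and sym: "\<And>z i j. 0 \<le> Re z \<Longrightarrow> i < p \<Longrightarrow> j < p \<Longrightarrow> H z $$ (i,j) = H z $$ (j,i)"
    and pos: "\<And>y x. 0 \<le> Re (quadratic_form p (H (Complex 0 y)) (\<lambda>i. complex_of_real (x i)))"
    and G: "\<And>s. s \<notin> \<real>\<^sub>\<le>\<^sub>0 \<Longrightarrow> G s = (1 / csqrt s) \<cdot>\<^sub>m H (csqrt s)"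
  shows "stieltjes_function p G"
proof -
  define S where "S y = (2 / pi) \<cdot>\<^sub>m map_mat Re (H (Complex 0 y))" for y
  define h where "h x z = quadratic_form p (H z) (\<lambda>i. complex_of_real (x i))" for x z
  have Sc: "S y \<in> carrier_mat p p" for y using carr by (simp add: S_def)
  have dims: "dim_row (H z) = p" "dim_col (H z) = p" for z using carr[of z] by auto
  have qS: "quadratic_form p (S y) x = 2 / pi * Re (h x (Complex 0 y))" for y x
    by (simp add: h_def Re_quadratic_form[OF carr] S_def quadratic_form_def sum_distrib_left dims ac_simps)
  have conth: "continuous_on {z. 0 \<le> Re z} (h x)" for x
    unfolding h_def quadratic_form_def by (intro continuous_intros cont) auto
  have holoh: "h x holomorphic_on {z. 0 < Re z}" for x
    unfolding h_def quadratic_form_def by (intro holomorphic_intros holo) auto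
  have decayh: "((\<lambda>z. h x z / z) \<longlongrightarrow> 0) at_infinity_right" for x
  proof -
    have "((\<lambda>z. \<Sum>i<p. \<Sum>j<p. of_real (x i) * of_real (x j) * (H z $$ (i,j) / z)) \<longlongrightarrow>
        (\<Sum>i<p. \<Sum>j<p. of_real (x i) * of_real (x j) * 0)) at_infinity_right"
      by (intro tendsto_intros decay) auto
    then show ?thesis by (simp add: h_def quadratic_form_def sum_divide_distrib)
  qed
  have cnjh: "h x (cnj z) = cnj (h x z)" if "0 \<le> Re z" for x z
    using that by (simp add: h_def quadratic_form_def cnj)
  have posh: "0 \<le> Re (h x (Complex 0 y))" for x y
    unfolding h_def by (rule pos)
  have contS: "continuous_on UNIV (\<lambda>y. S y $$ (i,j))" if "i < p" "j < p" for i j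
    using that by (simp add: S_def dims) (intro continuous_intros continuous_on_imaginary_axis[OF cont], auto)
  have symS: "S y $$ (i,j) = S y $$ (j,i)" if "i < p" "j < p" for y i j
    using that sym[of "Complex 0 y" i j] by (simp add: S_def dims)
  have psdS: "0 \<le> quadratic_form p (S y) x" for x y
    unfolding qS using posh by simp
  have qm: "quadratic_measure (square_pushforward p S) x =
     distr (density lborel (\<lambda>y. ennreal (indicator {0..} y * quadratic_form p (S y) (\<lambda>i. x $ i))))
       borel (\<lambda>y. y\<^sup>2)" if "x \<in> carrier_vec p" for x
    by (rule quadratic_measure_square_pushforward) (use that contS psdS in auto)
  have [measurable]: "(\<lambda>y. quadratic_form p (S y) x) \<in> borel_measurable borel" for x
    by (rule borel_measurable_continuous_onI, rule continuous_on_quadratic_form) (rule contS)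
  have integrable: "integrable (quadratic_measure (square_pushforward p S) x) (\<lambda>t. 1 / (1 + t))"
    if x: "x \<in> carrier_vec p" for x
  proof -
    have "integrable lborel (\<lambda>y. 2 / pi * (indicator {0..} y *\<^sub>R (Re (h (\<lambda>i. x $ i) (Complex 0 y)) / (1 + y\<^sup>2))))"
      by (intro integrable_mult_right half_plane_poisson_integrable conth holoh decayh cnjh posh)
    then have "integrable lborel (\<lambda>y. (indicator {0..} y * quadratic_form p (S y) (\<lambda>i. x $ i)) *\<^sub>R (1 / (1 + y\<^sup>2)))"
      by (simp add: qS ac_simps)
    then show ?thesis
      unfolding qm[OF x]
      by (subst integrable_distr_eq, simp, simp, subst integrable_density) (auto simp: psdS)
  qed
  have integral: "(LINT t|quadratic_measure (square_pushforward p S) x. 1 / (complex_of_real t + s)) =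
      h (\<lambda>i. x $ i) (csqrt s) / csqrt s"
    if x: "x \<in> carrier_vec p" and s: "s \<notin> \<real>\<^sub>\<le>\<^sub>0" for x s
  proof -
    have w: "0 < Re (csqrt s)" by (rule Re_csqrt_pos[OF s])
    have "(LINT t|quadratic_measure (square_pushforward p S) x. 1 / (complex_of_real t + s)) =
      (LINT y|lborel. (indicator {0..} y * quadratic_form p (S y) (\<lambda>i. x $ i)) *\<^sub>R (1 / (complex_of_real (y\<^sup>2) + s)))"
      unfolding qm[OF x]
      by (subst integral_distr, simp, simp, subst integral_density) (auto simp: psdS)
    also have "\<dots> = (LINT y|lborel. (2 / pi) * (indicator {0..} y *\<^sub>R
          (complex_of_real (Re (h (\<lambda>i. x $ i) (Complex 0 y))) / (of_real (y\<^sup>2) + (csqrt s)\<^sup>2))))"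
      by (intro Bochner_Integration.integral_cong) (auto simp: qS scaleR_conv_of_real)
    also have "\<dots> = (2 / pi) * (pi / 2 * (h (\<lambda>i. x $ i) (csqrt s) / csqrt s))"
      by (subst integral_mult_right_zero,
          subst half_plane_poisson_formula(1)[OF conth holoh decayh cnjh posh w]) auto
    finally show ?thesis by simp
  qed
  show ?thesis
    unfolding stieltjes_function_def
  proof (intro exI[of _ "0\<^sub>m p p"] exI[of _ "square_pushforward p S"] conjI ballI)
    show "sym_pos_semidef p (0\<^sub>m p p)"
      by (auto simp: sym_pos_semidef_def scalar_prod_def)
    show "psd_matrix_measure p (square_pushforward p S)"
      by (rule psd_matrix_measure_square_pushforward) (use contS symS psdS in auto)
    show "integrable (quadratic_measure (square_pushforward p S) x) (\<lambda>t. 1 / (1 + t))"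
      if "x \<in> carrier_vec p" for x by (rule integrable[OF that])
    fix s :: complex assume "s \<in> - \<real>\<^sub>\<le>\<^sub>0"
    then have s: "s \<notin> \<real>\<^sub>\<le>\<^sub>0" by simp
    have "((LINT t|quadratic_measure (square_pushforward p S) (unit_vec p i + unit_vec p j). 1 / (complex_of_real t + s)) -
      (LINT t|quadratic_measure (square_pushforward p S) (unit_vec p i - unit_vec p j). 1 / (complex_of_real t + s))) / 4
       = H (csqrt s) $$ (i,j) / csqrt s" if ij: "i < p" "j < p" for i j
    proof -
      let ?w = "csqrt s"
      have "h (\<lambda>k. (unit_vec p i + unit_vec p j) $ k) ?w - h (\<lambda>k. (unit_vec p i - unit_vec p j) $ k) ?w
        = quadratic_form p (H ?w) (\<lambda>k. (if k = i then 1 else 0) + (if k = j then 1 else 0)) -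
         quadratic_form p (H ?w) (\<lambda>k. (if k = i then 1 else 0) - (if k = j then 1 else 0))"
        unfolding h_def using ij by (intro arg_cong2[of _ _ _ _ "(-)"] quadratic_form_cong) auto
      also have "\<dots> = 4 * H ?w $$ (i,j)"
        by (rule quadratic_form_polarization[OF ij sym[OF Re_csqrt ij]])
      finally have "h (\<lambda>k. (unit_vec p i + unit_vec p j) $ k) ?w -
          h (\<lambda>k. (unit_vec p i - unit_vec p j) $ k) ?w = 4 * H ?w $$ (i,j)" .
      then show ?thesis
        by (subst (1 2) integral[OF _ s]) (auto simp: diff_divide_distrib[symmetric])
    qed
    then show "G s = cmat (0\<^sub>m p p) + matrix_integral p (square_pushforward p S) (\<lambda>t. 1 / (complex_of_real t + s))"
      unfolding G[OF s] by (intro eq_matI) (auto simp: matrix_integral_def dims)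
  qed
qed

text \<open>Approaching \<open>-y\<^sup>2\<close> along \<open>z\<^sup>2\<close> and along its conjugate, with \<open>z\<close> tending to \<open>iy\<close> from the right,
  gives the two limits \<open>c\<close> and \<open>cnj c\<close> for \<open>c = h(iy) / (iy)\<close>, where \<open>h\<close> is a diagonal entry.  A common value would be
  real, which forces \<open>Re h(iy) = 0\<close>.\<close>

theorem branch_cut_if_strictly_positive_real:
  fixes H :: "complex \<Rightarrow> complex mat"
  assumes carr: "\<And>z. H z \<in> carrier_mat p p"
    and cont: "\<And>i j. i < p \<Longrightarrow> j < p \<Longrightarrow> continuous_on {z. 0 \<le> Re z} (\<lambda>z. H z $$ (i,j))"
    and holo: "\<And>i j. i < p \<Longrightarrow> j < p \<Longrightarrow> (\<lambda>z. H z $$ (i,j)) holomorphic_on {z. 0 < Re z}"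
    and cnj: "\<And>z i j. 0 \<le> Re z \<Longrightarrow> i < p \<Longrightarrow> j < p \<Longrightarrow> H (cnj z) $$ (i,j) = cnj (H z $$ (i,j))"
    and pos: "\<And>y. 0 < y \<Longrightarrow> 0 < Re (H (Complex 0 y) $$ (k,k))" and k: "k < p"
    and G: "\<And>s. s \<notin> \<real>\<^sub>\<le>\<^sub>0 \<Longrightarrow> G s = (1 / csqrt s) \<cdot>\<^sub>m H (csqrt s)"
  shows "branch_cut_on_negative_reals p G"
  unfolding branch_cut_on_negative_reals_def
proof (intro conjI allI impI notI)
  have dims: "dim_row (H z) = p" "dim_col (H z) = p" for z using carr[of z] by auto
  show "(\<lambda>s. G s $$ (i,j)) holomorphic_on - \<real>\<^sub>\<le>\<^sub>0" if ij: "i < p" "j < p" for i j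
  proof -
    have "((\<lambda>z. H z $$ (i,j)) \<circ> csqrt) holomorphic_on - \<real>\<^sub>\<le>\<^sub>0"
      by (rule holomorphic_on_compose_gen[OF holomorphic_on_csqrt holo[OF ij]]) (auto intro: Re_csqrt_pos)
    then have "(\<lambda>s. (1 / csqrt s) * H (csqrt s) $$ (i,j)) holomorphic_on - \<real>\<^sub>\<le>\<^sub>0"
      unfolding o_def by (intro holomorphic_intros) auto
    moreover have "G s $$ (i,j) = (1 / csqrt s) * H (csqrt s) $$ (i,j)" if "s \<in> - \<real>\<^sub>\<le>\<^sub>0" for s
      using that ij by (simp add: G dims)
    ultimately show ?thesis by (metis (no_types, lifting) holomorphic_cong)
  qed
  fix x :: real assume x: "x < 0"
  assume "\<exists>L \<in> carrier_mat p p. \<forall>i<p. \<forall>j<p.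
             ((\<lambda>s. G s $$ (i,j)) \<longlongrightarrow> L $$ (i,j)) (at (complex_of_real x) within - \<real>\<^sub>\<le>\<^sub>0)"
  then obtain l where l: "((\<lambda>s. G s $$ (k,k)) \<longlongrightarrow> l) (at (complex_of_real x) within - \<real>\<^sub>\<le>\<^sub>0)"
    using k by blast
  define y where "y = sqrt (- x)"
  have y: "0 < y" "y\<^sup>2 = - x" using x by (auto simp: y_def)
  define c where "c = H (Complex 0 y) $$ (k,k) / Complex 0 y"
  define Z where "Z n = Complex (inverse (real (Suc n))) y" for n
  have ReZ: "0 < Re (Z n)" for n by (simp add: Z_def)
  have Zlim: "Z \<longlonglongrightarrow> Complex 0 y"
    unfolding Z_def by (intro tendsto_Complex LIMSEQ_inverse_real_of_nat tendsto_const)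
  have sq0: "(Complex 0 y)\<^sup>2 = complex_of_real x"
    using y by (simp add: complex_eq_iff power2_eq_square)
  have slit: "w\<^sup>2 \<notin> \<real>\<^sub>\<le>\<^sub>0" "csqrt (w\<^sup>2) = w" if "0 < Re w" for w
  proof -
    show "csqrt (w\<^sup>2) = w" using that by (intro csqrt_square) auto
    show "w\<^sup>2 \<notin> \<real>\<^sub>\<le>\<^sub>0"
      using that by (auto simp: complex_nonpos_Reals_iff Re_power2 Im_power2)
  qed
  have "(\<lambda>n. H (Z n) $$ (k,k)) \<longlonglongrightarrow> H (Complex 0 y) $$ (k,k)"
    by (rule continuous_on_tendsto_compose[OF cont[OF k k] Zlim]) (use ReZ in \<open>auto intro!: always_eventually less_imp_le\<close>)
  then have Hlim: "(\<lambda>n. H (Z n) $$ (k,k) / Z n) \<longlonglongrightarrow> c"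
    unfolding c_def using y by (intro tendsto_divide Zlim) (auto simp: complex_eq_iff)
  have lim: "(\<lambda>n. G ((W n)\<^sup>2) $$ (k,k)) \<longlonglongrightarrow> l"
    if W: "\<And>n. 0 < Re (W n)" "(\<lambda>n. (W n)\<^sup>2) \<longlonglongrightarrow> complex_of_real x" for W
  proof -
    have "(W n)\<^sup>2 \<in> - \<real>\<^sub>\<le>\<^sub>0 - {complex_of_real x}" for n
      using slit(1)[OF W(1)[of n]] x by auto
    then show ?thesis using l W(2) unfolding tendsto_at_iff_sequentially by (force simp: o_def)
  qed
  have GW: "G (w\<^sup>2) $$ (k,k) = H w $$ (k,k) / w" if "0 < Re w" for w
    using slit[OF that] k by (simp add: G dims)
  have "(\<lambda>n. (Z n)\<^sup>2) \<longlonglongrightarrow> (Complex 0 y)\<^sup>2" by (intro tendsto_intros Zlim)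
  then have "(\<lambda>n. G ((Z n)\<^sup>2) $$ (k,k)) \<longlonglongrightarrow> l"
    using sq0 ReZ by (intro lim) auto
  then have 1: "l = c"
    using Hlim GW[OF ReZ] LIMSEQ_unique by auto
  have "(\<lambda>n. (cnj (Z n))\<^sup>2) \<longlonglongrightarrow> (cnj (Complex 0 y))\<^sup>2" by (intro tendsto_intros tendsto_cnj Zlim)
  moreover have "(cnj (Complex 0 y))\<^sup>2 = complex_of_real x"
    using sq0 by (metis complex_cnj_complex_of_real complex_cnj_power)
  ultimately have "(\<lambda>n. G ((cnj (Z n))\<^sup>2) $$ (k,k)) \<longlonglongrightarrow> l"
    using ReZ by (intro lim) auto
  moreover have "G ((cnj (Z n))\<^sup>2) $$ (k,k) = cnj (H (Z n) $$ (k,k) / Z n)" for n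
    using GW[of "cnj (Z n)"] ReZ[of n] cnj[of "Z n" k k] k by (simp del: complex_cnj_power)
  ultimately have "(\<lambda>n. cnj (H (Z n) $$ (k,k) / Z n)) \<longlonglongrightarrow> l" by simp
  then have 2: "l = cnj c"
    using tendsto_cnj[OF Hlim] LIMSEQ_unique by blast
  have "Im c = 0" using 1 2 by (metis cnj.simps(2) equal_neg_zero)
  moreover have "H (Complex 0 y) $$ (k,k) = c * Complex 0 y"
    using y by (simp add: c_def complex_eq_iff)
  ultimately have "Re (H (Complex 0 y) $$ (k,k)) = 0" by simp
  then show False using pos[OF y(1)] by simp
qed

section \<open>Inverses of matrices and their analytic dependence\<close>

lemma
  fixes A :: "'a::field mat"
  assumes A: "A \<in> carrier_mat n n" and det: "Determinant.det A \<noteq> 0"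
  shows minv_carrier: "minv A \<in> carrier_mat n n"
    and minv_right: "A * minv A = 1\<^sub>m n"
    and minv_left: "minv A * A = 1\<^sub>m n"
proof -
  have "A \<in> Units (ring_mat TYPE('a) n ())"
    by (rule det_non_zero_imp_unit[OF A det])
  then obtain B where "mat_inverse A = Some B"
    using mat_inverse(1)[OF A, where b = "()"] by (cases "mat_inverse A") auto
  with mat_inverse(2)[OF A this]
  show "minv A \<in> carrier_mat n n" "A * minv A = 1\<^sub>m n" "minv A * A = 1\<^sub>m n" by auto
qed

lemma det_nonzero_if_right_inverse:
  fixes A :: "'a::field mat"
  assumes "A \<in> carrier_mat n n" "B \<in> carrier_mat n n" "A * B = 1\<^sub>m n"
  shows "Determinant.det A \<noteq> 0" "Determinant.det B \<noteq> 0"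
  using Determinant.det_mult[OF assms(1,2)] assms(3) by auto

lemma minv_unique:
  fixes A :: "'a::field mat"
  assumes A: "A \<in> carrier_mat n n" and B: "B \<in> carrier_mat n n" and AB: "A * B = 1\<^sub>m n"
  shows "minv A = B"
proof -
  note det = det_nonzero_if_right_inverse(1)[OF A B AB]
  have "minv A = minv A * (A * B)"
    using minv_carrier[OF A det] AB by simp
  also have "\<dots> = minv A * A * B"
    by (rule assoc_mult_mat[symmetric, OF minv_carrier[OF A det] A B])
  finally show ?thesis using minv_left[OF A det] B by simp
qed

lemma det_minv_nonzero:
  fixes A :: "'a::field mat"
  assumes "A \<in> carrier_mat n n" "Determinant.det A \<noteq> 0"
  shows "Determinant.det (minv A) \<noteq> 0"
  by (rule det_nonzero_if_right_inverse(2)[OF assms(1) minv_carrier minv_right]) (use assms in auto)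

lemma minv_minv:
  fixes A :: "'a::field mat"
  assumes "A \<in> carrier_mat n n" "Determinant.det A \<noteq> 0"
  shows "minv (minv A) = A"
  by (rule minv_unique[OF minv_carrier _ minv_left]) (use assms in auto)

lemma minv_transpose:
  fixes A :: "'a::field mat"
  assumes A: "A \<in> carrier_mat n n" and det: "Determinant.det A \<noteq> 0"
  shows "minv (A\<^sup>T) = (minv A)\<^sup>T"
proof (rule minv_unique)
  show "A\<^sup>T * (minv A)\<^sup>T = 1\<^sub>m n"
    using transpose_mult[OF minv_carrier[OF A det] A] minv_left[OF A det] by simp
qed (use A minv_carrier[OF A det] in auto)

lemma minv_hom:
  fixes h :: "'a::field \<Rightarrow> 'b::field"
  assumes h: "comm_ring_hom h" and A: "A \<in> carrier_mat n n" and det: "Determinant.det A \<noteq> 0"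
  shows "minv (map_mat h A) = map_mat h (minv A)"
proof -
  interpret comm_ring_hom h by (rule h)
  show ?thesis
  proof (rule minv_unique)
    show "map_mat h A * map_mat h (minv A) = 1\<^sub>m n"
      using mat_hom_mult[OF A minv_carrier[OF A det]] minv_right[OF A det] mat_hom_one by simp
  qed (use A minv_carrier[OF A det] in auto)
qed

lemma minv_mult_cancel_vec:
  fixes A :: "'a::field mat"
  assumes A: "A \<in> carrier_mat n n" and det: "Determinant.det A \<noteq> 0" and x: "x \<in> carrier_vec n"
  shows "minv A *\<^sub>v (A *\<^sub>v x) = x" "A *\<^sub>v (minv A *\<^sub>v x) = x"
  using assoc_mult_mat_vec[OF minv_carrier[OF A det] A x] assoc_mult_mat_vec[OF A minv_carrier[OF A det] x]
    minv_left[OF A det] minv_right[OF A det] x by auto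

lemma smult_mult_mat_vec:
  fixes A :: "'a::comm_semiring_0 mat"
  assumes "A \<in> carrier_mat nr nc" "x \<in> carrier_vec nc"
  shows "(k \<cdot>\<^sub>m A) *\<^sub>v x = k \<cdot>\<^sub>v (A *\<^sub>v x)"
  using assms by (intro eq_vecI) auto

text \<open>Cramer's rule makes the entries of an inverse rational in the entries of the matrix, which is how
  continuity, holomorphy and limits pass to inverses.\<close>

lemma minv_eq_adj_mat:
  fixes A :: "'a::field mat"
  assumes A: "A \<in> carrier_mat n n" and det: "Determinant.det A \<noteq> 0"
  shows "minv A = (1 / Determinant.det A) \<cdot>\<^sub>m adj_mat A"
proof (rule minv_unique[OF A])
  show "A * ((1 / Determinant.det A) \<cdot>\<^sub>m adj_mat A) = 1\<^sub>m n"
    using det adj_mat[OF A] A by (subst mult_smult_distrib[of A n n _ n]) (auto intro!: eq_matI)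
qed (use adj_mat[OF A] in auto)

lemma det_nonzero_if_injective:
  fixes A :: "'a::field mat"
  assumes "A \<in> carrier_mat n n" "\<And>v. v \<in> carrier_vec n \<Longrightarrow> A *\<^sub>v v = 0\<^sub>v n \<Longrightarrow> v = 0\<^sub>v n"
  shows "Determinant.det A \<noteq> 0"
  using det_0_iff_vec_prod_zero_field[OF assms(1)] assms(2) by blast

lemma det_nonzero_if_invertible:
  fixes A :: "'a::field mat"
  assumes "invertible_mat A" "A \<in> carrier_mat n n"
  shows "Determinant.det A \<noteq> 0"
proof -
  from assms obtain B where B: "A * B = 1\<^sub>m n" "B * A = 1\<^sub>m (dim_row B)"
    by (auto simp: invertible_mat_def inverts_mat_def)
  have "dim_col (A * B) = n" "dim_col (B * A) = dim_row B" using B by auto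
  then have "B \<in> carrier_mat n n" using assms by auto
  then show ?thesis using det_nonzero_if_right_inverse(1) assms B by blast
qed

lemma continuous_on_det:
  fixes M :: "'b::topological_space \<Rightarrow> complex mat"
  assumes M: "\<And>z. M z \<in> carrier_mat n n"
    and cont: "\<And>i j. i < n \<Longrightarrow> j < n \<Longrightarrow> continuous_on S (\<lambda>z. M z $$ (i,j))"
  shows "continuous_on S (\<lambda>z. Determinant.det (M z))"
  unfolding Determinant.det_def'[OF M]
  by (intro continuous_intros cont) (auto dest: permutes_in_image)

lemma tendsto_det:
  fixes M :: "'b \<Rightarrow> complex mat"
  assumes M: "\<And>z. M z \<in> carrier_mat n n" and L: "L \<in> carrier_mat n n"
    and lim: "\<And>i j. i < n \<Longrightarrow> j < n \<Longrightarrow> ((\<lambda>z. M z $$ (i,j)) \<longlongrightarrow> L $$ (i,j)) F"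
  shows "((\<lambda>z. Determinant.det (M z)) \<longlongrightarrow> Determinant.det L) F"
  unfolding Determinant.det_def'[OF M] Determinant.det_def'[OF L]
  by (intro tendsto_intros lim) (auto dest: permutes_in_image)

lemma mat_delete_entry:
  assumes "A \<in> carrier_mat n n" "k < n - 1" "l < n - 1"
  shows "mat_delete A i j $$ (k,l) = A $$ (if k < i then k else Suc k, if l < j then l else Suc l)"
  using assms by (simp add: mat_delete_def)

lemma minv_entry:
  fixes A :: "'a::field mat"
  assumes "A \<in> carrier_mat n n" "Determinant.det A \<noteq> 0" "i < n" "j < n"
  shows "minv A $$ (i,j) = (-1) ^ (j + i) * Determinant.det (mat_delete A j i) / Determinant.det A"
  using assms by (simp add: minv_eq_adj_mat[OF assms(1,2)] adj_mat_def cofactor_def)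

lemma continuous_on_minv:
  fixes M :: "'b::topological_space \<Rightarrow> complex mat"
  assumes M: "\<And>z. M z \<in> carrier_mat n n"
    and det: "\<And>z. z \<in> S \<Longrightarrow> Determinant.det (M z) \<noteq> 0"
    and cont: "\<And>i j. i < n \<Longrightarrow> j < n \<Longrightarrow> continuous_on S (\<lambda>z. M z $$ (i,j))"
    and ij: "i < n" "j < n"
  shows "continuous_on S (\<lambda>z. minv (M z) $$ (i,j))"
proof -
  have "continuous_on S (\<lambda>z. (-1) ^ (j + i) * Determinant.det (mat_delete (M z) j i) / Determinant.det (M z))"
  proof (intro continuous_on_divide continuous_on_mult continuous_on_const)
    show "continuous_on S (\<lambda>z. Determinant.det (M z))" by (rule continuous_on_det[OF M cont])
    have "continuous_on S (\<lambda>z. mat_delete (M z) j i $$ (k,l))" if "k < n - 1" "l < n - 1" for k l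
      unfolding mat_delete_entry[OF M that] by (rule cont) (use that in auto)
    then show "continuous_on S (\<lambda>z. Determinant.det (mat_delete (M z) j i))"
      by (rule continuous_on_det[OF mat_delete_carrier[OF M]])
  qed (use det in auto)
  then show ?thesis
    by (rule continuous_on_eq) (simp add: minv_entry[OF M det ij])
qed

lemma holomorphic_on_minv:
  assumes M: "\<And>z. M z \<in> carrier_mat n n"
    and det: "\<And>z. z \<in> S \<Longrightarrow> Determinant.det (M z) \<noteq> 0"
    and holo: "\<And>i j. i < n \<Longrightarrow> j < n \<Longrightarrow> (\<lambda>z. M z $$ (i,j)) holomorphic_on S"
    and ij: "i < n" "j < n"
  shows "(\<lambda>z. minv (M z) $$ (i,j)) holomorphic_on S"
proof -
  have hdet: "(\<lambda>z. Determinant.det (N z)) holomorphic_on S"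
    if "\<And>z. N z \<in> carrier_mat k k" "\<And>i j. i < k \<Longrightarrow> j < k \<Longrightarrow> (\<lambda>z. N z $$ (i,j)) holomorphic_on S" for N k
    unfolding Determinant.det_def'[OF that(1)]
    by (intro holomorphic_intros that(2)) (auto dest: permutes_in_image)
  have "(\<lambda>z. (-1) ^ (j + i) * Determinant.det (mat_delete (M z) j i) / Determinant.det (M z)) holomorphic_on S"
  proof (intro holomorphic_on_divide holomorphic_on_mult holomorphic_on_const)
    show "(\<lambda>z. Determinant.det (M z)) holomorphic_on S" by (rule hdet[OF M holo])
    have "(\<lambda>z. mat_delete (M z) j i $$ (k,l)) holomorphic_on S" if "k < n - 1" "l < n - 1" for k l
      unfolding mat_delete_entry[OF M that] by (rule holo) (use that in auto)
    then show "(\<lambda>z. Determinant.det (mat_delete (M z) j i)) holomorphic_on S"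
      by (rule hdet[OF mat_delete_carrier[OF M]])
  qed (use det in auto)
  then show ?thesis
    by (rule holomorphic_transform) (simp add: minv_entry[OF M det ij])
qed

lemma tendsto_minv:
  fixes M :: "'b \<Rightarrow> complex mat"
  assumes M: "\<And>z. M z \<in> carrier_mat n n" and L: "L \<in> carrier_mat n n" "Determinant.det L \<noteq> 0"
    and lim: "\<And>i j. i < n \<Longrightarrow> j < n \<Longrightarrow> ((\<lambda>z. M z $$ (i,j)) \<longlongrightarrow> L $$ (i,j)) F"
    and ij: "i < n" "j < n"
  shows "((\<lambda>z. minv (M z) $$ (i,j)) \<longlongrightarrow> minv L $$ (i,j)) F"
proof -
  have limdet: "((\<lambda>z. Determinant.det (M z)) \<longlongrightarrow> Determinant.det L) F"
    by (rule tendsto_det[of M n L, OF M L(1) lim])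
  have "((\<lambda>z. (-1) ^ (j + i) * Determinant.det (mat_delete (M z) j i) / Determinant.det (M z))
      \<longlongrightarrow> (-1) ^ (j + i) * Determinant.det (mat_delete L j i) / Determinant.det L) F"
  proof (intro tendsto_divide tendsto_mult tendsto_const limdet L)
    have "((\<lambda>z. mat_delete (M z) j i $$ (k,l)) \<longlongrightarrow> mat_delete L j i $$ (k,l)) F"
      if "k < n - 1" "l < n - 1" for k l
      unfolding mat_delete_entry[OF M that] mat_delete_entry[OF L(1) that] by (rule lim) (use that in auto)
    then show "((\<lambda>z. Determinant.det (mat_delete (M z) j i)) \<longlongrightarrow> Determinant.det (mat_delete L j i)) F"
      by (rule tendsto_det[OF mat_delete_carrier[OF M] mat_delete_carrier[OF L(1)]])
  qed
  then show ?thesis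
    unfolding minv_entry[OF L ij, symmetric]
  proof (rule Lim_transform_eventually)
    show "\<forall>\<^sub>F z in F. (-1) ^ (j + i) * Determinant.det (mat_delete (M z) j i) / Determinant.det (M z) = minv (M z) $$ (i,j)"
      using tendsto_imp_eventually_ne[OF limdet L(2)]
      by eventually_elim (simp add: minv_entry[OF M _ ij])
  qed
qed

section \<open>Accretive and positive definite matrices\<close>

text \<open>Positive definiteness of the Hermitian part, which is stable under addition and inversion and
  excludes singular matrices.\<close>

definition accretive :: "nat \<Rightarrow> complex mat \<Rightarrow> bool" where
  "accretive p P \<longleftrightarrow> P \<in> carrier_mat p p \<and>
     (\<forall>x \<in> carrier_vec p. x \<noteq> 0\<^sub>v p \<longrightarrow> 0 < Re ((P *\<^sub>v x) \<bullet>c x))"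

definition accretive_semidef :: "nat \<Rightarrow> complex mat \<Rightarrow> bool" where
  "accretive_semidef p P \<longleftrightarrow> P \<in> carrier_mat p p \<and> (\<forall>x \<in> carrier_vec p. 0 \<le> Re ((P *\<^sub>v x) \<bullet>c x))"

lemma accretive_imp_semidef: "accretive p P \<Longrightarrow> accretive_semidef p P"
  unfolding accretive_def accretive_semidef_def
  by (metis conjugate_zero_vec less_imp_le order_refl scalar_prod_right_zero carrier_matD(1)
      dim_mult_mat_vec carrier_vecI zero_complex.sel(1))

lemma accretive_det_nonzero: "accretive p P \<Longrightarrow> Determinant.det P \<noteq> 0"
  by (rule det_nonzero_if_injective[of _ p]) (auto simp: accretive_def)

lemma hermitian_form_add:
  assumes "P \<in> carrier_mat p p" "Q \<in> carrier_mat p p" "x \<in> carrier_vec p"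
  shows "((P + Q) *\<^sub>v x) \<bullet>c x = (P *\<^sub>v x) \<bullet>c x + (Q *\<^sub>v x) \<bullet>c (x :: complex vec)"
  using assms by (simp add: add_mult_distrib_mat_vec[of P p p] add_scalar_prod_distrib[of _ p])

lemma accretive_add_semidef:
  "accretive p P \<Longrightarrow> accretive_semidef p Q \<Longrightarrow> accretive p (P + Q)"
  unfolding accretive_def accretive_semidef_def
  by (auto simp: hermitian_form_add intro!: add_pos_nonneg)

lemma semidef_add_accretive:
  "accretive_semidef p P \<Longrightarrow> accretive p Q \<Longrightarrow> accretive p (P + Q)"
  unfolding accretive_def accretive_semidef_def
  by (auto simp: hermitian_form_add intro!: add_nonneg_pos)

text \<open>With \<open>a = P\<^sup>-\<^sup>1 x\<close> the form of the inverse at \<open>x\<close> is the conjugate of the form of \<open>P\<close> at \<open>a\<close>.\<close>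

lemma accretive_minv:
  assumes P: "accretive p P"
  shows "accretive p (minv P)"
proof -
  have c: "P \<in> carrier_mat p p" using P by (simp add: accretive_def)
  note d = accretive_det_nonzero[OF P]
  have "0 < Re ((minv P *\<^sub>v x) \<bullet>c x)" if x: "x \<in> carrier_vec p" "x \<noteq> 0\<^sub>v p" for x
  proof -
    define a where "a = minv P *\<^sub>v x"
    have a: "a \<in> carrier_vec p" "P *\<^sub>v a = x"
      using minv_carrier[OF c d] minv_mult_cancel_vec[OF c d x(1)] x by (auto simp: a_def)
    have "a \<noteq> 0\<^sub>v p" using a x c by auto
    then have "0 < Re ((P *\<^sub>v a) \<bullet>c a)" using P a by (auto simp: accretive_def)
    also have "(P *\<^sub>v a) \<bullet>c a = cnj (a \<bullet>c x)"
      unfolding a(2) using a x by (simp add: scalar_prod_def mult.commute)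
    finally show ?thesis by (simp add: a_def)
  qed
  then show ?thesis using minv_carrier[OF c d] by (simp add: accretive_def)
qed

text \<open>Symmetry cancels the mixed terms, so the form is real; this is what allows multiplication by a
  complex number with nonnegative real part.\<close>

lemma cmat_quadratic_form:
  assumes M: "M \<in> carrier_mat p p" and x: "x \<in> carrier_vec p" and sym: "M\<^sup>T = M"
  shows "(cmat M *\<^sub>v x) \<bullet>c x =
    complex_of_real (scalar_prod (map_vec Re x) (M *\<^sub>v map_vec Re x) + scalar_prod (map_vec Im x) (M *\<^sub>v map_vec Im x))"
proof -
  have s: "M $$ (i,j) = M $$ (j,i)" if "i < p" "j < p" for i j
    using arg_cong[OF sym, of "\<lambda>N. N $$ (j,i)"] that M by simp
  have "(cmat M *\<^sub>v x) \<bullet>c x = (\<Sum>i<p. \<Sum>j<p. of_real (M $$ (i,j)) * x $ j * cnj (x $ i))"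
    using M x by (simp add: scalar_prod_def sum_distrib_right atLeast0LessThan)
  also have "\<dots> = of_real (\<Sum>i<p. \<Sum>j<p. M $$ (i,j) * (Re (x $ i) * Re (x $ j) + Im (x $ i) * Im (x $ j))) +
      \<i> * of_real (\<Sum>i<p. \<Sum>j<p. M $$ (i,j) * (Re (x $ i) * Im (x $ j) - Im (x $ i) * Re (x $ j)))"
    by (simp add: complex_eq_iff algebra_simps sum.distrib sum_subtractf)
  also have "(\<Sum>i<p. \<Sum>j<p. M $$ (i,j) * (Re (x $ i) * Im (x $ j) - Im (x $ i) * Re (x $ j))) = 0"
  proof -
    have "(\<Sum>i<p. \<Sum>j<p. M $$ (i,j) * (Re (x $ i) * Im (x $ j))) = (\<Sum>i<p. \<Sum>j<p. M $$ (i,j) * (Im (x $ i) * Re (x $ j)))"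
      by (subst sum.swap) (intro sum.cong, auto simp: s)
    then show ?thesis by (simp add: right_diff_distrib sum_subtractf)
  qed
  also have "(\<Sum>i<p. \<Sum>j<p. M $$ (i,j) * (Re (x $ i) * Re (x $ j) + Im (x $ i) * Im (x $ j))) =
     scalar_prod (map_vec Re x) (M *\<^sub>v map_vec Re x) + scalar_prod (map_vec Im x) (M *\<^sub>v map_vec Im x)"
    using M x by (simp add: scalar_prod_def sum_distrib_left atLeast0LessThan sum.distrib algebra_simps)
  finally show ?thesis by simp
qed

lemma sym_pos_def_nonneg:
  "sym_pos_def p M \<Longrightarrow> x \<in> carrier_vec p \<Longrightarrow> 0 \<le> scalar_prod x (M *\<^sub>v x)"
  by (cases "x = 0\<^sub>v p") (auto simp: sym_pos_def_def intro: less_imp_le)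

lemma sym_pos_def_imp_semidef: "sym_pos_def p M \<Longrightarrow> sym_pos_semidef p M"
  using sym_pos_def_nonneg by (auto simp: sym_pos_def_def sym_pos_semidef_def)

lemma accretive_semidef_smult_cmat:
  assumes M: "sym_pos_semidef p M" and z: "0 \<le> Re z"
  shows "accretive_semidef p (z \<cdot>\<^sub>m cmat M)"
proof -
  have c: "M \<in> carrier_mat p p" "M\<^sup>T = M" using M by (auto simp: sym_pos_semidef_def)
  have "0 \<le> Re ((z \<cdot>\<^sub>m cmat M *\<^sub>v x) \<bullet>c x)" if x: "x \<in> carrier_vec p" for x
  proof -
    have "(z \<cdot>\<^sub>m cmat M *\<^sub>v x) \<bullet>c x = z * ((cmat M *\<^sub>v x) \<bullet>c x)"
      using c x by (simp add: smult_mult_mat_vec[of _ p p])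
    then show ?thesis
      unfolding cmat_quadratic_form[OF c(1) x c(2)] using M x z by (auto simp: sym_pos_semidef_def)
  qed
  then show ?thesis using c by (auto simp: accretive_semidef_def)
qed

lemma accretive_smult_cmat:
  assumes M: "sym_pos_def p M" and z: "0 < Re z"
  shows "accretive p (z \<cdot>\<^sub>m cmat M)"
proof -
  have c: "M \<in> carrier_mat p p" "M\<^sup>T = M" using M by (auto simp: sym_pos_def_def)
  have "0 < Re ((z \<cdot>\<^sub>m cmat M *\<^sub>v x) \<bullet>c x)" if x: "x \<in> carrier_vec p" "x \<noteq> 0\<^sub>v p" for x
  proof -
    have "(z \<cdot>\<^sub>m cmat M *\<^sub>v x) \<bullet>c x = z * ((cmat M *\<^sub>v x) \<bullet>c x)"
      using c x by (simp add: smult_mult_mat_vec[of _ p p])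
    moreover have "map_vec Re x \<noteq> 0\<^sub>v p \<or> map_vec Im x \<noteq> 0\<^sub>v p"
    proof (rule ccontr)
      assume "\<not> (map_vec Re x \<noteq> 0\<^sub>v p \<or> map_vec Im x \<noteq> 0\<^sub>v p)"
      then have e: "map_vec Re x = 0\<^sub>v p" "map_vec Im x = 0\<^sub>v p" by auto
      have "x $ i = 0" if "i < p" for i
        using arg_cong[OF e(1), of "\<lambda>v. v $ i"] arg_cong[OF e(2), of "\<lambda>v. v $ i"] that x
        by (auto simp: complex_eq_iff)
      then show False using x by auto
    qed
    moreover have "0 < scalar_prod (map_vec Re x) (M *\<^sub>v map_vec Re x) + scalar_prod (map_vec Im x) (M *\<^sub>v map_vec Im x)"
      using calculation(2) M x sym_pos_def_nonneg[OF M, of "map_vec Re x"] sym_pos_def_nonneg[OF M, of "map_vec Im x"]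
      unfolding sym_pos_def_def
      by (smt (verit, best) map_carrier_vec)
    ultimately show ?thesis
      unfolding cmat_quadratic_form[OF c(1) x(1) c(2)] using z by auto
  qed
  then show ?thesis using c by (auto simp: accretive_def)
qed

lemma accretive_cmat: "sym_pos_def p M \<Longrightarrow> accretive p (cmat M)"
proof -
  assume "sym_pos_def p M"
  moreover have "1 \<cdot>\<^sub>m cmat M = cmat M" by (rule eq_matI) auto
  ultimately show ?thesis using accretive_smult_cmat[of p M 1] by simp
qed

lemma sym_pos_def_carrier: "sym_pos_def p M \<Longrightarrow> M \<in> carrier_mat p p"
  and sym_pos_def_transpose: "sym_pos_def p M \<Longrightarrow> M\<^sup>T = M"
  by (auto simp: sym_pos_def_def)

lemma sym_pos_def_det: "sym_pos_def p M \<Longrightarrow> Determinant.det M \<noteq> 0"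
  by (rule det_nonzero_if_injective[of _ p]) (force simp: sym_pos_def_def)+

lemma symmetric_scalar_prod:
  fixes M :: "'a::comm_ring_1 mat"
  assumes "M \<in> carrier_mat p p" "M\<^sup>T = M" "x \<in> carrier_vec p" "y \<in> carrier_vec p"
  shows "scalar_prod x (M *\<^sub>v y) = scalar_prod y (M *\<^sub>v x)"
  using transpose_vec_mult_scalar[OF assms(1,4,3)] assms
  by (metis comm_scalar_prod mult_mat_vec_carrier)

lemma sym_pos_def_minv:
  assumes M: "sym_pos_def p M"
  shows "sym_pos_def p (minv M)"
proof -
  note c = sym_pos_def_carrier[OF M] and d = sym_pos_def_det[OF M]
  have "0 < scalar_prod x (minv M *\<^sub>v x)" if x: "x \<in> carrier_vec p" "x \<noteq> 0\<^sub>v p" for x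
  proof -
    define a where "a = minv M *\<^sub>v x"
    have a: "a \<in> carrier_vec p" "M *\<^sub>v a = x"
      using minv_carrier[OF c d] minv_mult_cancel_vec[OF c d x(1)] x by (auto simp: a_def)
    have "a \<noteq> 0\<^sub>v p" using a x c by auto
    then have "0 < scalar_prod a (M *\<^sub>v a)" using M a by (auto simp: sym_pos_def_def)
    then show ?thesis using a x comm_scalar_prod[of a p x] by (simp add: a_def)
  qed
  then show ?thesis
    using minv_carrier[OF c d] minv_transpose[OF c d] sym_pos_def_transpose[OF M]
    by (simp add: sym_pos_def_def)
qed

text \<open>With \<open>a = A\<^sup>-\<^sup>1 x\<close> and \<open>b = B\<^sup>-\<^sup>1 x\<close>,
  \<open>x\<^sup>T (A\<^sup>-\<^sup>1 - B\<^sup>-\<^sup>1) x = (a - b)\<^sup>T A (a - b) + b\<^sup>T (B - A) b\<close>.\<close>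

lemma minv_antimono:
  assumes A: "sym_pos_def p A" and B: "sym_pos_def p B" and AB: "sym_pos_def p (B - A)"
  shows "sym_pos_def p (minv A - minv B)"
proof -
  note cA = sym_pos_def_carrier[OF A] and dA = sym_pos_def_det[OF A]
  note cB = sym_pos_def_carrier[OF B] and dB = sym_pos_def_det[OF B]
  note iA = minv_carrier[OF cA dA] and iB = minv_carrier[OF cB dB]
  have "0 < scalar_prod x ((minv A - minv B) *\<^sub>v x)" if x: "x \<in> carrier_vec p" "x \<noteq> 0\<^sub>v p" for x
  proof -
    define a b where "a = minv A *\<^sub>v x" and "b = minv B *\<^sub>v x"
    have a: "a \<in> carrier_vec p" "A *\<^sub>v a = x" and b: "b \<in> carrier_vec p" "B *\<^sub>v b = x"
      using iA iB minv_mult_cancel_vec[OF cA dA x(1)] minv_mult_cancel_vec[OF cB dB x(1)] x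
      by (auto simp: a_def b_def)
    have "b \<noteq> 0\<^sub>v p" using b x cB by auto
    then have pos: "0 < scalar_prod b ((B - A) *\<^sub>v b)" using AB b by (auto simp: sym_pos_def_def)
    have "0 \<le> scalar_prod (a - b) (A *\<^sub>v (a - b))"
      by (rule sym_pos_def_nonneg[OF A]) (use a b in auto)
    also have "\<dots> = scalar_prod a x - scalar_prod b x - scalar_prod a (A *\<^sub>v b) + scalar_prod b (A *\<^sub>v b)"
      using a b x cA
      by (simp add: mult_minus_distrib_mat_vec[of _ p p] minus_scalar_prod_distrib[of _ p] scalar_prod_minus_distrib[of _ p])
    also have "scalar_prod a (A *\<^sub>v b) = scalar_prod b x"
      using symmetric_scalar_prod[OF cA sym_pos_def_transpose[OF A] a(1) b(1)] a by simp
    finally have "0 < scalar_prod a x - scalar_prod b x"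
      using pos a b x cA cB
      by (simp add: minus_mult_distrib_mat_vec[of _ p p] scalar_prod_minus_distrib[of _ p])
    also have "\<dots> = scalar_prod x ((minv A - minv B) *\<^sub>v x)"
      using a b x iA iB unfolding minus_mult_distrib_mat_vec[OF iA iB x(1)] a_def[symmetric] b_def[symmetric]
      by (simp add: scalar_prod_minus_distrib[of _ p] comm_scalar_prod[of _ p x])
    finally show ?thesis .
  qed
  then show ?thesis
    using iA iB minv_transpose[OF cA dA] minv_transpose[OF cB dB] sym_pos_def_transpose[OF A] sym_pos_def_transpose[OF B]
    by (simp add: sym_pos_def_def transpose_minus[OF iA iB] minus_carrier_mat)
qed

lemma sym_pos_def_smult:
  assumes "sym_pos_def p M" "0 < r"
  shows "sym_pos_def p (r \<cdot>\<^sub>m M)"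
proof -
  have "(r \<cdot>\<^sub>m M)\<^sup>T = r \<cdot>\<^sub>m M\<^sup>T" by (rule eq_matI) auto
  then show ?thesis
    using assms by (auto simp: sym_pos_def_def smult_mult_mat_vec[of _ p p])
qed

lemma sym_pos_def_add_semidef:
  assumes "sym_pos_def p M" "sym_pos_semidef p N"
  shows "sym_pos_def p (M + N)"
  using assms
  by (auto simp: sym_pos_def_def sym_pos_semidef_def transpose_add[of _ p p] add_mult_distrib_mat_vec[of _ p p]
      scalar_prod_add_distrib[of _ p] intro!: add_pos_nonneg)

section \<open>Matrix Stieltjes continued fractions\<close>

fun contfrac :: "'a::field \<Rightarrow> 'a mat list \<Rightarrow> 'a mat \<Rightarrow> 'a mat" where
  "contfrac z [] X = X"
| "contfrac z (M # Ms) X = minv (z \<cdot>\<^sub>m M + contfrac z Ms X)"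

lemma contfrac_append: "contfrac z (Ms @ Ns) X = contfrac z Ms (contfrac z Ns X)"
  by (induction Ms) auto

lemma sym_pos_def_contfrac:
  assumes "0 < r" "\<forall>M \<in> set Ms. sym_pos_def p M" "sym_pos_semidef p X" "Ms \<noteq> []"
  shows "sym_pos_def p (contfrac r Ms X)"
  using assms(2,4)
proof (induction Ms)
  case (Cons M Ms)
  have "sym_pos_semidef p (contfrac r Ms X)"
    using Cons assms(3) by (cases "Ms = []") (auto intro: sym_pos_def_imp_semidef)
  then show ?case
    using Cons assms(1) by (auto intro!: sym_pos_def_minv sym_pos_def_add_semidef sym_pos_def_smult)
qed simp

text \<open>Each level of the fraction reverses the order once.\<close>

lemma contfrac_strict_mono:
  assumes r: "0 < r" and M: "\<forall>M \<in> set Ms. sym_pos_def p M"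
    and X: "sym_pos_semidef p X" and Y: "sym_pos_semidef p Y" and XY: "sym_pos_def p (Y - X)"
  shows "if even (length Ms) then sym_pos_def p (contfrac r Ms Y - contfrac r Ms X)
         else sym_pos_def p (contfrac r Ms X - contfrac r Ms Y)"
  using M
proof (induction Ms)
  case Nil then show ?case using XY by simp
next
  case (Cons M Ms)
  have semi: "sym_pos_semidef p (contfrac r Ms Z)" if "sym_pos_semidef p Z" for Z
    using Cons that sym_pos_def_contfrac[OF r, of Ms p Z] by (cases "Ms = []") (auto intro: sym_pos_def_imp_semidef)
  let ?x = "contfrac r Ms X" and ?y = "contfrac r Ms Y"
  have c: "?x \<in> carrier_mat p p" "?y \<in> carrier_mat p p" "M \<in> carrier_mat p p"
    using semi[OF X] semi[OF Y] Cons.prems by (auto simp: sym_pos_semidef_def sym_pos_def_def)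
  have spd: "sym_pos_def p (r \<cdot>\<^sub>m M + ?x)" "sym_pos_def p (r \<cdot>\<^sub>m M + ?y)"
    using Cons.prems semi[OF X] semi[OF Y] r by (auto intro!: sym_pos_def_add_semidef sym_pos_def_smult)
  have diff: "(r \<cdot>\<^sub>m M + ?y) - (r \<cdot>\<^sub>m M + ?x) = ?y - ?x" "(r \<cdot>\<^sub>m M + ?x) - (r \<cdot>\<^sub>m M + ?y) = ?x - ?y"
    using c by (auto intro!: eq_matI)
  have "if even (length Ms) then sym_pos_def p (?y - ?x) else sym_pos_def p (?x - ?y)"
    using Cons by simp
  then show ?case
    using minv_antimono[OF spd] minv_antimono[OF spd(2,1)] diff by (auto split: if_splits)
qed

text \<open>A strictly accretive terminal value keeps every level invertible up to the imaginary axis,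
  where the coefficients \<open>z M\<close> contribute nothing to the Hermitian part.\<close>

lemma contfrac_accretive_closed:
  assumes "0 \<le> Re z" "\<forall>M \<in> set Ms. sym_pos_def p M" "accretive p X"
  shows "accretive p (contfrac z (map cmat Ms) X)"
  using assms(2)
  by (induction Ms) (auto intro!: accretive_minv semidef_add_accretive accretive_semidef_smult_cmat
      sym_pos_def_imp_semidef assms(1,3))

text \<open>In the open half-plane the coefficients themselves are accretive, so the terminal value may be
  singular, in particular \<open>0\<close>.\<close>

lemma contfrac_accretive_open:
  assumes "0 < Re z" "\<forall>M \<in> set Ms. sym_pos_def p M" "accretive_semidef p X" "Ms \<noteq> []"
  shows "accretive p (contfrac z (map cmat Ms) X)"
  using assms(2,4)
proof (induction Ms)
  case (Cons M Ms)
  have "accretive_semidef p (contfrac z (map cmat Ms) X)"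
    using Cons assms(3) by (cases "Ms = []") (auto intro: accretive_imp_semidef)
  then show ?case
    using Cons assms(1) by (auto intro!: accretive_minv accretive_add_semidef accretive_smult_cmat)
qed simp

lemma accretive_carrier: "accretive p P \<Longrightarrow> P \<in> carrier_mat p p"
  by (simp add: accretive_def)

lemma contfrac_transpose:
  assumes z: "0 \<le> Re z" and M: "\<forall>M \<in> set Ms. sym_pos_def p M" and X: "accretive p X" "X\<^sup>T = X"
  shows "(contfrac z (map cmat Ms) X)\<^sup>T = contfrac z (map cmat Ms) X"
  using M
proof (induction Ms)
  case (Cons M Ms)
  let ?P = "z \<cdot>\<^sub>m cmat M + contfrac z (map cmat Ms) X"
  have acc: "accretive p (contfrac z (map cmat Ms) X)"
    using Cons contfrac_accretive_closed[OF z _ X(1)] by auto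
  have P: "accretive p ?P"
    using Cons acc z by (auto intro!: semidef_add_accretive accretive_semidef_smult_cmat sym_pos_def_imp_semidef)
  have "(z \<cdot>\<^sub>m cmat M)\<^sup>T = z \<cdot>\<^sub>m cmat (M\<^sup>T)"
    by (rule eq_matI) auto
  then have "?P\<^sup>T = ?P"
    using Cons accretive_carrier[OF acc]
    by (subst transpose_add[of _ p p]) (auto simp: sym_pos_def_transpose dest: sym_pos_def_carrier)
  then show ?case
    using minv_transpose[OF accretive_carrier[OF P] accretive_det_nonzero[OF P]] by simp
qed (use X in simp)

lemma comm_ring_hom_cnj: "comm_ring_hom cnj"
  by unfold_locales auto

lemma contfrac_cnj:
  assumes z: "0 \<le> Re z" and M: "\<forall>M \<in> set Ms. sym_pos_def p M" and X: "accretive p (cmat X)"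
  shows "contfrac (cnj z) (map cmat Ms) (cmat X) = map_mat cnj (contfrac z (map cmat Ms) (cmat X))"
  using M
proof (induction Ms)
  case Nil then show ?case by (auto intro!: eq_matI)
next
  case (Cons M Ms)
  let ?H = "contfrac z (map cmat Ms) (cmat X)"
  let ?P = "z \<cdot>\<^sub>m cmat M + ?H"
  have acc: "accretive p ?H"
    using Cons contfrac_accretive_closed[OF z _ X(1)] by auto
  have P: "accretive p ?P"
    using Cons acc z by (auto intro!: semidef_add_accretive accretive_semidef_smult_cmat sym_pos_def_imp_semidef)
  have "map_mat cnj ?P = cnj z \<cdot>\<^sub>m cmat M + map_mat cnj ?H"
    using accretive_carrier[OF acc] Cons.prems by (auto intro!: eq_matI dest!: sym_pos_def_carrier)
  then show ?case
    using Cons minv_hom[OF comm_ring_hom_cnj accretive_carrier[OF P] accretive_det_nonzero[OF P]] by simp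
qed

lemma contfrac_cmat:
  assumes r: "0 < r" and M: "\<forall>M \<in> set Ms. sym_pos_def p M" and X: "sym_pos_semidef p X"
  shows "contfrac (complex_of_real r) (map cmat Ms) (cmat X) = cmat (contfrac r Ms X)"
  using M
proof (induction Ms)
  case (Cons M Ms)
  have semi: "sym_pos_semidef p (contfrac r Ms X)"
    using Cons X sym_pos_def_contfrac[OF r, of Ms p X] by (cases "Ms = []") (auto intro: sym_pos_def_imp_semidef)
  let ?P = "r \<cdot>\<^sub>m M + contfrac r Ms X"
  have P: "sym_pos_def p ?P"
    using Cons.prems semi r by (auto intro!: sym_pos_def_add_semidef sym_pos_def_smult)
  have "cmat ?P = of_real r \<cdot>\<^sub>m cmat M + cmat (contfrac r Ms X)"
    using semi Cons.prems by (auto intro!: eq_matI dest!: sym_pos_def_carrier simp: sym_pos_semidef_def)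
  then show ?case
    using Cons minv_hom[OF of_real_hom.comm_ring_hom_axioms[where ?'a = complex] sym_pos_def_carrier[OF P] sym_pos_def_det[OF P]] by simp
qed simp

lemma contfrac_continuous_holomorphic:
  assumes M: "\<forall>M \<in> set Ms. sym_pos_def p M" and X: "accretive p X" and ij: "i < p" "j < p"
  shows "continuous_on {z. 0 \<le> Re z} (\<lambda>z. contfrac z (map cmat Ms) X $$ (i,j))"
    and "(\<lambda>z. contfrac z (map cmat Ms) X $$ (i,j)) holomorphic_on {z. 0 < Re z}"
proof -
  have "continuous_on {z. 0 \<le> Re z} (\<lambda>z. contfrac z (map cmat Ms) X $$ (i,j)) \<and>
    (\<lambda>z. contfrac z (map cmat Ms) X $$ (i,j)) holomorphic_on {z. 0 < Re z}"
    using M ij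
  proof (induction Ms arbitrary: i j)
    case (Cons M Ms)
    \<comment> \<open>Outside the closed half-plane the sum may have any dimensions, so a matrix of the right
      size is put there.\<close>
    define N where "N z = (if 0 \<le> Re z then z \<cdot>\<^sub>m cmat M + contfrac z (map cmat Ms) X else 1\<^sub>m p)" for z
    have cM: "M \<in> carrier_mat p p" using Cons.prems by (auto dest: sym_pos_def_carrier)
    have acc: "accretive p (contfrac z (map cmat Ms) X)" if "0 \<le> Re z" for z
      using that Cons contfrac_accretive_closed[OF _ _ X(1)] by auto
    have N: "accretive p (N z)" if "0 \<le> Re z" for z
      using that Cons acc[OF that] unfolding N_def
      by (auto intro!: semidef_add_accretive accretive_semidef_smult_cmat sym_pos_def_imp_semidef)
    have cN: "N z \<in> carrier_mat p p" for z
      using accretive_carrier[OF N, of z] by (cases "0 \<le> Re z") (auto simp: N_def)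
    have Ne: "N z $$ (k,l) = z * of_real (M $$ (k,l)) + contfrac z (map cmat Ms) X $$ (k,l)"
      if "k < p" "l < p" "0 \<le> Re z" for k l z
      using that cM accretive_carrier[OF acc[OF that(3)]] by (simp add: N_def)
    have contN: "continuous_on {z. 0 \<le> Re z} (\<lambda>z. N z $$ (k,l))" if "k < p" "l < p" for k l
    proof -
      have "continuous_on {z. 0 \<le> Re z} (\<lambda>z. z * of_real (M $$ (k,l)) + contfrac z (map cmat Ms) X $$ (k,l))"
        using Cons.IH[OF _ that] Cons.prems by (intro continuous_intros) auto
      then show ?thesis by (rule continuous_on_eq) (use Ne that in auto)
    qed
    have holoN: "(\<lambda>z. N z $$ (k,l)) holomorphic_on {z. 0 < Re z}" if "k < p" "l < p" for k l
    proof -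
      have "(\<lambda>z. z * of_real (M $$ (k,l)) + contfrac z (map cmat Ms) X $$ (k,l)) holomorphic_on {z. 0 < Re z}"
        using Cons.IH[OF _ that] Cons.prems by (intro holomorphic_intros) auto
      then show ?thesis by (rule holomorphic_transform) (use Ne that in auto)
    qed
    have 1: "continuous_on {z. 0 \<le> Re z} (\<lambda>z. minv (N z) $$ (i,j))"
      by (rule continuous_on_minv[OF cN accretive_det_nonzero[OF N] contN]) (use Cons.prems in auto)
    have 2: "(\<lambda>z. minv (N z) $$ (i,j)) holomorphic_on {z. 0 < Re z}"
      by (rule holomorphic_on_minv[OF cN accretive_det_nonzero[OF N] holoN]) (use Cons.prems in auto)
    have "minv (N z) $$ (i,j) = contfrac z (map cmat (M # Ms)) X $$ (i,j)" if "0 \<le> Re z" for z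
      using that by (simp add: N_def)
    then show ?case
      by (intro conjI continuous_on_eq[OF 1] holomorphic_transform[OF 2]) auto
  qed auto
  then show "continuous_on {z. 0 \<le> Re z} (\<lambda>z. contfrac z (map cmat Ms) X $$ (i,j))"
    and "(\<lambda>z. contfrac z (map cmat Ms) X $$ (i,j)) holomorphic_on {z. 0 < Re z}" by auto
qed

text \<open>Level by level: if \<open>H(z) / z\<close> tends to \<open>0\<close>, then \<open>(z M + H(z))\<^sup>-\<^sup>1 = (M + H(z) / z)\<^sup>-\<^sup>1 / z\<close> tends to \<open>0\<close>
  as well.\<close>

lemma contfrac_decay:
  assumes M: "\<forall>M \<in> set Ms. sym_pos_def p M" and X: "accretive p X" and ij: "i < p" "j < p"
  shows "((\<lambda>z. contfrac z (map cmat Ms) X $$ (i,j) / z) \<longlongrightarrow> 0) at_infinity_right"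
    (is "(_ \<longlongrightarrow> _) ?F")
proof -
  have inv: "((\<lambda>z. 1 / z) \<longlongrightarrow> 0) ?F"
    unfolding divide_inverse mult_1_left by (rule tendsto_mono[OF inf_le1 tendsto_inverse_0])
  have nz: "\<forall>\<^sub>F z::complex in ?F. z \<noteq> 0 \<and> 0 \<le> Re z"
    by (auto simp: eventually_inf_principal eventually_at_infinity intro!: exI[of _ 1])
  show ?thesis
    using M ij
  proof (induction Ms arbitrary: i j)
    case Nil
    have "((\<lambda>z. X $$ (i,j) * (1 / z)) \<longlongrightarrow> X $$ (i,j) * 0) ?F"
      by (intro tendsto_intros inv)
    then show ?case by simp
  next
    case (Cons M Ms)
    let ?H = "\<lambda>z. contfrac z (map cmat Ms) X"
    have cM: "M \<in> carrier_mat p p" and spdM: "sym_pos_def p M" and detM: "Determinant.det M \<noteq> 0"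
      using Cons.prems by (auto dest: sym_pos_def_carrier sym_pos_def_det)
    define N where "N z = mat p p (\<lambda>(k,l). complex_of_real (M $$ (k,l)) + ?H z $$ (k,l) / z)" for z
    have cN: "N z \<in> carrier_mat p p" for z by (simp add: N_def)
    have limN: "((\<lambda>z. N z $$ (k,l)) \<longlongrightarrow> cmat M $$ (k,l)) ?F" if "k < p" "l < p" for k l
    proof -
      have "((\<lambda>z. complex_of_real (M $$ (k,l)) + ?H z $$ (k,l) / z) \<longlongrightarrow> of_real (M $$ (k,l)) + 0) ?F"
        by (intro tendsto_intros Cons.IH) (use that Cons.prems in auto)
      then show ?thesis using that cM by (simp add: N_def)
    qed
    have detc: "Determinant.det (cmat M) \<noteq> 0"
      using detM of_real_hom.hom_det[of M, where ?'a = complex] by simp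
    have "((\<lambda>z. minv (N z) $$ (i,j)) \<longlongrightarrow> minv (cmat M) $$ (i,j)) ?F"
      by (rule tendsto_minv[OF cN _ detc limN]) (use cM Cons.prems in auto)
    then have "((\<lambda>z. minv (N z) $$ (i,j) * (1 / z) * (1 / z)) \<longlongrightarrow> minv (cmat M) $$ (i,j) * 0 * 0) ?F"
      by (intro tendsto_mult inv)
    moreover have "\<forall>\<^sub>F z in ?F. minv (N z) $$ (i,j) * (1 / z) * (1 / z) = contfrac z (map cmat (M # Ms)) X $$ (i,j) / z"
      using nz
    proof eventually_elim
      case (elim z)
      have acc: "accretive p (?H z)"
        using Cons.prems contfrac_accretive_closed[OF _ _ X, of z Ms] elim by auto
      then have cH: "?H z \<in> carrier_mat p p" by (rule accretive_carrier)
      have P: "accretive p (z \<cdot>\<^sub>m cmat M + ?H z)"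
        using acc elim spdM by (auto intro!: semidef_add_accretive accretive_semidef_smult_cmat sym_pos_def_imp_semidef)
      have "N z = (1 / z) \<cdot>\<^sub>m (z \<cdot>\<^sub>m cmat M + ?H z)"
        using cM cH elim by (intro eq_matI) (auto simp: N_def field_simps)
      then have "N z * (z \<cdot>\<^sub>m minv (z \<cdot>\<^sub>m cmat M + ?H z)) = 1\<^sub>m p"
        using elim accretive_carrier[OF P] minv_carrier[OF accretive_carrier[OF P] accretive_det_nonzero[OF P]]
          minv_right[OF accretive_carrier[OF P] accretive_det_nonzero[OF P]]
        by (subst mult_smult_distrib[of _ p p _ p], simp, simp, simp, subst mult_smult_assoc_mat[of _ p p _ p])
          (auto intro!: eq_matI)
      then have "minv (N z) = z \<cdot>\<^sub>m minv (z \<cdot>\<^sub>m cmat M + ?H z)"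
        using minv_carrier[OF accretive_carrier[OF P] accretive_det_nonzero[OF P]]
        by (intro minv_unique[OF cN]) auto
      then show ?case
        using elim Cons.prems minv_carrier[OF accretive_carrier[OF P] accretive_det_nonzero[OF P]] by simp
    qed
    ultimately show ?case
      by (simp only: mult_zero_right) (rule Lim_transform_eventually)
  qed
qed

section \<open>Orthogonality in the block Lanczos iteration\<close>

text \<open>The matrix \<open>P\<close> is a witness that \<open>Z\<close> is injective.\<close>

lemma sym_pos_def_congruence:
  assumes A: "sym_pos_def n A" and Z: "Z \<in> carrier_mat n p"
    and P: "P \<in> carrier_mat n p" and det: "Determinant.det (P\<^sup>T * Z) \<noteq> 0"
  shows "sym_pos_def p (Z\<^sup>T * (A * Z))"
proof -
  have cA: "A \<in> carrier_mat n n" and tA: "A\<^sup>T = A" using A by (auto simp: sym_pos_def_def)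
  have PZ: "P\<^sup>T * Z \<in> carrier_mat p p" using P Z by auto
  have "0 < scalar_prod x (Z\<^sup>T * (A * Z) *\<^sub>v x)" if x: "x \<in> carrier_vec p" "x \<noteq> 0\<^sub>v p" for x
  proof -
    have Zx: "Z *\<^sub>v x \<in> carrier_vec n" using Z x by auto
    have "Z *\<^sub>v x \<noteq> 0\<^sub>v n"
    proof
      assume "Z *\<^sub>v x = 0\<^sub>v n"
      then have "(P\<^sup>T * Z) *\<^sub>v x = 0\<^sub>v p"
        using P Z x by (subst assoc_mult_mat_vec[of _ p n _ p]) auto
      then show False using det PZ x det_0_iff_vec_prod_zero_field[OF PZ] by blast
    qed
    then have "0 < scalar_prod (Z *\<^sub>v x) (A *\<^sub>v (Z *\<^sub>v x))"
      using A Zx by (auto simp: sym_pos_def_def)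
    also have "\<dots> = scalar_prod x (Z\<^sup>T *\<^sub>v (A *\<^sub>v (Z *\<^sub>v x)))"
      using transpose_vec_mult_scalar[OF Z x(1), of "A *\<^sub>v (Z *\<^sub>v x)"] cA Zx Z x
      by (metis comm_scalar_prod mult_mat_vec_carrier transpose_carrier_mat)
    also have "Z\<^sup>T *\<^sub>v (A *\<^sub>v (Z *\<^sub>v x)) = Z\<^sup>T * (A * Z) *\<^sub>v x"
      using cA Z x by (subst assoc_mult_mat_vec[of _ p n _ p], simp, simp, simp, subst assoc_mult_mat_vec[of _ n n _ p]) auto
    finally show ?thesis .
  qed
  moreover have "(Z\<^sup>T * (A * Z))\<^sup>T = Z\<^sup>T * (A * Z)"
    using cA Z by (simp add: transpose_mult[of _ p n _ p] transpose_mult[of _ n n _ p] tA assoc_mult_mat[of _ p n _ n _ p])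
  ultimately show ?thesis using Z cA by (auto simp: sym_pos_def_def)
qed

lemma minus_zero_mat: "X \<in> carrier_mat a b \<Longrightarrow> X - 0\<^sub>m a b = (X :: 'a::group_add mat)"
  by (rule eq_matI) auto

locale lanczos_run =
  fixes n p m :: nat and A B :: "real mat" and Q \<alpha> \<beta> :: "nat \<Rightarrow> real mat"
  assumes A: "sym_pos_def n A" and Bc: "B \<in> carrier_mat n p" and BB: "B\<^sup>T * B = 1\<^sub>m p"
    and run: "block_lanczos n p m A B Q \<alpha> \<beta>"
    and inv: "\<forall>i \<in> {2..m}. invertible_mat (\<beta> i)"
begin

lemmas carrier_simps[simp] =
  mult_carrier_mat[of _ n n _ p] mult_carrier_mat[of _ p n _ p] mult_carrier_mat[of _ n p _ p]
  mult_carrier_mat[of _ p p _ p] minus_carrier_mat[of _ n p] minus_carrier_mat[of _ p p]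

lemmas unit_simps =
  left_mult_zero_mat[of _ p p] right_mult_zero_mat[of _ p p] left_mult_one_mat[of _ p p]
  right_mult_one_mat[of _ p p] minus_zero_mat[of _ p p]

text \<open>The block \<open>0\<close> and the coefficients outside \<open>{2..m}\<close> are set to zero, so that the first step of
  the iteration obeys the same three-term recurrence as the others.\<close>

definition Q0 :: "nat \<Rightarrow> real mat" where "Q0 k = (if k = 0 then 0\<^sub>m n p else Q k)"
definition \<beta>0 :: "nat \<Rightarrow> real mat" where "\<beta>0 k = (if k \<in> {2..m} then \<beta> k else 0\<^sub>m p p)"

lemma A_carrier[simp]: "A \<in> carrier_mat n n" and A_transpose[simp]: "A\<^sup>T = A"
  using A by (auto simp: sym_pos_def_def)

lemma \<beta>0_carrier[simp]: "\<beta>0 k \<in> carrier_mat p p"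
  using run by (auto simp: block_lanczos_def \<beta>0_def)

lemma Q0_carrier[simp]: "k \<le> m \<Longrightarrow> Q0 k \<in> carrier_mat n p"
  using run Bc by (cases "k = 1") (auto simp: block_lanczos_def Q0_def)

lemma Q0_normal: "1 \<le> k \<Longrightarrow> k \<le> m \<Longrightarrow> (Q0 k)\<^sup>T * Q0 k = 1\<^sub>m p"
  using run BB by (cases "k = 1") (auto simp: block_lanczos_def Q0_def)

lemma det_\<beta>0: "2 \<le> k \<Longrightarrow> k \<le> m \<Longrightarrow> Determinant.det (\<beta>0 k) \<noteq> 0"
  using inv run by (intro det_nonzero_if_invertible[of _ p]) (auto simp: block_lanczos_def \<beta>0_def)

lemma lanczos_W_eq:
  assumes "1 \<le> k" "k \<le> m"
  shows "lanczos_W A Q \<beta> k = A * Q0 k - Q0 (k - 1) * (\<beta>0 k)\<^sup>T"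
proof (cases "k = 1")
  case True
  then have "A * Q0 1 \<in> carrier_mat n p" using assms by simp
  with True show ?thesis by (simp add: lanczos_W_def Q0_def \<beta>0_def minus_zero_mat)
qed (use assms in \<open>auto simp: lanczos_W_def Q0_def \<beta>0_def\<close>)

lemma \<alpha>_eq:
  assumes "1 \<le> k" "k \<le> m"
  shows "\<alpha> k = (Q0 k)\<^sup>T * (A * Q0 k - Q0 (k - 1) * (\<beta>0 k)\<^sup>T)"
  using run assms lanczos_W_eq[OF assms] by (auto simp: block_lanczos_def Q0_def)

lemma \<alpha>_carrier[simp]: "1 \<le> k \<Longrightarrow> k \<le> m \<Longrightarrow> \<alpha> k \<in> carrier_mat p p"
  unfolding \<alpha>_eq by simp

lemma three_term:
  assumes "1 \<le> k" "k < m"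
  shows "Q0 (k + 1) * \<beta>0 (k + 1) = A * Q0 k - Q0 (k - 1) * (\<beta>0 k)\<^sup>T - Q0 k * \<alpha> k"
proof -
  have "Q (k + 1) * \<beta> (k + 1) = lanczos_W A Q \<beta> k - Q k * \<alpha> k"
    using run assms unfolding block_lanczos_def by (auto dest!: bspec[of "{2..m}" _ "k + 1"])
  then show ?thesis using assms lanczos_W_eq[of k] by (simp add: Q0_def \<beta>0_def)
qed

definition gram :: "nat \<Rightarrow> nat \<Rightarrow> real mat" where "gram i j = (Q0 i)\<^sup>T * Q0 j"
definition energy :: "nat \<Rightarrow> nat \<Rightarrow> real mat" where "energy i j = (Q0 i)\<^sup>T * (A * Q0 j)"

lemma gram_carrier[simp]: "i \<le> m \<Longrightarrow> j \<le> m \<Longrightarrow> gram i j \<in> carrier_mat p p"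
  and energy_carrier[simp]: "i \<le> m \<Longrightarrow> j \<le> m \<Longrightarrow> energy i j \<in> carrier_mat p p"
  by (simp_all add: gram_def energy_def)

lemma gram_transpose: "i \<le> m \<Longrightarrow> j \<le> m \<Longrightarrow> (gram i j)\<^sup>T = gram j i"
  by (simp add: gram_def transpose_mult[of _ p n _ p])

lemma energy_transpose: "i \<le> m \<Longrightarrow> j \<le> m \<Longrightarrow> (energy i j)\<^sup>T = energy j i"
  by (simp add: energy_def transpose_mult[of _ p n _ p] transpose_mult[of _ n n _ p] assoc_mult_mat[of _ p n _ n _ p])

lemma gram_step:
  assumes "i \<le> m" "1 \<le> k" "k < m"
  shows "gram i (k + 1) * \<beta>0 (k + 1) = energy i k - gram i (k - 1) * (\<beta>0 k)\<^sup>T - gram i k * \<alpha> k"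
proof -
  have c: "A * Q0 k \<in> carrier_mat n p" "Q0 (k - 1) * (\<beta>0 k)\<^sup>T \<in> carrier_mat n p"
    "Q0 k * \<alpha> k \<in> carrier_mat n p"
    using assms by simp_all
  have "gram i (k + 1) * \<beta>0 (k + 1) = (Q0 i)\<^sup>T * (Q0 (k + 1) * \<beta>0 (k + 1))"
    using assms by (simp add: gram_def assoc_mult_mat[of _ p n _ p _ p])
  also have "\<dots> = (Q0 i)\<^sup>T * (A * Q0 k) - (Q0 i)\<^sup>T * (Q0 (k - 1) * (\<beta>0 k)\<^sup>T)
      - (Q0 i)\<^sup>T * (Q0 k * \<alpha> k)"
    unfolding three_term[OF assms(2,3)] using assms c
    by (simp add: mult_minus_distrib_mat[of _ p n _ p] minus_carrier_mat)
  finally show ?thesis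
    unfolding gram_def energy_def using assms
    by (simp only: assoc_mult_mat[of _ p n _ p _ p] transpose_carrier_mat Q0_carrier \<beta>0_carrier \<alpha>_carrier
        less_imp_le diff_le_self order_trans[OF diff_le_self])
qed

lemma energy_diag:
  assumes "1 \<le> k" "k \<le> m" "gram k (k - 1) = 0\<^sub>m p p"
  shows "energy k k = \<alpha> k"
proof -
  have c: "A * Q0 k \<in> carrier_mat n p" "Q0 (k - 1) * (\<beta>0 k)\<^sup>T \<in> carrier_mat n p"
    using assms by simp_all
  have "\<alpha> k = energy k k - gram k (k - 1) * (\<beta>0 k)\<^sup>T"
    unfolding \<alpha>_eq[OF assms(1,2)] gram_def energy_def
      assoc_mult_mat[OF transpose_carrier_mat[THEN iffD2, OF Q0_carrier[OF assms(2)]] Q0_carrier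
        transpose_carrier_mat[THEN iffD2, OF \<beta>0_carrier], of "k - 1", OF order_trans[OF diff_le_self assms(2)]]
    using assms c by (intro mult_minus_distrib_mat[of _ p n _ p]) simp_all
  also have "\<dots> = energy k k"
    using assms(1,2) unfolding assms(3) by (simp add: unit_simps)
  finally show ?thesis by simp
qed

text \<open>The recurrence for \<open>A Q\<^sub>i\<close> involves only the blocks \<open>i - 1\<close>, \<open>i\<close>, \<open>i + 1\<close>.\<close>

lemma energy_below:
  assumes orth: "\<And>j. j \<le> k \<Longrightarrow> gram k j = (if j = k \<and> 1 \<le> j then 1\<^sub>m p else 0\<^sub>m p p)"
    and i: "1 \<le> i" "i < k" and k: "k \<le> m"
  shows "energy k i = (if i + 1 = k then \<beta>0 k else 0\<^sub>m p p)"
proof -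
  have "gram k (i + 1) * \<beta>0 (i + 1) = energy k i - gram k (i - 1) * (\<beta>0 i)\<^sup>T - gram k i * \<alpha> i"
    using i k by (intro gram_step) auto
  moreover have "gram k (i - 1) = 0\<^sub>m p p" "gram k i = 0\<^sub>m p p"
    using i orth by auto
  moreover have "gram k (i + 1) * \<beta>0 (i + 1) = (if i + 1 = k then \<beta>0 k else 0\<^sub>m p p)"
    using i orth[of "i + 1"] by (auto simp: unit_simps)
  ultimately show ?thesis using i k by (simp add: unit_simps)
qed

text \<open>The classical Lanczos argument: \<open>\<alpha>\<^sub>k\<close> is chosen to make the residual orthogonal to \<open>Q\<^sub>k\<close>, symmetry of
  \<open>A\<close> gives orthogonality to \<open>Q\<^sub>k\<^sub>-\<^sub>1\<close> and to all earlier blocks, and \<open>\<beta>\<^sub>k\<^sub>+\<^sub>1\<close> can be cancelled because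
  there is no breakdown.\<close>

lemma orthonormal:
  assumes "k \<le> m"
  shows "\<forall>i\<le>k. \<forall>j\<le>k. gram i j = (if i = j \<and> 1 \<le> i then 1\<^sub>m p else 0\<^sub>m p p)"
  using assms
proof (induction k)
  case 0
  then show ?case by (auto simp: gram_def Q0_def)
next
  case (Suc k)
  then have IH: "gram i j = (if i = j \<and> 1 \<le> i then 1\<^sub>m p else 0\<^sub>m p p)" if "i \<le> k" "j \<le> k" for i j
    using that by auto
  have zero: "gram i (k + 1) = 0\<^sub>m p p" if i: "i \<le> k" for i
  proof (cases "i = 0")
    case True then show ?thesis using Suc.prems Q0_carrier[of "Suc k"] by (auto simp: gram_def Q0_def intro!: left_mult_zero_mat)
  next
    case False
    have k: "1 \<le> k" "k < m" "k \<le> m" using i False Suc.prems by auto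
    have g: "gram i (k + 1) * \<beta>0 (k + 1) = energy i k - gram i (k - 1) * (\<beta>0 k)\<^sup>T - gram i k * \<alpha> k"
      using k i by (intro gram_step) auto
    have "gram i (k + 1) * \<beta>0 (k + 1) = 0\<^sub>m p p"
    proof (cases "i = k")
      case True
      have "gram k (k - 1) = 0\<^sub>m p p" "gram k k = 1\<^sub>m p" using k IH by auto
      moreover have "energy k k = \<alpha> k" using k calculation by (intro energy_diag) auto
      ultimately show ?thesis
        using g k by (simp add: True unit_simps minus_r_inv_mat[of _ p p])
    next
      case neq: False
      have "energy k i = (if i + 1 = k then \<beta>0 k else 0\<^sub>m p p)"
        by (rule energy_below) (use IH k i neq False in auto)
      then have e: "energy i k = (if i + 1 = k then (\<beta>0 k)\<^sup>T else 0\<^sub>m p p)"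
        using energy_transpose[of k i] k i by (auto split: if_splits)
      have "gram i k = 0\<^sub>m p p" "gram i (k - 1) = (if i + 1 = k then 1\<^sub>m p else 0\<^sub>m p p)"
        using IH[of i k] IH[of i "k - 1"] i k neq False by auto
      then show ?thesis unfolding g e using k by (simp add: unit_simps minus_r_inv_mat[of _ p p])
    qed
    then have "gram i (k + 1) * \<beta>0 (k + 1) * minv (\<beta>0 (k + 1)) = 0\<^sub>m p p"
      using minv_carrier[OF \<beta>0_carrier det_\<beta>0[of "k + 1"]] k by (simp add: unit_simps)
    then show ?thesis
      using minv_carrier[OF \<beta>0_carrier det_\<beta>0[of "k + 1"]] minv_right[OF \<beta>0_carrier det_\<beta>0[of "k + 1"]] k i
      by (simp add: assoc_mult_mat[of _ p p _ p _ p] unit_simps)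
  qed
  have zero': "gram (k + 1) i = 0\<^sub>m p p" if "i \<le> k" for i
    using gram_transpose[of i "k + 1"] zero[OF that] that Suc.prems by auto
  show ?case
    using IH zero zero' Q0_normal[of "Suc k"] Suc.prems by (auto simp: le_Suc_eq gram_def)
qed

lemma energy_eq:
  assumes "1 \<le> i" "i \<le> k" "k \<le> m"
  shows "energy k i = (if i = k then \<alpha> k else if i + 1 = k then \<beta>0 k else 0\<^sub>m p p)"
proof (cases "i = k")
  case True
  then show ?thesis using assms orthonormal[OF assms(3)] by (auto intro!: energy_diag)
next
  case False
  have "energy k i = (if i + 1 = k then \<beta>0 k else 0\<^sub>m p p)"
    by (rule energy_below) (use assms False orthonormal[OF assms(3)] in auto)
  then show ?thesis using False by simp
qed

end

section \<open>Positivity of the Stieltjes parameters\<close>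

context lanczos_run begin

abbreviation "\<kappa> \<equiv> kappa_hat p \<alpha> \<beta>"
abbreviation "\<gamma> \<equiv> gamma p \<alpha> \<beta>"

text \<open>The columns of \<open>Z\<^sub>i\<close> correspond to block vectors \<open>u\<^sub>j = \<kappa>\<^sub>j v\<close> with the same \<open>v\<close> for all \<open>j \<le> i\<close>.  On them
  the quadratic form of the leading part of \<open>T\<^sub>m\<close> reduces to that of \<open>\<gamma>\<^sub>i\<^sup>-\<^sup>1\<close>.\<close>

primrec Z :: "nat \<Rightarrow> real mat" where
  "Z 0 = 0\<^sub>m n p"
| "Z (Suc i) = Z i + Q0 (Suc i) * \<kappa> (Suc i)"

definition pivot_energy :: "nat \<Rightarrow> real mat" where
  "pivot_energy i = (Z i)\<^sup>T * (A * Z i)"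

lemma Z_facts:
  assumes "i \<le> m" "\<And>j. 1 \<le> j \<Longrightarrow> j \<le> i \<Longrightarrow> \<kappa> j \<in> carrier_mat p p"
  shows "Z i \<in> carrier_mat n p \<and>
    (\<forall>k. i < k \<and> k \<le> m \<longrightarrow> (Q0 k)\<^sup>T * Z i = 0\<^sub>m p p) \<and>
    (\<forall>k. i + 1 < k \<and> k \<le> m \<longrightarrow> (Q0 k)\<^sup>T * (A * Z i) = 0\<^sub>m p p) \<and>
    (1 \<le> i \<longrightarrow> (Q0 i)\<^sup>T * Z i = \<kappa> i) \<and>
    (1 \<le> i \<and> i < m \<longrightarrow> (Q0 (i + 1))\<^sup>T * (A * Z i) = \<beta>0 (i + 1) * \<kappa> i)"
  using assms
proof (induction i)
  case 0
  have "(Q0 k)\<^sup>T * 0\<^sub>m n p = 0\<^sub>m p p" "(Q0 k)\<^sup>T * (A * 0\<^sub>m n p) = 0\<^sub>m p p"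
    if "k \<le> m" for k
    using that right_mult_zero_mat[of A n n p] right_mult_zero_mat[of "(Q0 k)\<^sup>T" p n p] by simp_all
  then show ?case by simp
next
  case (Suc i)
  note IH = Suc.IH[OF Suc_leD[OF Suc.prems(1)] Suc.prems(2)]
  have c: "Z i \<in> carrier_mat n p" using IH by simp
  have k: "\<kappa> (Suc i) \<in> carrier_mat p p" using Suc.prems by simp
  have Q: "Q0 (Suc i) \<in> carrier_mat n p" using Suc.prems by simp
  have g: "(Q0 k)\<^sup>T * Z (Suc i) = (Q0 k)\<^sup>T * Z i + gram k (Suc i) * \<kappa> (Suc i)"
    if "k \<le> m" for k
    using that c k Q by (simp add: gram_def mult_add_distrib_mat[of _ p n _ p] assoc_mult_mat[of _ p n _ p _ p])
  have e: "(Q0 k)\<^sup>T * (A * Z (Suc i)) = (Q0 k)\<^sup>T * (A * Z i) + energy k (Suc i) * \<kappa> (Suc i)"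
    if "k \<le> m" for k
  proof -
    have "A * (Q0 (Suc i) * \<kappa> (Suc i)) = (A * Q0 (Suc i)) * \<kappa> (Suc i)"
      using k Q by (simp add: assoc_mult_mat[of A n n _ p _ p])
    moreover have "(Q0 k)\<^sup>T * ((A * Q0 (Suc i)) * \<kappa> (Suc i)) = energy k (Suc i) * \<kappa> (Suc i)"
      using that k Q unfolding energy_def by (intro assoc_mult_mat[of _ p n _ p _ p, symmetric]) simp_all
    ultimately show ?thesis
      using that c k Q by (simp add: mult_add_distrib_mat[of A n n _ p] mult_add_distrib_mat[of _ p n _ p])
  qed
  have gk: "gram k (Suc i) = (if k = Suc i then 1\<^sub>m p else 0\<^sub>m p p)" if "k \<le> m" for k
    using orthonormal[OF order_refl] that Suc.prems by auto
  have ek: "energy k (Suc i) = (if k = Suc (Suc i) then \<beta>0 k else 0\<^sub>m p p)" if "k \<le> m" "Suc i < k" for k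
    using energy_eq[of "Suc i" k] that by auto
  have b: "\<beta>0 j * \<kappa> (Suc i) \<in> carrier_mat p p" for j using k by simp
  have cZ: "Z (Suc i) \<in> carrier_mat n p" using c k Q by simp
  have r1: "(Q0 j)\<^sup>T * Z (Suc i) = 0\<^sub>m p p" if "Suc i < j" "j \<le> m" for j
    using that g[of j] gk[of j] IH k by (simp add: unit_simps)
  have r2: "(Q0 j)\<^sup>T * (A * Z (Suc i)) = 0\<^sub>m p p" if "Suc i + 1 < j" "j \<le> m" for j
    using that e[of j] ek[of j] IH k by (simp add: unit_simps)
  have r3: "(Q0 (Suc i))\<^sup>T * Z (Suc i) = \<kappa> (Suc i)"
    using Suc.prems(1) g[of "Suc i"] gk[of "Suc i"] IH k by (simp add: unit_simps)
  have r4: "(Q0 (Suc i + 1))\<^sup>T * (A * Z (Suc i)) = \<beta>0 (Suc i + 1) * \<kappa> (Suc i)" if "Suc i < m"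
    using that e[of "Suc (Suc i)"] ek[of "Suc (Suc i)"] IH k b by (simp add: unit_simps)
  show ?case using cZ r1 r2 r3 r4 by blast
qed

text \<open>Only the neighbouring block couples \<open>Z\<^sub>i\<close> to \<open>Q\<^sub>i\<^sub>+\<^sub>1\<close>, so a single pair of cross terms appears.\<close>

lemma pivot_energy_Suc:
  assumes "Suc i \<le> m" "1 \<le> i" "\<And>j. 1 \<le> j \<Longrightarrow> j \<le> Suc i \<Longrightarrow> \<kappa> j \<in> carrier_mat p p"
  shows "pivot_energy (Suc i) = pivot_energy i + ((\<kappa> (Suc i))\<^sup>T * (\<beta>0 (Suc i) * \<kappa> i))\<^sup>T
    + ((\<kappa> (Suc i))\<^sup>T * (\<beta>0 (Suc i) * \<kappa> i) + (\<kappa> (Suc i))\<^sup>T * \<alpha> (Suc i) * \<kappa> (Suc i))"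
proof -
  note f = Z_facts[OF Suc_leD[OF assms(1)] assms(3)]
  have c: "Z i \<in> carrier_mat n p" using f by simp
  have k: "\<kappa> (Suc i) \<in> carrier_mat p p" and Q: "Q0 (Suc i) \<in> carrier_mat n p" using assms by simp_all
  have b: "(Q0 (Suc i))\<^sup>T * (A * Z i) = \<beta>0 (Suc i) * \<kappa> i" using f assms by simp
  have b': "(Z i)\<^sup>T * (A * Q0 (Suc i)) = (\<beta>0 (Suc i) * \<kappa> i)\<^sup>T"
    unfolding b[symmetric] using c Q
    by (simp add: transpose_mult[of _ p n _ p] transpose_mult[of _ n n _ p] assoc_mult_mat[of _ p n _ n _ p])
  have a: "(Q0 (Suc i))\<^sup>T * (A * Q0 (Suc i)) = \<alpha> (Suc i)"
    using energy_eq[of "Suc i" "Suc i"] assms by (simp add: energy_def)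
  let ?Y = "Q0 (Suc i) * \<kappa> (Suc i)"
  have Y: "?Y \<in> carrier_mat n p" using k Q by simp
  have t: "?Y\<^sup>T = (\<kappa> (Suc i))\<^sup>T * (Q0 (Suc i))\<^sup>T"
    using k Q by (simp add: transpose_mult[of _ n p _ p])
  have AY: "A * ?Y = (A * Q0 (Suc i)) * \<kappa> (Suc i)"
    using k Q by (simp add: assoc_mult_mat[of A n n _ p _ p])
  have "(Z i)\<^sup>T * (A * ?Y) = ((Z i)\<^sup>T * (A * Q0 (Suc i))) * \<kappa> (Suc i)"
    unfolding AY using k Q c by (intro assoc_mult_mat[symmetric, of _ p n _ p _ p]) simp_all
  also have "\<dots> = ((\<kappa> (Suc i))\<^sup>T * (\<beta>0 (Suc i) * \<kappa> i))\<^sup>T"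
    unfolding b' using k assms(2,3) by (simp add: transpose_mult[of _ p p _ p])
  finally have 1: "(Z i)\<^sup>T * (A * ?Y) = \<dots>" .
  have "?Y\<^sup>T * (A * Z i) = (\<kappa> (Suc i))\<^sup>T * ((Q0 (Suc i))\<^sup>T * (A * Z i))"
    unfolding t using k Q c by (intro assoc_mult_mat[of _ p p _ n _ p]) simp_all
  then have 2: "?Y\<^sup>T * (A * Z i) = (\<kappa> (Suc i))\<^sup>T * (\<beta>0 (Suc i) * \<kappa> i)"
    unfolding b .
  have "?Y\<^sup>T * (A * ?Y) = (\<kappa> (Suc i))\<^sup>T * ((Q0 (Suc i))\<^sup>T * ((A * Q0 (Suc i)) * \<kappa> (Suc i)))"
    unfolding t AY using k Q by (intro assoc_mult_mat[of _ p p _ n _ p]) simp_all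
  also have "(Q0 (Suc i))\<^sup>T * ((A * Q0 (Suc i)) * \<kappa> (Suc i)) = \<alpha> (Suc i) * \<kappa> (Suc i)"
    unfolding a[symmetric] using k Q by (intro assoc_mult_mat[symmetric, of _ p n _ p _ p]) simp_all
  also have "(\<kappa> (Suc i))\<^sup>T * (\<alpha> (Suc i) * \<kappa> (Suc i)) = (\<kappa> (Suc i))\<^sup>T * \<alpha> (Suc i) * \<kappa> (Suc i)"
    using k assms(1) by (intro assoc_mult_mat[symmetric, of _ p p _ p _ p]) simp_all
  finally have 3: "?Y\<^sup>T * (A * ?Y) = \<dots>" .
  have cc: "(Z i)\<^sup>T \<in> carrier_mat p n" "A * Z i \<in> carrier_mat n p" "A * ?Y \<in> carrier_mat n p"
    "?Y\<^sup>T \<in> carrier_mat p n" using c Y by simp_all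
  have "pivot_energy (Suc i) = ((Z i)\<^sup>T + ?Y\<^sup>T) * (A * Z i + A * ?Y)"
    using c Y by (simp add: pivot_energy_def transpose_add[of _ n p] mult_add_distrib_mat[of A n n _ p])
  also have "\<dots> = ((Z i)\<^sup>T * (A * Z i) + (Z i)\<^sup>T * (A * ?Y)) +
     (?Y\<^sup>T * (A * Z i) + ?Y\<^sup>T * (A * ?Y))"
    using cc by (subst add_mult_distrib_mat[of _ p n _ _ p]) (simp_all add: mult_add_distrib_mat[of _ p n _ p])
  finally show ?thesis unfolding 1 2 3 pivot_energy_def .
qed

text \<open>By definition of \<open>\<kappa>\<^sub>i\<close> each cross term in the energy of \<open>Z\<^sub>i\<close> equals \<open>-\<gamma>\<^sub>i\<^sub>-\<^sub>1\<^sup>-\<^sup>1\<close>, so that the energy is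
  \<open>\<gamma>\<^sub>i\<^sub>-\<^sub>1\<^sup>-\<^sup>1 - 2 \<gamma>\<^sub>i\<^sub>-\<^sub>1\<^sup>-\<^sup>1 + \<kappa>\<^sub>i\<^sup>T \<alpha>\<^sub>i \<kappa>\<^sub>i\<close>, which is the expression that defines \<open>\<gamma>\<^sub>i\<^sup>-\<^sup>1\<close>.  It is
  positive definite since \<open>Q\<^sub>i\<^sup>T Z\<^sub>i = \<kappa>\<^sub>i\<close> is nonsingular.  The last two conclusions express the
  blocks of \<open>T\<^sub>m\<close> by the parameters.\<close>

theorem stieltjes_parameters:
  assumes "1 \<le> i" "i \<le> m"
  shows "\<kappa> i \<in> carrier_mat p p \<and> Determinant.det (\<kappa> i) \<noteq> 0 \<and> sym_pos_def p (\<gamma> i) \<and> minv (\<gamma> i) = pivot_energy i \<and>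
    (\<kappa> i)\<^sup>T * \<alpha> i * \<kappa> i = minv (\<gamma> i) + (if i = 1 then 0\<^sub>m p p else minv (\<gamma> (i - 1))) \<and>
    (2 \<le> i \<longrightarrow> (\<kappa> i)\<^sup>T * (\<beta> i * \<kappa> (i - 1)) = - minv (\<gamma> (i - 1)))"
  using assms
proof (induction i rule: less_induct)
  case (less i)
  have pos: "sym_pos_def p (pivot_energy i)"
    if k: "\<And>j. 1 \<le> j \<Longrightarrow> j \<le> i \<Longrightarrow> \<kappa> j \<in> carrier_mat p p" and d: "Determinant.det (\<kappa> i) \<noteq> 0"
  proof -
    note f = Z_facts[OF less.prems(2) k]
    show ?thesis unfolding pivot_energy_def
      by (rule sym_pos_def_congruence[OF A, of _ p "Q0 i"]) (use f d less.prems in auto)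
  qed
  show ?case
  proof (cases "i = 1")
    case True
    have \<alpha>1: "\<alpha> 1 = pivot_energy 1"
      using energy_eq[of 1 1] less.prems True left_add_zero_mat[of "Q0 1" n p]
      by (simp add: pivot_energy_def energy_def right_mult_one_mat[of _ n p])
    have p: "sym_pos_def p (pivot_energy 1)"
      using pos True by (simp add: less_Suc_eq_le le_Suc_eq)
    have "minv (\<gamma> 1) = pivot_energy 1"
      using minv_minv[OF sym_pos_def_carrier[OF p] sym_pos_def_det[OF p]] \<alpha>1 by simp
    moreover have "sym_pos_def p (\<gamma> 1)" using sym_pos_def_minv[OF p] \<alpha>1 by simp
    ultimately show ?thesis
      using \<alpha>1 sym_pos_def_carrier[OF p] True by (simp add: unit_simps)
  next
    case False
    then have "i = Suc (Suc (i - 2))" using less.prems by simp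
    then obtain j where j: "i = Suc (Suc j)" by blast
    let ?l = "Suc j"
    have IH: "\<kappa> k \<in> carrier_mat p p" "Determinant.det (\<kappa> k) \<noteq> 0" "sym_pos_def p (\<gamma> k)" "minv (\<gamma> k) = pivot_energy k"
      if "1 \<le> k" "k < i" for k using less.IH[OF that(2,1)] that less.prems by auto
    have l: "1 \<le> ?l" "?l < i" using j by auto
    note kl = IH(1)[OF l] and dl = IH(2)[OF l] and gl = IH(3)[OF l] and pl = IH(4)[OF l]
    note cg = sym_pos_def_carrier[OF gl] and dg = sym_pos_def_det[OF gl]
    have bi: "\<beta>0 i = \<beta> i" using j less.prems by (simp add: \<beta>0_def)
    have cb: "\<beta> i \<in> carrier_mat p p" using \<beta>0_carrier[of i] bi by simp
    have db: "Determinant.det (\<beta> i) \<noteq> 0" using det_\<beta>0[of i] bi j less.prems by simp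
    let ?N = "- (\<gamma> ?l * (\<kappa> ?l)\<^sup>T * (\<beta> i)\<^sup>T)"
    have cN: "?N \<in> carrier_mat p p" using cg kl cb by simp
    have dN: "Determinant.det ?N \<noteq> 0"
    proof -
      have "Determinant.det (\<gamma> ?l * (\<kappa> ?l)\<^sup>T * (\<beta> i)\<^sup>T) \<noteq> 0"
        using cg kl cb dg dl db by (simp add: Determinant.det_mult[of _ p] Determinant.det_transpose[of _ p])
      then show ?thesis using cg kl cb by (subst det_0_negate[of _ p]) auto
    qed
    have ki: "\<kappa> i = minv ?N" using j by simp
    have ck: "\<kappa> i \<in> carrier_mat p p" and dk: "Determinant.det (\<kappa> i) \<noteq> 0"
      unfolding ki using minv_carrier[OF cN dN] det_minv_nonzero[OF cN dN] by auto
    have NK: "?N * \<kappa> i = 1\<^sub>m p" unfolding ki by (rule minv_right[OF cN dN])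
    let ?d = "minv (\<gamma> ?l)"
    have cd: "?d \<in> carrier_mat p p" and dg1: "?d * \<gamma> ?l = 1\<^sub>m p"
      using minv_carrier[OF cg dg] minv_left[OF cg dg] by auto
    have dt: "?d\<^sup>T = ?d"
      using sym_pos_def_transpose[OF sym_pos_def_minv[OF gl]] .
    have "?d = ?d * (?N * \<kappa> i)" unfolding NK using cd by (simp add: unit_simps)
    also have "\<dots> = - (?d * \<gamma> ?l * ((\<kappa> ?l)\<^sup>T * ((\<beta> i)\<^sup>T * \<kappa> i)))"
      using cd cg kl cb ck by (simp add: assoc_mult_mat[of _ p p _ p _ p])
    also have "\<dots> = - ((\<kappa> ?l)\<^sup>T * ((\<beta> i)\<^sup>T * \<kappa> i))"
      unfolding dg1 using kl cb ck by (simp add: unit_simps)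
    finally have "?d\<^sup>T = (- ((\<kappa> ?l)\<^sup>T * ((\<beta> i)\<^sup>T * \<kappa> i)))\<^sup>T" by simp
    also have "\<dots> = - ((\<kappa> i)\<^sup>T * (\<beta> i * \<kappa> ?l))"
      using kl cb ck by (simp add: transpose_uminus transpose_mult[of _ p p _ p] assoc_mult_mat[of _ p p _ p _ p])
    finally have R1: "(\<kappa> i)\<^sup>T * (\<beta> i * \<kappa> ?l) = - ?d" unfolding dt by simp
    have kall: "\<kappa> k \<in> carrier_mat p p" if "1 \<le> k" "k \<le> i" for k
      using IH(1)[of k] ck that by (cases "k = i") auto
    have pi: "sym_pos_def p (pivot_energy i)" by (rule pos[OF kall dk])
    let ?a = "(\<kappa> i)\<^sup>T * \<alpha> i * \<kappa> i"
    have ca: "?a \<in> carrier_mat p p" using ck less.prems by simp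
    have "pivot_energy i = ?d + (- ?d)\<^sup>T + (- ?d + ?a)"
      using pivot_energy_Suc[of ?l] kall less.prems R1 bi pl j by simp
    then have pe: "pivot_energy i = ?a - ?d"
      using cd ca unfolding transpose_uminus dt by (auto intro!: eq_matI)
    have gi: "\<gamma> i = minv (pivot_energy i)" unfolding pe using j by simp
    have mg: "minv (\<gamma> i) = pivot_energy i"
      unfolding gi by (rule minv_minv[OF sym_pos_def_carrier[OF pi] sym_pos_def_det[OF pi]])
    have "?a = minv (\<gamma> i) + ?d"
      unfolding mg pe using ca cd by (auto intro!: eq_matI)
    then show ?thesis
      using ck dk sym_pos_def_minv[OF pi] mg R1 j gi by simp
  qed
qed

end

section \<open>The block tridiagonal system as a ladder\<close>

definition block :: "nat \<Rightarrow> 'a vec \<Rightarrow> nat \<Rightarrow> 'a vec" where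
  "block p u i = vec p (\<lambda>a. u $ ((i - 1) * p + a))"

lemma block_carrier[simp]: "block p u i \<in> carrier_vec p" and dim_block[simp]: "dim_vec (block p u i) = p"
  and block_index[simp]: "a < p \<Longrightarrow> block p u i $ a = u $ ((i - 1) * p + a)"
  by (auto simp: block_def)

lemma block_position_less:
  assumes "1 \<le> i" "i \<le> m" "a < p"
  shows "(i - 1) * p + a < m * (p::nat)"
proof -
  have "(i - 1) * p + a < (i - 1) * p + p" using assms by simp
  also have "\<dots> = i * p" using assms by (cases i) auto
  also have "\<dots> \<le> m * p" using assms by simp
  finally show ?thesis .
qed

lemma sum_over_blocks:
  fixes f :: "nat \<Rightarrow> 'a::comm_monoid_add"
  shows "(\<Sum>c<m * p. f c) = (\<Sum>j<m. \<Sum>b<p. f (j * p + b))"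
proof -
  have "sum f {j * p..<j * p + p} = (\<Sum>b<p. f (j * p + b))" for j
    by (rule sum.reindex_bij_witness[of _ "\<lambda>b. j * p + b" "\<lambda>c. c - j * p"]) auto
  then show ?thesis by (simp add: sum.nat_group[symmetric])
qed

lemma vec_eq_0_if_blocks:
  assumes u: "u \<in> carrier_vec (m * p)" and z: "\<And>i. 1 \<le> i \<Longrightarrow> i \<le> m \<Longrightarrow> block p u i = 0\<^sub>v p"
  shows "u = 0\<^sub>v (m * p)"
proof (rule eq_vecI)
  fix c assume "c < dim_vec (0\<^sub>v (m * p))"
  then have c: "c < m * p" by simp
  then have p: "0 < p" by (cases p) auto
  have "c div p < m" using c by (simp add: less_mult_imp_div_less)
  then have "block p u (c div p + 1) $ (c mod p) = 0" using z[of "c div p + 1"] p by simp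
  then show "u $ c = 0\<^sub>v (m * p) $ c" using p c by simp
qed (use u in simp)

lemma block_unit_carrier[simp]: "block_unit m p i \<in> carrier_mat (m * p) p"
  by (simp add: block_unit_def)

lemma transpose_block_unit_mult_vec:
  fixes u :: "'a::comm_semiring_1 vec"
  assumes i: "1 \<le> i" "i \<le> m" and u: "u \<in> carrier_vec (m * p)"
  shows "(block_unit m p i)\<^sup>T *\<^sub>v u = block p u i"
proof (rule eq_vecI)
  fix a assume "a < dim_vec (block p u i)"
  then have a: "a < p" by simp
  note lt = block_position_less[OF i a]
  have "((block_unit m p i)\<^sup>T *\<^sub>v u) $ a =
      (\<Sum>c<m * p. (if c = (i - 1) * p + a then 1 else 0) * u $ c)"
    using a u by (simp add: block_unit_def scalar_prod_def atLeast0LessThan)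
  also have "\<dots> = u $ ((i - 1) * p + a)"
    using lt by (simp add: if_distrib[of "\<lambda>x. x * _"] cong: if_cong)
  finally show "((block_unit m p i)\<^sup>T *\<^sub>v u) $ a = block p u i $ a" using a by simp
qed (use u in \<open>simp add: block_unit_def\<close>)

lemma block_block_unit_mult_vec:
  fixes w :: "'a::comm_semiring_1 vec"
  assumes i: "1 \<le> i" "i \<le> m" and j: "1 \<le> j" and w: "w \<in> carrier_vec p"
  shows "block p (block_unit m p j *\<^sub>v w) i = (if i = j then w else 0\<^sub>v p)"
proof (rule eq_vecI)
  fix a assume "a < dim_vec (if i = j then w else 0\<^sub>v p)"
  then have a: "a < p" using w by (auto split: if_splits)
  note lt = block_position_less[OF i a]
  have pos: "(i - 1) * p + a = (j - 1) * p + c \<longleftrightarrow> i = j \<and> a = c" if "c < p" for c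
  proof
    assume e: "(i - 1) * p + a = (j - 1) * p + c"
    have "((i - 1) * p + a) div p = i - 1" "((j - 1) * p + c) div p = j - 1" using a that by auto
    with e have "i - 1 = j - 1" by simp
    with e i j show "i = j \<and> a = c" by auto
  qed auto
  have "block p (block_unit m p j *\<^sub>v w) i $ a =
      (\<Sum>c<p. (if (i - 1) * p + a = (j - 1) * p + c then 1 else 0) * w $ c)"
    using a w lt by (simp add: block_unit_def scalar_prod_def atLeast0LessThan)
  also have "\<dots> = (\<Sum>c<p. (if c = a then (if i = j then w $ a else 0) else 0))"
    by (intro sum.cong refl, subst pos) auto
  also have "\<dots> = (if i = j then w else 0\<^sub>v p) $ a" using a by simp
  finally show "block p (block_unit m p j *\<^sub>v w) i $ a = (if i = j then w else 0\<^sub>v p) $ a" .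
qed (use w in auto)

lemma block_tridiag_carrier[simp]: "block_tridiag m p \<alpha> \<beta> \<in> carrier_mat (m * p) (m * p)"
  by (simp add: block_tridiag_def)

lemma block_tridiag_entry:
  assumes i: "1 \<le> i" "i \<le> m" and j: "j < m" and ab: "a < p" "b < p"
  shows "block_tridiag m p \<alpha> \<beta> $$ ((i - 1) * p + a, j * p + b) =
    (if j = i - 1 then \<alpha> i $$ (a,b)
     else if 1 < i \<and> j = i - 2 then \<beta> i $$ (a,b)
     else if j = i then (\<beta> (i + 1))\<^sup>T $$ (a,b) else 0)"
proof -
  have r: "((i - 1) * p + a) div p = i - 1" "((i - 1) * p + a) mod p = a" "(j * p + b) div p = j" "(j * p + b) mod p = b"
    using ab by auto
  have l: "(i - 1) * p + a < m * p" by (rule block_position_less[OF i ab(1)])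
  have l': "j * p + b < m * p" using block_position_less[of "j + 1" m b p] j ab by simp
  show ?thesis
    unfolding block_tridiag_def index_mat(1)[OF l l'] prod.case Let_def r using i j by auto
qed

lemma block_block_tridiag_mult_vec:
  assumes i: "1 \<le> i" "i \<le> m" and u: "u \<in> carrier_vec (m * p)"
    and \<alpha>: "\<alpha> i \<in> carrier_mat p p"
    and \<beta>: "1 < i \<Longrightarrow> \<beta> i \<in> carrier_mat p p" "i < m \<Longrightarrow> \<beta> (i + 1) \<in> carrier_mat p p"
  shows "block p (cmat (block_tridiag m p \<alpha> \<beta>) *\<^sub>v u) i =
    (if 1 < i then cmat (\<beta> i) *\<^sub>v block p u (i - 1) else 0\<^sub>v p) + cmat (\<alpha> i) *\<^sub>v block p u i +
    (if i < m then cmat ((\<beta> (i + 1))\<^sup>T) *\<^sub>v block p u (i + 1) else 0\<^sub>v p)" (is "_ = ?L + ?D + ?U")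
proof (rule eq_vecI)
  have cU: "?U \<in> carrier_vec p" using \<beta> by auto
  fix a assume "a < dim_vec (?L + ?D + ?U)"
  then have a: "a < p" using cU by auto
  note lt = block_position_less[OF i a]
  define sl where "sl X j = (\<Sum>b<p. complex_of_real (X $$ (a,b)) * u $ (j * p + b))" for X j
  have D: "?D $ a = sl (\<alpha> i) (i - 1)"
    using a \<alpha> by (simp add: sl_def scalar_prod_def atLeast0LessThan)
  have L: "?L $ a = (if 1 < i then sl (\<beta> i) (i - 2) else 0)"
  proof -
    have e: "i - 1 - 1 = i - 2" by simp
    have "(cmat (\<beta> i) *\<^sub>v block p u (i - 1)) $ a = sl (\<beta> i) (i - 1 - 1)" if "1 < i"
      using a \<beta>(1)[OF that] by (simp add: sl_def scalar_prod_def atLeast0LessThan)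
    then show ?thesis using a by (simp add: e del: One_nat_def)
  qed
  have U: "?U $ a = (if i < m then sl ((\<beta> (i + 1))\<^sup>T) i else 0)"
    using a \<beta>(2) by (auto simp: sl_def scalar_prod_def atLeast0LessThan intro!: sum.cong)
  have "block p (cmat (block_tridiag m p \<alpha> \<beta>) *\<^sub>v u) i $ a =
      (\<Sum>c<m * p. complex_of_real (block_tridiag m p \<alpha> \<beta> $$ ((i - 1) * p + a, c)) * u $ c)"
    using a u lt by (simp add: scalar_prod_def atLeast0LessThan block_tridiag_def)
  also have "\<dots> = (\<Sum>j<m. \<Sum>b<p. complex_of_real (block_tridiag m p \<alpha> \<beta> $$ ((i - 1) * p + a, j * p + b)) * u $ (j * p + b))"
    by (rule sum_over_blocks)
  also have "\<dots> = (\<Sum>j<m. (if j = i - 1 then sl (\<alpha> i) (i - 1) else 0) +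
      (if j = i - 2 then (if 1 < i then sl (\<beta> i) (i - 2) else 0) else 0) +
      (if j = i then sl ((\<beta> (i + 1))\<^sup>T) i else 0))"
  proof (rule sum.cong[OF refl])
    fix j assume "j \<in> {..<m}"
    then have j: "j < m" by simp
    have "(\<Sum>b<p. complex_of_real (block_tridiag m p \<alpha> \<beta> $$ ((i - 1) * p + a, j * p + b)) * u $ (j * p + b)) =
      (\<Sum>b<p. complex_of_real (if j = i - 1 then \<alpha> i $$ (a,b)
     else if 1 < i \<and> j = i - 2 then \<beta> i $$ (a,b)
     else if j = i then (\<beta> (i + 1))\<^sup>T $$ (a,b) else 0) * u $ (j * p + b))"
      by (intro sum.cong refl) (simp only: block_tridiag_entry[OF i j a] lessThan_iff)
    also have "\<dots> = (if j = i - 1 then sl (\<alpha> i) (i - 1) else 0) +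
      (if j = i - 2 then (if 1 < i then sl (\<beta> i) (i - 2) else 0) else 0) +
      (if j = i then sl ((\<beta> (i + 1))\<^sup>T) i else 0)"
      using i by (cases "j = i - 1"; cases "1 < i \<and> j = i - 2"; cases "j = i") (auto simp: sl_def)
    finally show "(\<Sum>b<p. complex_of_real (block_tridiag m p \<alpha> \<beta> $$ ((i - 1) * p + a, j * p + b)) * u $ (j * p + b)) = \<dots>" .
  qed
  also have "\<dots> = ?D $ a + ?L $ a + ?U $ a"
    unfolding D L U using i by (auto simp: sum.distrib)
  finally show "block p (cmat (block_tridiag m p \<alpha> \<beta>) *\<^sub>v u) i $ a = (?L + ?D + ?U) $ a"
    using a \<alpha> \<beta> by auto
qed (use \<beta> in auto)

lemma cmat_add:
  "M \<in> carrier_mat a b \<Longrightarrow> N \<in> carrier_mat a b \<Longrightarrow> cmat (M + N) = cmat M + cmat N"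
  by (rule eq_matI) auto

lemma cmat_mult:
  "M \<in> carrier_mat a b \<Longrightarrow> N \<in> carrier_mat b c \<Longrightarrow> cmat (M * N) = cmat M * cmat N"
  by (rule of_real_hom.mat_hom_mult)

lemma mat_eq_if_mult_vec_eq:
  fixes M N :: "'a::semiring_1 mat"
  assumes M: "M \<in> carrier_mat a b" and N: "N \<in> carrier_mat a b"
    and eq: "\<And>x. x \<in> carrier_vec b \<Longrightarrow> M *\<^sub>v x = N *\<^sub>v x"
  shows "M = N"
proof (rule eq_matI)
  fix i j assume ij: "i < dim_row N" "j < dim_col N"
  have "(M *\<^sub>v unit_vec b j) $ i = (N *\<^sub>v unit_vec b j) $ i" using eq by simp
  then show "M $$ (i,j) = N $$ (i,j)" using ij M N by simp
qed (use M N in auto)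

lemma cmat_mult_vec3:
  assumes "P \<in> carrier_mat p p" "R \<in> carrier_mat p p" "S \<in> carrier_mat p p" "v \<in> carrier_vec p"
  shows "cmat P *\<^sub>v (cmat R *\<^sub>v (cmat S *\<^sub>v v)) = cmat (P * (R * S)) *\<^sub>v v"
proof -
  have "cmat (P * (R * S)) = cmat P * (cmat R * cmat S)"
    using assms by (simp add: of_real_hom.mat_hom_mult[of _ p p _ p])
  then show ?thesis using assms by (simp add: assoc_mult_mat_vec[of _ p p _ p])
qed

text \<open>The two identities \<open>diag\<close> and \<open>subdiag\<close> say that the congruence by the block diagonal matrix of the
  \<open>\<kappa>\<^sub>i\<close> turns \<open>T\<^sub>m\<close> into a matrix determined by the \<open>\<gamma>\<^sub>i\<^sup>-\<^sup>1\<close> alone, with block row sums zero except in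
  the last row.\<close>

locale lanczos_ladder =
  fixes m p :: nat and \<alpha> \<beta> \<kappa> \<gamma> :: "nat \<Rightarrow> real mat"
  assumes m: "1 \<le> m"
    and \<alpha>c: "\<And>i. 1 \<le> i \<Longrightarrow> i \<le> m \<Longrightarrow> \<alpha> i \<in> carrier_mat p p"
    and \<beta>c: "\<And>i. 2 \<le> i \<Longrightarrow> i \<le> m \<Longrightarrow> \<beta> i \<in> carrier_mat p p"
    and \<kappa>c: "\<And>i. 1 \<le> i \<Longrightarrow> i \<le> m \<Longrightarrow> \<kappa> i \<in> carrier_mat p p"
    and \<kappa>det: "\<And>i. 1 \<le> i \<Longrightarrow> i \<le> m \<Longrightarrow> Determinant.det (\<kappa> i) \<noteq> 0"
    and \<kappa>1: "\<kappa> 1 = 1\<^sub>m p"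
    and \<gamma>: "\<And>i. 1 \<le> i \<Longrightarrow> i \<le> m \<Longrightarrow> sym_pos_def p (\<gamma> i)"
    and diag: "\<And>i. 1 \<le> i \<Longrightarrow> i \<le> m \<Longrightarrow> (\<kappa> i)\<^sup>T * \<alpha> i * \<kappa> i =
        minv (\<gamma> i) + (if i = 1 then 0\<^sub>m p p else minv (\<gamma> (i - 1)))"
    and subdiag: "\<And>i. 2 \<le> i \<Longrightarrow> i \<le> m \<Longrightarrow> (\<kappa> i)\<^sup>T * (\<beta> i * \<kappa> (i - 1)) = - minv (\<gamma> (i - 1))"
begin

definition K :: "nat \<Rightarrow> real mat" where "K i = (\<kappa> i)\<^sup>T * \<kappa> i"

fun ladder :: "nat \<Rightarrow> nat \<Rightarrow> real mat list" where
  "ladder i 0 = [K i]"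
| "ladder i (Suc k) = K i # \<gamma> i # ladder (Suc i) k"

lemma sym_pos_def_K:
  assumes i: "1 \<le> i" "i \<le> m"
  shows "sym_pos_def p (K i)"
proof -
  have "0 < scalar_prod v (K i *\<^sub>v v)" if v: "v \<in> carrier_vec p" "v \<noteq> 0\<^sub>v p" for v
  proof -
    have kv: "\<kappa> i *\<^sub>v v \<in> carrier_vec p" using \<kappa>c[OF i] v by auto
    have "\<kappa> i *\<^sub>v v \<noteq> 0\<^sub>v p"
      using v \<kappa>det[OF i] det_0_iff_vec_prod_zero_field[OF \<kappa>c[OF i]] by blast
    then have "0 < scalar_prod (\<kappa> i *\<^sub>v v) (\<kappa> i *\<^sub>v v)"
      using conjugate_square_greater_0_vec[OF kv] by simp
    also have "\<dots> = scalar_prod ((\<kappa> i)\<^sup>T *\<^sub>v (\<kappa> i *\<^sub>v v)) v"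
      by (rule transpose_vec_mult_scalar[OF \<kappa>c[OF i] v(1) kv, symmetric])
    also have "(\<kappa> i)\<^sup>T *\<^sub>v (\<kappa> i *\<^sub>v v) = K i *\<^sub>v v"
      unfolding K_def using \<kappa>c[OF i] v by (intro assoc_mult_mat_vec[symmetric, of _ p p _ p]) auto
    also have "scalar_prod (K i *\<^sub>v v) v = scalar_prod v (K i *\<^sub>v v)"
      using \<kappa>c[OF i] v by (intro comm_scalar_prod[of _ p]) (auto simp: K_def)
    finally show ?thesis .
  qed
  then show ?thesis using \<kappa>c[OF i] by (auto simp: sym_pos_def_def K_def transpose_mult[of _ p p _ p])
qed

lemma ladder_sym_pos_def: "1 \<le> i \<Longrightarrow> i + k \<le> m \<Longrightarrow> \<forall>M \<in> set (ladder i k). sym_pos_def p M"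
  by (induction i k rule: ladder.induct) (auto simp: sym_pos_def_K \<gamma>)

lemma length_ladder: "length (ladder i k) = 2 * k + 1"
  by (induction i k rule: ladder.induct) auto

lemma ladder_not_Nil[simp]: "ladder i k \<noteq> []" by (cases k) auto

text \<open>Eliminating from the bottom: knowing the ratio of \<open>v\<close> to \<open>w\<close> at one rung determines it at the
  next one by one step of the continued fraction.\<close>

lemma contfrac_propagates:
  assumes z: "0 < Re z" and Y: "accretive_semidef p Y"
    and v: "\<And>i. 1 \<le> i \<Longrightarrow> i \<le> m \<Longrightarrow> v i \<in> carrier_vec p" and w: "\<And>i. i \<le> m \<Longrightarrow> w i \<in> carrier_vec p"
    and wrec: "\<And>i. 1 \<le> i \<Longrightarrow> i \<le> m \<Longrightarrow> w (i - 1) = w i + z \<cdot>\<^sub>v (cmat (K i) *\<^sub>v v i)"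
    and vrec: "\<And>i. 1 \<le> i \<Longrightarrow> i < m \<Longrightarrow> v i = v (i + 1) + z \<cdot>\<^sub>v (cmat (\<gamma> i) *\<^sub>v w i)"
    and last: "w m = Y *\<^sub>v v m"
  shows "1 \<le> i \<Longrightarrow> i + k = m \<Longrightarrow> v i = contfrac z (map cmat (ladder i k)) Y *\<^sub>v w (i - 1)"
proof (induction i k rule: ladder.induct)
  have solve: "b = minv (z \<cdot>\<^sub>m cmat M + C) *\<^sub>v a"
    if "sym_pos_def p M" "accretive_semidef p C" "b \<in> carrier_vec p" "a = C *\<^sub>v b + z \<cdot>\<^sub>v (cmat M *\<^sub>v b)" for M C a b
  proof -
    have acc: "accretive p (z \<cdot>\<^sub>m cmat M + C)"
      by (intro accretive_add_semidef accretive_smult_cmat that z)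
    have c: "cmat M \<in> carrier_mat p p" "C \<in> carrier_mat p p"
      using that by (auto simp: sym_pos_def_def accretive_semidef_def)
    have "(z \<cdot>\<^sub>m cmat M + C) *\<^sub>v b = z \<cdot>\<^sub>v (cmat M *\<^sub>v b) + C *\<^sub>v b"
      using c that(3) by (simp add: add_mult_distrib_mat_vec[of _ p p] smult_mult_mat_vec[of _ p p])
    also have "\<dots> = a" unfolding that(4) using c that(3) by (intro comm_add_vec[of _ p]) auto
    finally show ?thesis
      using minv_mult_cancel_vec(1)[OF accretive_carrier[OF acc] accretive_det_nonzero[OF acc] that(3)] by simp
  qed
  {
    case (1 i)
    then have "i = m" by simp
    then show ?case using 1 wrec[of m] last m
      by (auto intro!: solve sym_pos_def_K Y v)
  next
    case (2 i k)
    let ?C = "contfrac z (map cmat (ladder (Suc i) k)) Y"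
    have accC: "accretive p ?C"
      using ladder_sym_pos_def[of "Suc i" k] 2 by (intro contfrac_accretive_open z Y) auto
    have IH: "v (Suc i) = ?C *\<^sub>v w i" using 2 by simp
    have w1: "w i = minv (z \<cdot>\<^sub>m cmat (\<gamma> i) + ?C) *\<^sub>v v i"
      using 2 vrec[of i] IH by (intro solve \<gamma> accretive_imp_semidef accC w) auto
    have accD: "accretive p (minv (z \<cdot>\<^sub>m cmat (\<gamma> i) + ?C))"
      using 2 by (intro accretive_minv accretive_add_semidef accretive_smult_cmat \<gamma> z accretive_imp_semidef accC) auto
    have "v i = minv (z \<cdot>\<^sub>m cmat (K i) + minv (z \<cdot>\<^sub>m cmat (\<gamma> i) + ?C)) *\<^sub>v w (i - 1)"
      using 2 wrec[of i] w1 by (intro solve sym_pos_def_K accretive_imp_semidef accD v) auto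
    then show ?case by simp
  }
qed

context
  fixes z :: complex and \<Delta> Y :: "complex mat"
  assumes z: "0 < Re z" and Y: "accretive_semidef p Y" and \<Delta>: "\<Delta> \<in> carrier_mat p p"
    and Y_eq: "z \<cdot>\<^sub>m Y = cmat (minv (\<gamma> m)) - cmat ((\<kappa> m)\<^sup>T) * (\<Delta> * cmat (\<kappa> m))"
begin

text \<open>The last block is perturbed by an arbitrary \<open>\<Delta>\<close> to cover the three quadratures at once.\<close>

definition shifted :: "complex mat" where
  "shifted = cmat (block_tridiag m p \<alpha> \<beta>) - block_unit m p m * \<Delta> * (block_unit m p m)\<^sup>T + z\<^sup>2 \<cdot>\<^sub>m 1\<^sub>m (m * p)"

lemma shifted_carrier: "shifted \<in> carrier_mat (m * p) (m * p)"
  by (simp add: shifted_def)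

definition block_row :: "nat \<Rightarrow> (nat \<Rightarrow> complex vec) \<Rightarrow> complex vec" where
  "block_row i u = (if 1 < i then cmat (\<beta> i) *\<^sub>v u (i - 1) else 0\<^sub>v p) + cmat (\<alpha> i) *\<^sub>v u i +
    (if i < m then cmat ((\<beta> (i + 1))\<^sup>T) *\<^sub>v u (i + 1) else 0\<^sub>v p)
    - (if i = m then \<Delta> *\<^sub>v u m else 0\<^sub>v p) + z\<^sup>2 \<cdot>\<^sub>v u i"

lemma block_shifted:
  assumes i: "1 \<le> i" "i \<le> m" and u: "u \<in> carrier_vec (m * p)"
  shows "block p (shifted *\<^sub>v u) i = block_row i (block p u)"
proof -
  let ?T = "(if 1 < i then cmat (\<beta> i) *\<^sub>v block p u (i - 1) else 0\<^sub>v p) + cmat (\<alpha> i) *\<^sub>v block p u i +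
    (if i < m then cmat ((\<beta> (i + 1))\<^sup>T) *\<^sub>v block p u (i + 1) else 0\<^sub>v p)"
  let ?E = "if i = m then \<Delta> *\<^sub>v block p u m else 0\<^sub>v p"
  let ?EE = "block_unit m p m * \<Delta> * (block_unit m p m)\<^sup>T :: complex mat"
  have cE: "block_unit m p m \<in> carrier_mat (m * p) p" for m p by simp
  have cEE: "?EE \<in> carrier_mat (m * p) (m * p)"
    using \<Delta> by (intro mult_carrier_mat[of _ _ p]) (auto intro: mult_carrier_mat[of _ _ p])
  have EEu: "?EE *\<^sub>v u = block_unit m p m *\<^sub>v (\<Delta> *\<^sub>v block p u m)"
    using u \<Delta> m transpose_block_unit_mult_vec[of m m u p]
    by (simp add: assoc_mult_mat_vec[of _ "m * p" p _ "m * p"] assoc_mult_mat_vec[of _ "m * p" p _ p]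
        mult_carrier_mat[of _ "m * p" p _ p])
  have "shifted *\<^sub>v u = cmat (block_tridiag m p \<alpha> \<beta>) *\<^sub>v u - block_unit m p m *\<^sub>v (\<Delta> *\<^sub>v block p u m) + z\<^sup>2 \<cdot>\<^sub>v u"
  proof -
    have "cmat (block_tridiag m p \<alpha> \<beta>) - ?EE \<in> carrier_mat (m * p) (m * p)"
      by (rule minus_carrier_mat[OF cEE])
    then show ?thesis
      using u cEE unfolding shifted_def EEu[symmetric]
      by (simp add: add_mult_distrib_mat_vec[of _ "m * p" "m * p"] minus_mult_distrib_mat_vec[of _ "m * p" "m * p"]
          smult_mult_mat_vec[of _ "m * p" "m * p"])
  qed
  moreover have "block p (X - Y' + Z') i = block p X i - block p Y' i + block p Z' i"
    if "X \<in> carrier_vec (m * p)" "Y' \<in> carrier_vec (m * p)" "Z' \<in> carrier_vec (m * p)" for X Y' Z' :: "complex vec"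
    using that block_position_less[OF i] by (intro eq_vecI) auto
  moreover have "block p (z\<^sup>2 \<cdot>\<^sub>v u) i = z\<^sup>2 \<cdot>\<^sub>v block p u i"
    using u block_position_less[OF i] by (intro eq_vecI) auto
  moreover have "block p (block_unit m p m *\<^sub>v (\<Delta> *\<^sub>v block p u m)) i = ?E"
    using \<Delta> by (subst block_block_unit_mult_vec[OF i m]) auto
  moreover have "block p (cmat (block_tridiag m p \<alpha> \<beta>) *\<^sub>v u) i = ?T"
    by (rule block_block_tridiag_mult_vec[where m = m]) (use i u \<alpha>c \<beta>c in auto)
  ultimately show ?thesis
    using u \<Delta> by (simp add: block_row_def mult_mat_vec_carrier[of _ "m * p" p] mult_mat_vec_carrier[of _ "m * p" "m * p"])
qed

abbreviation \<delta> :: "nat \<Rightarrow> complex mat" where "\<delta> i \<equiv> cmat (minv (\<gamma> i))"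

lemma minv_\<gamma>_carrier: "1 \<le> i \<Longrightarrow> i \<le> m \<Longrightarrow> minv (\<gamma> i) \<in> carrier_mat p p"
  using sym_pos_def_carrier[OF sym_pos_def_minv[OF \<gamma>]] .

text \<open>Multiplication by \<open>\<kappa>\<^sub>i\<^sup>T\<close> completes the congruence, so that \<open>diag\<close> and \<open>subdiag\<close> replace the
  coefficients of \<open>T\<^sub>m\<close> by the inverses of the \<open>\<gamma>\<^sub>j\<close>.\<close>

lemma congruent_row:
  assumes i: "1 \<le> i" "i \<le> m" and v: "\<And>j. v j \<in> carrier_vec p"
  defines "u \<equiv> \<lambda>j. cmat (\<kappa> j) *\<^sub>v v j"
  shows "cmat ((\<kappa> i)\<^sup>T) *\<^sub>v block_row i u =
    (if 1 < i then - (\<delta> (i - 1) *\<^sub>v v (i - 1)) else 0\<^sub>v p) + (\<delta> i *\<^sub>v v i + (if 1 < i then \<delta> (i - 1) *\<^sub>v v i else 0\<^sub>v p)) +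
    (if i < m then - (\<delta> i *\<^sub>v v (i + 1)) else 0\<^sub>v p)
    - (if i = m then (\<delta> m - z \<cdot>\<^sub>m Y) *\<^sub>v v m else 0\<^sub>v p) + z\<^sup>2 \<cdot>\<^sub>v (cmat (K i) *\<^sub>v v i)"
proof -
  let ?k = "cmat ((\<kappa> i)\<^sup>T)"
  have ck: "?k \<in> carrier_mat p p" using \<kappa>c[OF i] by simp
  have cu: "u j \<in> carrier_vec p" if "1 \<le> j" "j \<le> m" for j using \<kappa>c[OF that] v by (simp add: u_def)
  have zero: "?k *\<^sub>v 0\<^sub>v p = 0\<^sub>v p" using ck by auto
  have cd: "\<delta> j \<in> carrier_mat p p" if "1 \<le> j" "j \<le> m" for j using minv_\<gamma>_carrier[OF that] by simp
  have cY: "Y \<in> carrier_mat p p" using Y by (simp add: accretive_semidef_def)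
  let ?L = "if 1 < i then cmat (\<beta> i) *\<^sub>v u (i - 1) else 0\<^sub>v p" and ?D = "cmat (\<alpha> i) *\<^sub>v u i"
    and ?U = "if i < m then cmat ((\<beta> (i + 1))\<^sup>T) *\<^sub>v u (i + 1) else 0\<^sub>v p"
    and ?E = "if i = m then \<Delta> *\<^sub>v u m else 0\<^sub>v p"
  have neg: "cmat (- M) *\<^sub>v x = - (cmat M *\<^sub>v x)" if "M \<in> carrier_mat p p" "x \<in> carrier_vec p" for M x
  proof -
    have "cmat (- M) = - cmat M" by (rule eq_matI) auto
    then show ?thesis using that by simp
  qed
  have L: "?k *\<^sub>v ?L = (if 1 < i then - (\<delta> (i - 1) *\<^sub>v v (i - 1)) else 0\<^sub>v p)"
    using i zero v cmat_mult_vec3[of "(\<kappa> i)\<^sup>T" p "\<beta> i" "\<kappa> (i - 1)" "v (i - 1)"] \<kappa>c[of i] \<kappa>c[of "i - 1"] \<beta>c[of i]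
      subdiag[of i] neg[OF minv_\<gamma>_carrier[of "i - 1"] v]
    by (simp add: u_def)
  have D: "?k *\<^sub>v ?D = \<delta> i *\<^sub>v v i + (if 1 < i then \<delta> (i - 1) *\<^sub>v v i else 0\<^sub>v p)"
  proof -
    have "?k *\<^sub>v ?D = cmat ((\<kappa> i)\<^sup>T * (\<alpha> i * \<kappa> i)) *\<^sub>v v i"
      unfolding u_def by (rule cmat_mult_vec3) (use \<kappa>c[OF i] \<alpha>c[OF i] v in auto)
    also have "(\<kappa> i)\<^sup>T * (\<alpha> i * \<kappa> i) = minv (\<gamma> i) + (if i = 1 then 0\<^sub>m p p else minv (\<gamma> (i - 1)))"
      unfolding diag[OF i, symmetric] using \<kappa>c[OF i] \<alpha>c[OF i] by (intro assoc_mult_mat[symmetric, of _ p p _ p _ p]) auto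
    also have "cmat \<dots> = \<delta> i + (if i = 1 then 0\<^sub>m p p else \<delta> (i - 1))"
      using minv_\<gamma>_carrier[OF i] minv_\<gamma>_carrier[of "i - 1"] i
      by (cases "i = 1") (auto simp: cmat_add[of _ p p])
    also have "\<dots> *\<^sub>v v i = \<delta> i *\<^sub>v v i + (if 1 < i then \<delta> (i - 1) *\<^sub>v v i else 0\<^sub>v p)"
      using cd[OF i] cd[of "i - 1"] v i by (cases "i = 1") (auto simp: add_mult_distrib_mat_vec[of _ p p])
    finally show ?thesis .
  qed
  have U: "?k *\<^sub>v ?U = (if i < m then - (\<delta> i *\<^sub>v v (i + 1)) else 0\<^sub>v p)"
  proof (cases "i < m")
    case True
    have c: "\<kappa> i \<in> carrier_mat p p" "\<kappa> (i + 1) \<in> carrier_mat p p" "\<beta> (i + 1) \<in> carrier_mat p p"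
      using \<kappa>c[of i] \<kappa>c[of "i + 1"] \<beta>c[of "i + 1"] i True by auto
    have "(\<kappa> i)\<^sup>T * ((\<beta> (i + 1))\<^sup>T * \<kappa> (i + 1)) =
      ((\<kappa> (i + 1))\<^sup>T * (\<beta> (i + 1) * \<kappa> i))\<^sup>T"
      using c by (simp add: transpose_mult[of _ p p _ p] assoc_mult_mat[of _ p p _ p _ p])
    also have "\<dots> = - minv (\<gamma> i)"
      using subdiag[of "i + 1"] True i sym_pos_def_transpose[OF sym_pos_def_minv[OF \<gamma>[OF i]]] by (simp add: transpose_uminus)
    finally show ?thesis
      using True c v cmat_mult_vec3[of "(\<kappa> i)\<^sup>T" p "(\<beta> (i + 1))\<^sup>T" "\<kappa> (i + 1)" "v (i + 1)"]
        neg[OF minv_\<gamma>_carrier[OF i] v]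
      by (simp add: u_def)
  qed (use zero in simp)
  have E: "?k *\<^sub>v ?E = (if i = m then (\<delta> m - z \<cdot>\<^sub>m Y) *\<^sub>v v m else 0\<^sub>v p)"
  proof (cases "i = m")
    case True
    have cm: "cmat (\<kappa> m) \<in> carrier_mat p p" "cmat ((\<kappa> m)\<^sup>T) \<in> carrier_mat p p" using \<kappa>c[OF m] by auto
    have "\<delta> m - z \<cdot>\<^sub>m Y = cmat ((\<kappa> m)\<^sup>T) * (\<Delta> * cmat (\<kappa> m))"
      unfolding Y_eq using cm \<Delta> cd[OF m order_refl]
      by (intro eq_matI) (auto simp: mult_carrier_mat[of _ p p _ p])
    then show ?thesis
      using True cm \<Delta> v by (simp add: u_def assoc_mult_mat_vec[of _ p p _ p])
  qed (use zero in simp)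
  have F: "?k *\<^sub>v (z\<^sup>2 \<cdot>\<^sub>v u i) = z\<^sup>2 \<cdot>\<^sub>v (cmat (K i) *\<^sub>v v i)"
  proof -
    have "cmat (K i) = ?k * cmat (\<kappa> i)"
      using \<kappa>c[OF i] by (simp add: K_def of_real_hom.mat_hom_mult[of _ p p _ p])
    then show ?thesis
      using ck \<kappa>c[OF i] v cu[OF i] by (simp add: u_def mult_mat_vec[of _ p p] assoc_mult_mat_vec[of _ p p _ p])
  qed
  have c: "?L \<in> carrier_vec p" "?D \<in> carrier_vec p" "?U \<in> carrier_vec p" "?E \<in> carrier_vec p" "z\<^sup>2 \<cdot>\<^sub>v u i \<in> carrier_vec p"
    using i cu \<alpha>c \<beta>c \<Delta> m by (auto intro!: mult_mat_vec_carrier[of _ p p])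
  have "M *\<^sub>v (a + b + c - d + e) = M *\<^sub>v a + M *\<^sub>v b + M *\<^sub>v c - M *\<^sub>v d + M *\<^sub>v e"
    if M: "M \<in> carrier_mat p p" and "a \<in> carrier_vec p" "b \<in> carrier_vec p" "c \<in> carrier_vec p" "d \<in> carrier_vec p" "e \<in> carrier_vec p"
    for M :: "complex mat" and a b c d e
    by (simp only: mult_add_distrib_mat_vec[OF M] mult_minus_distrib_mat_vec[OF M]
        add_carrier_vec minus_carrier_vec that)
  from this[OF ck c] show ?thesis unfolding block_row_def L D U E F .
qed

text \<open>The congruent rows are \<open>s\<^sub>i\<^sub>-\<^sub>1 = s\<^sub>i + z\<^sup>2 K\<^sub>i v\<^sub>i\<close> for the fluxes \<open>s\<^sub>i = \<gamma>\<^sub>i\<^sup>-\<^sup>1 (v\<^sub>i - v\<^sub>i\<^sub>+\<^sub>1)\<close>.  Dividing the fluxes by \<open>z\<close>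
  gives the symmetric ladder, and \<open>s\<^sub>0 = x\<close>.  For \<open>x = 0\<close> the ratios propagate zero down the ladder.\<close>

lemma shifted_solution:
  assumes u: "u \<in> carrier_vec (m * p)" and x: "x \<in> carrier_vec p"
    and eq: "shifted *\<^sub>v u = block_unit m p 1 *\<^sub>v x"
  shows "block p u 1 = contfrac z (map cmat (ladder 1 (m - 1))) Y *\<^sub>v ((1 / z) \<cdot>\<^sub>v x)"
    and "x = 0\<^sub>v p \<Longrightarrow> u = 0\<^sub>v (m * p)"
proof -
  have z0: "z \<noteq> 0" using z by auto
  have cY: "Y \<in> carrier_mat p p" using Y by (simp add: accretive_semidef_def)
  have cd: "\<delta> j \<in> carrier_mat p p" if "1 \<le> j" "j \<le> m" for j using minv_\<gamma>_carrier[OF that] by simp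
  have cK: "cmat (K j) \<in> carrier_mat p p" if "1 \<le> j" "j \<le> m" for j using sym_pos_def_carrier[OF sym_pos_def_K[OF that]] by simp
  have c\<kappa>: "cmat (\<kappa> j) \<in> carrier_mat p p" "Determinant.det (cmat (\<kappa> j)) \<noteq> 0" if "1 \<le> j" "j \<le> m" for j
    using \<kappa>c[OF that] \<kappa>det[OF that] of_real_hom.hom_det[of "\<kappa> j", where ?'a = complex] by auto
  define v where "v j = (if 1 \<le> j \<and> j \<le> m then minv (cmat (\<kappa> j)) *\<^sub>v block p u j else 0\<^sub>v p)" for j
  have cv: "v j \<in> carrier_vec p" for j
    unfolding v_def using mult_mat_vec_carrier[OF minv_carrier[OF c\<kappa>] block_carrier] by simp
  have uv: "block p u j = cmat (\<kappa> j) *\<^sub>v v j" if "1 \<le> j" "j \<le> m" for j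
    using minv_mult_cancel_vec(2)[OF c\<kappa>[OF that] block_carrier] that by (simp add: v_def)
  define s where "s i = (if i = 0 then x else if i < m then \<delta> i *\<^sub>v v i - \<delta> i *\<^sub>v v (i + 1) else (z \<cdot>\<^sub>m Y) *\<^sub>v v m)" for i
  define w where "w i = (1 / z) \<cdot>\<^sub>v s i" for i
  have cs: "s i \<in> carrier_vec p" if "i \<le> m" for i
    using x cd cv cY that by (auto simp: s_def intro!: mult_mat_vec_carrier[of _ p p] minus_carrier_vec)
  have srec: "s (i - 1) = s i + z\<^sup>2 \<cdot>\<^sub>v (cmat (K i) *\<^sub>v v i)" if i: "1 \<le> i" "i \<le> m" for i
  proof -
    have "(if i = 1 then x else 0\<^sub>v p) = block p (shifted *\<^sub>v u) i"
      unfolding eq by (rule block_block_unit_mult_vec[OF i order_refl x, symmetric])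
    also have "\<dots> = block_row i (\<lambda>j. cmat (\<kappa> j) *\<^sub>v v j)"
      unfolding block_shifted[OF i u] block_row_def uv[OF i] uv[OF m order_refl]
      using uv[of "i - 1"] uv[of "i + 1"] i
      by (intro arg_cong2[of _ _ _ _ "(+)"] arg_cong2[of _ _ _ _ "(-)"] refl if_cong) auto
    finally have "cmat ((\<kappa> i)\<^sup>T) *\<^sub>v (if i = 1 then x else 0\<^sub>v p) =
      (if 1 < i then - (\<delta> (i - 1) *\<^sub>v v (i - 1)) else 0\<^sub>v p) + (\<delta> i *\<^sub>v v i + (if 1 < i then \<delta> (i - 1) *\<^sub>v v i else 0\<^sub>v p)) +
      (if i < m then - (\<delta> i *\<^sub>v v (i + 1)) else 0\<^sub>v p)
      - (if i = m then (\<delta> m - z \<cdot>\<^sub>m Y) *\<^sub>v v m else 0\<^sub>v p) + z\<^sup>2 \<cdot>\<^sub>v (cmat (K i) *\<^sub>v v i)" (is "_ = ?R")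
      using congruent_row[of i v, OF i cv] by simp
    moreover have "cmat ((\<kappa> i)\<^sup>T) *\<^sub>v (if i = 1 then x else 0\<^sub>v p) = (if i = 1 then x else 0\<^sub>v p)"
      using x \<kappa>1 \<kappa>c[OF i] by (auto simp: of_real_hom.mat_hom_one)
    ultimately have row: "(if i = 1 then x else 0\<^sub>v p) = ?R" by simp
    have last: "(\<delta> m - z \<cdot>\<^sub>m Y) *\<^sub>v v m = \<delta> m *\<^sub>v v m - (z \<cdot>\<^sub>m Y) *\<^sub>v v m"
      using cd[OF m order_refl] cY cv by (intro minus_mult_distrib_mat_vec[of _ p p]) auto
    define P where "P = \<delta> (i - 1) *\<^sub>v v (i - 1)"
    define P' where "P' = \<delta> (i - 1) *\<^sub>v v i"
    define D where "D = \<delta> i *\<^sub>v v i"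
    define U where "U = \<delta> i *\<^sub>v v (i + 1)"
    define E where "E = (z \<cdot>\<^sub>m Y) *\<^sub>v v m"
    define F where "F = z\<^sup>2 \<cdot>\<^sub>v (cmat (K i) *\<^sub>v v i)"
    have dims: "dim_vec D = p" "dim_vec U = p" "dim_vec E = p" "dim_vec F = p" "dim_vec x = p"
      "1 < i \<Longrightarrow> dim_vec P = p" "1 < i \<Longrightarrow> dim_vec P' = p"
      using carrier_matD[OF minv_\<gamma>_carrier[OF i]] carrier_matD[OF minv_\<gamma>_carrier[of "i - 1"]]
        carrier_matD[OF cY] carrier_matD[OF cK[OF i]] x i
      by (auto simp: D_def U_def E_def F_def P_def P'_def)
    have row': "(if i = 1 then x else 0\<^sub>v p) = (if 1 < i then - P else 0\<^sub>v p) + (D + (if 1 < i then P' else 0\<^sub>v p)) +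
      (if i < m then - U else 0\<^sub>v p) - (if i = m then D - E else 0\<^sub>v p) + F"
      using row unfolding last P_def P'_def D_def U_def E_def F_def by (auto split: if_splits)
    have s1: "s (i - 1) = (if i = 1 then x else P - P')"
      using i by (auto simp: s_def P_def P'_def)
    have s2: "s i = (if i < m then D - U else E)"
      using i by (auto simp: s_def D_def U_def E_def)
    show ?thesis
      unfolding s1 s2 F_def[symmetric]
    proof (rule eq_vecI)
      fix a assume "a < dim_vec ((if i < m then D - U else E) + F)"
      then have a: "a < p" using dims by (auto split: if_splits)
      show "(if i = 1 then x else P - P') $ a = ((if i < m then D - U else E) + F) $ a"
        using arg_cong[OF row', of "\<lambda>y. vec_index y a"] a dims i
        by (cases "i = 1"; cases "i = m") (auto simp: algebra_simps)
    qed (use dims i in auto)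
  qed
  have wrec: "w (i - 1) = w i + z \<cdot>\<^sub>v (cmat (K i) *\<^sub>v v i)" if i: "1 \<le> i" "i \<le> m" for i
  proof -
    have "w (i - 1) = (1 / z) \<cdot>\<^sub>v s i + (1 / z) \<cdot>\<^sub>v (z\<^sup>2 \<cdot>\<^sub>v (cmat (K i) *\<^sub>v v i))"
      unfolding w_def srec[OF i] using cs[OF i(2)] cK[OF i] cv
      by (intro smult_add_distrib_vec[of _ p]) auto
    then show ?thesis using z0 by (simp add: w_def smult_smult_assoc power2_eq_square)
  qed
  have vrec: "v i = v (i + 1) + z \<cdot>\<^sub>v (cmat (\<gamma> i) *\<^sub>v w i)" if i: "1 \<le> i" "i < m" for i
  proof -
    have im: "i \<le> m" using i by simp
    note cg = sym_pos_def_carrier[OF \<gamma>[OF i(1) im]] and dg = sym_pos_def_det[OF \<gamma>[OF i(1) im]]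
    have cancel: "cmat (\<gamma> i) *\<^sub>v (\<delta> i *\<^sub>v y) = y" if "y \<in> carrier_vec p" for y
    proof -
      have "cmat (\<gamma> i) * \<delta> i = 1\<^sub>m p"
        using cmat_mult[OF cg minv_\<gamma>_carrier[OF i(1) im]] minv_right[OF cg dg]
        by (simp add: of_real_hom.mat_hom_one)
      then show ?thesis
        using assoc_mult_mat_vec[of "cmat (\<gamma> i)" p p "\<delta> i" p y] cg cd[OF i(1) im] that by simp
    qed
    have "z \<cdot>\<^sub>v (cmat (\<gamma> i) *\<^sub>v w i) = cmat (\<gamma> i) *\<^sub>v s i"
      using cg cs[OF im] z0 by (simp add: w_def mult_mat_vec[of _ p p] smult_smult_assoc)
    also have "\<dots> = v i - v (i + 1)"
      using i cg cd[OF i(1) im] cv by (simp add: s_def mult_minus_distrib_mat_vec[of _ p p] cancel)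
    finally show ?thesis using cv[of i] cv[of "i + 1"] by (intro eq_vecI) auto
  qed
  have last: "w m = Y *\<^sub>v v m"
    using m z0 cY cv by (simp add: w_def s_def smult_mult_mat_vec[of _ p p] smult_smult_assoc)
  have cw: "w i \<in> carrier_vec p" if "i \<le> m" for i using cs[OF that] by (simp add: w_def)
  note propagate = contfrac_propagates[OF z Y cv cw wrec vrec last]
  have "v 1 = contfrac z (map cmat (ladder 1 (m - 1))) Y *\<^sub>v w 0"
    using propagate[of 1 "m - 1"] m by simp
  moreover have "block p u 1 = v 1"
    using uv[of 1] m cv[of 1] \<kappa>1 by (simp add: of_real_hom.mat_hom_one)
  ultimately show "block p u 1 = contfrac z (map cmat (ladder 1 (m - 1))) Y *\<^sub>v ((1 / z) \<cdot>\<^sub>v x)"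
    by (simp add: w_def s_def)
  show "u = 0\<^sub>v (m * p)" if x0: "x = 0\<^sub>v p"
  proof -
    have acc: "accretive p (contfrac z (map cmat (ladder i (m - i))) Y)" if "1 \<le> i" "i \<le> m" for i
      using that ladder_sym_pos_def[of i "m - i"] by (intro contfrac_accretive_open z Y) auto
    have v0: "v i = 0\<^sub>v p" if "1 \<le> i" "i \<le> m" "w (i - 1) = 0\<^sub>v p" for i
    proof -
      have "M *\<^sub>v 0\<^sub>v p = 0\<^sub>v p" if "M \<in> carrier_mat p p" for M :: "complex mat"
        using that by (intro eq_vecI) auto
      from this[OF accretive_carrier[OF acc[OF that(1,2)]]] show ?thesis
        using propagate[of i "m - i"] that by simp
    qed
    have w0: "w i = 0\<^sub>v p" if "i \<le> m" for i
      using that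
    proof (induction i)
      case 0
      then show ?case using x0 by (auto simp: w_def s_def)
    next
      case (Suc i)
      have vi: "v (Suc i) = 0\<^sub>v p" using v0[of "Suc i"] Suc by simp
      have "z \<cdot>\<^sub>v (cmat (K (Suc i)) *\<^sub>v v (Suc i)) = 0\<^sub>v p"
        using cK[of "Suc i"] Suc.prems unfolding vi by auto
      then show ?case using wrec[of "Suc i"] Suc cw[of "Suc i"] by simp
    qed
    show ?thesis
    proof (rule vec_eq_0_if_blocks[OF u])
      fix i assume i: "1 \<le> i" "i \<le> m"
      then have "v i = 0\<^sub>v p" using v0 w0[of "i - 1"] by simp
      then show "block p u i = 0\<^sub>v p" using uv[OF i] c\<kappa>(1)[OF i] by auto
    qed
  qed
qed

theorem resolvent_corner_eq_contfrac:
  "resolvent_corner m p (cmat (block_tridiag m p \<alpha> \<beta>) -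
     block_unit m p m * \<Delta> * (block_unit m p m)\<^sup>T) (z\<^sup>2) =
   (1 / z) \<cdot>\<^sub>m contfrac z (map cmat (ladder 1 (m - 1))) Y"
proof -
  let ?C = "contfrac z (map cmat (ladder 1 (m - 1))) Y"
  let ?E = "block_unit m p 1 :: complex mat"
  have cC: "?C \<in> carrier_mat p p"
    using m ladder_sym_pos_def[of 1 "m - 1"] by (intro accretive_carrier contfrac_accretive_open z Y) auto
  have z0: "0\<^sub>v (m * p) = ?E *\<^sub>v 0\<^sub>v p"
    by (rule eq_vecI) (auto simp: block_unit_def scalar_prod_def)
  have det: "Determinant.det shifted \<noteq> 0"
    by (rule det_nonzero_if_injective[OF shifted_carrier], rule shifted_solution(2)) (auto simp: z0)
  note cN = minv_carrier[OF shifted_carrier det]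
  have cR: "?E\<^sup>T * minv shifted \<in> carrier_mat p (m * p)"
    using cN by (intro mult_carrier_mat[of _ p "m * p"]) auto
  have "(?E\<^sup>T * minv shifted * ?E) *\<^sub>v x = ((1 / z) \<cdot>\<^sub>m ?C) *\<^sub>v x" if x: "x \<in> carrier_vec p" for x
  proof -
    define u where "u = minv shifted *\<^sub>v (?E *\<^sub>v x)"
    have Ex: "?E *\<^sub>v x \<in> carrier_vec (m * p)" by (rule mult_mat_vec_carrier[OF block_unit_carrier x])
    have u: "u \<in> carrier_vec (m * p)" unfolding u_def by (rule mult_mat_vec_carrier[OF cN Ex])
    have eq: "shifted *\<^sub>v u = ?E *\<^sub>v x"
      unfolding u_def by (rule minv_mult_cancel_vec(2)[OF shifted_carrier det Ex])
    have "(?E\<^sup>T * minv shifted * ?E) *\<^sub>v x = ?E\<^sup>T *\<^sub>v u"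
      unfolding u_def using cR cN x Ex
      by (simp add: assoc_mult_mat_vec[of _ p "m * p" _ p] assoc_mult_mat_vec[of _ p "m * p" _ "m * p"])
    also have "\<dots> = block p u 1"
      using m by (intro transpose_block_unit_mult_vec u) auto
    also have "\<dots> = ?C *\<^sub>v ((1 / z) \<cdot>\<^sub>v x)" by (rule shifted_solution(1)[OF u x eq])
    also have "\<dots> = ((1 / z) \<cdot>\<^sub>m ?C) *\<^sub>v x"
      using cC x by (simp add: mult_mat_vec[of _ p p] smult_mult_mat_vec[of _ p p])
    finally show ?thesis .
  qed
  moreover have "?E\<^sup>T * minv shifted * ?E \<in> carrier_mat p p"
    by (rule mult_carrier_mat[OF cR block_unit_carrier])
  ultimately have "?E\<^sup>T * minv shifted * ?E = (1 / z) \<cdot>\<^sub>m ?C"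
    using cC by (intro mat_eq_if_mult_vec_eq[of _ p p]) auto
  then show ?thesis by (simp add: resolvent_corner_def shifted_def)
qed

end
end

section \<open>The three quadratures\<close>

text \<open>With \<open>R = (g\<^sup>-\<^sup>1 + z \<phi>)\<^sup>-\<^sup>1\<close> both sides of the equation are \<open>z g\<^sup>-\<^sup>1 R \<phi>\<close>.  The right side is
  \<open>g\<^sup>-\<^sup>1 - g\<^sup>-\<^sup>1 R g\<^sup>-\<^sup>1\<close>, and \<open>g\<^sup>-\<^sup>1 = g\<^sup>-\<^sup>1 R (g\<^sup>-\<^sup>1 + z \<phi>)\<close>.  On the left, \<open>g\<^sup>-\<^sup>1 R \<phi>\<close> inverts \<open>z g + \<phi>\<^sup>-\<^sup>1\<close>
  because \<open>\<phi> (z g + \<phi>\<^sup>-\<^sup>1) = (z \<phi> + g\<^sup>-\<^sup>1) g\<close>.\<close>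

lemma delta_alpha_identities:
  fixes g k \<phi> :: "real mat" and z :: complex
  assumes g: "sym_pos_def p g" and \<phi>: "sym_pos_def p \<phi>" and k: "k \<in> carrier_mat p p" "Determinant.det k \<noteq> 0"
    and z: "0 < Re z"
  defines "\<Delta> \<equiv> (cmat (minv k))\<^sup>T * cmat (minv g) * minv (cmat (minv g) + z \<cdot>\<^sub>m cmat \<phi>) * cmat (minv g) * cmat (minv k)"
  shows "\<Delta> \<in> carrier_mat p p"
    and "z \<cdot>\<^sub>m minv (z \<cdot>\<^sub>m cmat g + cmat (minv \<phi>)) = cmat (minv g) - cmat (k\<^sup>T) * (\<Delta> * cmat k)"
proof -
  let ?d = "cmat (minv g)" and ?g = "cmat g" and ?f = "cmat \<phi>" and ?i = "cmat (minv \<phi>)"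
  have sd: "sym_pos_def p (minv g)" and si: "sym_pos_def p (minv \<phi>)" using sym_pos_def_minv g \<phi> by auto
  note cr = sym_pos_def_carrier[OF g] sym_pos_def_carrier[OF \<phi>] sym_pos_def_carrier[OF sd] sym_pos_def_carrier[OF si]
  have c: "?d \<in> carrier_mat p p" "?g \<in> carrier_mat p p" "?f \<in> carrier_mat p p" "?i \<in> carrier_mat p p"
    using cr by auto
  have dg: "?d * ?g = 1\<^sub>m p" "?f * ?i = 1\<^sub>m p"
    unfolding cmat_mult[OF cr(3,1), symmetric] cmat_mult[OF cr(2,4), symmetric]
    using minv_left[OF cr(1) sym_pos_def_det[OF g]] minv_right[OF cr(2) sym_pos_def_det[OF \<phi>]]
    by (auto simp: of_real_hom.mat_hom_one)
  have accN: "accretive p (?d + z \<cdot>\<^sub>m ?f)"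
    by (intro accretive_add_semidef accretive_cmat sd accretive_imp_semidef accretive_smult_cmat \<phi> z)
  define R where "R = minv (?d + z \<cdot>\<^sub>m ?f)"
  have cR: "R \<in> carrier_mat p p" and RN: "R * (?d + z \<cdot>\<^sub>m ?f) = 1\<^sub>m p"
    unfolding R_def
    using minv_carrier[OF accretive_carrier[OF accN] accretive_det_nonzero[OF accN]]
      minv_left[OF accretive_carrier[OF accN] accretive_det_nonzero[OF accN]] by auto
  have ck: "cmat k \<in> carrier_mat p p" "cmat (minv k) \<in> carrier_mat p p" using k minv_carrier[OF k] by auto
  have kk: "cmat (minv k) * cmat k = 1\<^sub>m p"
    unfolding cmat_mult[OF minv_carrier[OF k] k(1), symmetric] minv_left[OF k] by (rule of_real_hom.mat_hom_one)
  have kk': "cmat (k\<^sup>T) * (cmat (minv k))\<^sup>T = 1\<^sub>m p"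
  proof -
    have "cmat (k\<^sup>T) * (cmat (minv k))\<^sup>T = (cmat (minv k) * cmat k)\<^sup>T"
      using ck by (simp add: transpose_mult[of _ p p _ p] map_mat_transpose)
    then show ?thesis unfolding kk by simp
  qed
  note assoc = assoc_mult_mat[of _ p p _ p _ p] and mc = mult_carrier_mat[of _ p p _ p]
  show "\<Delta> \<in> carrier_mat p p"
    unfolding \<Delta>_def R_def[symmetric] using c cR ck by (simp add: mc)
  have ct: "cmat (k\<^sup>T) \<in> carrier_mat p p" using k by simp
  have "cmat (k\<^sup>T) * (\<Delta> * cmat k) =
    (cmat (k\<^sup>T) * (cmat (minv k))\<^sup>T) * ((?d * R * ?d) * (cmat (minv k) * cmat k))"
    unfolding \<Delta>_def R_def[symmetric] using c cR ck ct by (simp add: assoc mc)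
  also have "\<dots> = ?d * R * ?d"
    unfolding kk kk' using c cR by (simp add: mc left_mult_one_mat[of _ p p] right_mult_one_mat[of _ p p])
  finally have kdk: "cmat (k\<^sup>T) * (\<Delta> * cmat k) = ?d * R * ?d" .
  have "?d = ?d * (R * (?d + z \<cdot>\<^sub>m ?f))" unfolding RN using c by (simp add: right_mult_one_mat[of _ p p])
  also have "\<dots> = ?d * R * ?d + z \<cdot>\<^sub>m (?d * R * ?f)"
    using c cR by (simp add: mult_add_distrib_mat[of _ p p _ p] mult_smult_distrib[of _ p p _ p] assoc mc)
  finally have "?d = ?d * R * ?d + z \<cdot>\<^sub>m (?d * R * ?f)" .
  moreover have "M + N - M = N" if "M \<in> carrier_mat p p" "N \<in> carrier_mat p p" for M N :: "complex mat"
    using that by (intro eq_matI) auto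
  ultimately have diff: "?d - ?d * R * ?d = z \<cdot>\<^sub>m (?d * R * ?f)"
    using c cR by (metis mc smult_carrier_mat)
  have "?d * R * ?f * (z \<cdot>\<^sub>m ?g + ?i) = 1\<^sub>m p"
  proof -
    have "R * (z \<cdot>\<^sub>m ?f * ?g + 1\<^sub>m p) = R * ((?d + z \<cdot>\<^sub>m ?f) * ?g)"
    proof -
      have "(?d + z \<cdot>\<^sub>m ?f) * ?g = ?d * ?g + z \<cdot>\<^sub>m ?f * ?g"
        using c by (intro add_mult_distrib_mat[of _ p p _ _ p]) auto
      also have "\<dots> = z \<cdot>\<^sub>m ?f * ?g + 1\<^sub>m p"
        unfolding dg using c by (intro comm_add_mat[of _ p p]) auto
      finally show ?thesis by simp
    qed
    also have "\<dots> = (R * (?d + z \<cdot>\<^sub>m ?f)) * ?g"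
      using c cR by (intro assoc[symmetric]) auto
    also have "\<dots> = ?g" unfolding RN using c by (simp add: left_mult_one_mat[of _ p p])
    finally have e: "R * (z \<cdot>\<^sub>m ?f * ?g + 1\<^sub>m p) = ?g" .
    have "?d * R * ?f * (z \<cdot>\<^sub>m ?g + ?i) = ?d * (R * (?f * (z \<cdot>\<^sub>m ?g + ?i)))"
      using c cR by (simp add: assoc mc)
    also have "?f * (z \<cdot>\<^sub>m ?g + ?i) = z \<cdot>\<^sub>m ?f * ?g + 1\<^sub>m p"
      unfolding dg(2)[symmetric] using c
      by (simp add: mult_add_distrib_mat[of _ p p _ p] mult_smult_distrib[of _ p p _ p] mult_smult_assoc_mat[of _ p p _ p])
    finally show ?thesis unfolding e dg(1) .
  qed
  then have "minv (z \<cdot>\<^sub>m ?g + ?i) = ?d * R * ?f"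
  proof (intro minv_unique)
    have acc: "accretive p (z \<cdot>\<^sub>m ?g + ?i)"
      by (intro accretive_add_semidef accretive_cmat si accretive_imp_semidef accretive_smult_cmat g z)
    note ca = accretive_carrier[OF acc]
    assume 1: "?d * R * ?f * (z \<cdot>\<^sub>m ?g + ?i) = 1\<^sub>m p"
    show "(z \<cdot>\<^sub>m ?g + ?i) * (?d * R * ?f) = 1\<^sub>m p"
      by (rule mat_mult_left_right_inverse[OF _ ca 1]) (use c cR in \<open>simp add: mc\<close>)
    show "z \<cdot>\<^sub>m ?g + ?i \<in> carrier_mat p p" by (rule ca)
    show "?d * R * ?f \<in> carrier_mat p p" using c cR by (simp add: mc)
  qed
  then show "z \<cdot>\<^sub>m minv (z \<cdot>\<^sub>m ?g + ?i) = ?d - cmat (k\<^sup>T) * (\<Delta> * cmat k)"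
    unfolding kdk diff by simp
qed

context lanczos_ladder begin

definition full_ladder :: "real mat list" where "full_ladder = ladder 1 (m - 1) @ [\<gamma> m]"

lemma full_ladder_sym_pos_def: "\<forall>M \<in> set full_ladder. sym_pos_def p M"
  using ladder_sym_pos_def[of 1 "m - 1"] \<gamma>[of m] m by (auto simp: full_ladder_def)

lemma krein_nudelman_eq:
  assumes z: "0 < Re z" and \<phi>: "sym_pos_def p \<phi>"
    and \<Delta>: "\<Delta> = (cmat (minv (\<kappa> m)))\<^sup>T * cmat (minv (\<gamma> m)) * minv (cmat (minv (\<gamma> m)) + z \<cdot>\<^sub>m cmat \<phi>)
        * cmat (minv (\<gamma> m)) * cmat (minv (\<kappa> m))"
  shows "resolvent_corner m p (cmat (block_tridiag m p \<alpha> \<beta>) -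
     block_unit m p m * \<Delta> * (block_unit m p m)\<^sup>T) (z\<^sup>2) =
   (1 / z) \<cdot>\<^sub>m contfrac z (map cmat full_ladder) (cmat (minv \<phi>))"
proof -
  let ?Y = "minv (z \<cdot>\<^sub>m cmat (\<gamma> m) + cmat (minv \<phi>))"
  have Y: "accretive_semidef p ?Y"
    by (intro accretive_imp_semidef accretive_minv accretive_add_semidef accretive_smult_cmat accretive_cmat
        sym_pos_def_minv \<phi> z \<gamma> m order_refl)
  note d = delta_alpha_identities[OF \<gamma>[OF m order_refl] \<phi> \<kappa>c[OF m order_refl] \<kappa>det[OF m order_refl] z, folded \<Delta>]
  show ?thesis
    using resolvent_corner_eq_contfrac[OF z Y d] by (simp add: full_ladder_def contfrac_append)
qed

text \<open>Without perturbation the ratio at the last rung is \<open>(z \<gamma>\<^sub>m)\<^sup>-\<^sup>1\<close>, which is the terminal value \<open>0\<close>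
  followed by the step of \<open>\<gamma>\<^sub>m\<close>.\<close>

lemma gauss_eq:
  assumes z: "0 < Re z"
  shows "resolvent_corner m p (cmat (block_tridiag m p \<alpha> \<beta>)) (z\<^sup>2) =
   (1 / z) \<cdot>\<^sub>m contfrac z (map cmat full_ladder) (0\<^sub>m p p)"
proof -
  note g = \<gamma>[OF m order_refl]
  note cg = sym_pos_def_carrier[OF g] and cd = minv_carrier[OF sym_pos_def_carrier[OF g] sym_pos_def_det[OF g]]
  let ?Y = "minv (z \<cdot>\<^sub>m cmat (\<gamma> m) + 0\<^sub>m p p)"
  have P: "z \<cdot>\<^sub>m cmat (\<gamma> m) + 0\<^sub>m p p = z \<cdot>\<^sub>m cmat (\<gamma> m)" using cg by simp
  have Y: "accretive_semidef p ?Y"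
    unfolding P by (intro accretive_imp_semidef accretive_minv accretive_smult_cmat z g)
  have "z \<cdot>\<^sub>m cmat (\<gamma> m) * ((1 / z) \<cdot>\<^sub>m cmat (minv (\<gamma> m))) = cmat (\<gamma> m * minv (\<gamma> m))"
    using cg cd z by (auto simp: mult_smult_distrib[of _ p p _ p] mult_smult_assoc_mat[of _ p p _ p]
        of_real_hom.mat_hom_mult[of _ p p _ p] intro!: eq_matI)
  then have Yv: "?Y = (1 / z) \<cdot>\<^sub>m cmat (minv (\<gamma> m))"
    unfolding P minv_right[OF cg sym_pos_def_det[OF g]] of_real_hom.mat_hom_one
    using cg cd by (intro minv_unique) auto
  have zero: "cmat ((\<kappa> m)\<^sup>T) * (0\<^sub>m p p * cmat (\<kappa> m)) = 0\<^sub>m p p"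
    using \<kappa>c[OF m order_refl] by (simp add: left_mult_zero_mat[of _ p p] right_mult_zero_mat[of _ p p])
  have Yeq: "z \<cdot>\<^sub>m ?Y = cmat (minv (\<gamma> m)) - cmat ((\<kappa> m)\<^sup>T) * (0\<^sub>m p p * cmat (\<kappa> m))"
    unfolding zero Yv using cd z by (intro eq_matI) auto
  have "block_unit m p m * 0\<^sub>m p p * (block_unit m p m)\<^sup>T = (0\<^sub>m (m * p) (m * p) :: complex mat)"
    by (subst right_mult_zero_mat[OF block_unit_carrier], rule left_mult_zero_mat) simp
  then have "cmat (block_tridiag m p \<alpha> \<beta>) - block_unit m p m * 0\<^sub>m p p * (block_unit m p m)\<^sup>T
      = cmat (block_tridiag m p \<alpha> \<beta>)"
    by (auto intro!: eq_matI simp: block_tridiag_def)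
  then show ?thesis
    using resolvent_corner_eq_contfrac[OF z Y zero_carrier_mat Yeq] by (simp add: full_ladder_def contfrac_append)
qed

text \<open>The perturbation removes the last pivot entirely, so the flux through the last rung vanishes
  and the fraction ends in \<open>0\<close> after \<open>K\<^sub>m\<close>.\<close>

lemma gauss_radau_eq:
  assumes z: "0 < Re z"
  shows "resolvent_corner m p (cmat (block_tridiag m p \<alpha> \<beta> -
     block_unit m p m * ((minv (\<kappa> m))\<^sup>T * minv (\<gamma> m) * minv (\<kappa> m)) * (block_unit m p m)\<^sup>T)) (z\<^sup>2) =
   (1 / z) \<cdot>\<^sub>m contfrac z (map cmat (ladder 1 (m - 1))) (0\<^sub>m p p)"
proof -
  note g = \<gamma>[OF m order_refl] and k = \<kappa>c[OF m order_refl] and dk = \<kappa>det[OF m order_refl]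
  note cd = minv_carrier[OF sym_pos_def_carrier[OF g] sym_pos_def_det[OF g]]
  note ik = minv_carrier[OF k dk]
  let ?X = "(minv (\<kappa> m))\<^sup>T * minv (\<gamma> m) * minv (\<kappa> m)"
  note assoc = assoc_mult_mat[of _ p p _ p _ p] and mc = mult_carrier_mat[of _ p p _ p]
  have cX: "?X \<in> carrier_mat p p" using cd ik by (simp add: mc)
  have kk': "(\<kappa> m)\<^sup>T * (minv (\<kappa> m))\<^sup>T = 1\<^sub>m p"
    unfolding transpose_mult[OF ik k, symmetric] minv_left[OF k dk] by simp
  have "(\<kappa> m)\<^sup>T * (?X * \<kappa> m) =
      ((\<kappa> m)\<^sup>T * (minv (\<kappa> m))\<^sup>T) * (minv (\<gamma> m) * (minv (\<kappa> m) * \<kappa> m))"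
    using cd ik k by (simp add: assoc mc)
  also have "\<dots> = minv (\<gamma> m)"
    unfolding kk' minv_left[OF k dk] using cd by (simp add: left_mult_one_mat[of _ p p] right_mult_one_mat[of _ p p])
  finally have X: "(\<kappa> m)\<^sup>T * (?X * \<kappa> m) = minv (\<gamma> m)" .
  have "cmat ((\<kappa> m)\<^sup>T) * (cmat ?X * cmat (\<kappa> m)) = cmat ((\<kappa> m)\<^sup>T * (?X * \<kappa> m))"
    using cX k by (simp add: of_real_hom.mat_hom_mult[of _ p p _ p] mc)
  then have Yeq: "z \<cdot>\<^sub>m 0\<^sub>m p p = cmat (minv (\<gamma> m)) - cmat ((\<kappa> m)\<^sup>T) * (cmat ?X * cmat (\<kappa> m))"
    unfolding X using cd by (auto intro!: eq_matI)
  have Y: "accretive_semidef p (0\<^sub>m p p)"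
    by (auto simp: accretive_semidef_def scalar_prod_def)
  have cE: "block_unit m p m * ?X \<in> carrier_mat (m * p) p"
    by (rule mult_carrier_mat[OF block_unit_carrier cX])
  have u: "cmat (block_unit m p m) = block_unit m p m" "cmat ((block_unit m p m)\<^sup>T) = (block_unit m p m)\<^sup>T"
    by (auto intro!: eq_matI simp: block_unit_def)
  have "cmat (block_unit m p m * ?X * (block_unit m p m)\<^sup>T) = block_unit m p m * cmat ?X * (block_unit m p m)\<^sup>T"
    using cmat_mult[OF cE transpose_carrier_mat[THEN iffD2, OF block_unit_carrier]]
      cmat_mult[OF block_unit_carrier[of m p m] cX] u by simp
  moreover have "cmat (block_tridiag m p \<alpha> \<beta> - M) = cmat (block_tridiag m p \<alpha> \<beta>) - cmat M"
    if "M \<in> carrier_mat (m * p) (m * p)" for M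
    using that by (auto intro!: eq_matI simp: block_tridiag_def)
  moreover have "block_unit m p m * ?X * (block_unit m p m)\<^sup>T \<in> carrier_mat (m * p) (m * p)"
    by (rule mult_carrier_mat[OF cE]) simp
  ultimately show ?thesis
    using resolvent_corner_eq_contfrac[OF z Y _ Yeq] cX by simp
qed

end

theorem proposition1:
  fixes n p m :: nat
    and A B \<phi> :: "real mat"
    and Q \<alpha> \<beta> :: "nat \<Rightarrow> real mat"
  assumes "n \<ge> 1" and "p \<ge> 1" and "m \<ge> 1" and "m * p \<le> n"
    and "sym_pos_def n A"
    and "B \<in> carrier_mat n p" and "transpose_mat B * B = 1\<^sub>m p"
    and "block_lanczos n p m A B Q \<alpha> \<beta>"
    and "\<forall>i \<in> {2..m}. invertible_mat (\<beta> i)"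
    and "sym_pos_def p \<phi>"
  shows "stieltjes_function p (krein_nudelman m p \<alpha> \<beta> \<phi>) \<and>
         branch_cut_on_negative_reals p (krein_nudelman m p \<alpha> \<beta> \<phi>) \<and>
         (\<forall>s::real. s > 0 \<longrightarrow>
            (\<exists>F F_KN F_GR.
               block_gauss m p \<alpha> \<beta> (of_real s) = cmat F \<and>
               krein_nudelman m p \<alpha> \<beta> \<phi> (of_real s) = cmat F_KN \<and>
               block_gauss_radau m p \<alpha> \<beta> (of_real s) = cmat F_GR \<and>
               loewner_less p F F_KN \<and> loewner_less p F_KN F_GR))"
proof -
  interpret L: lanczos_run n p m A B Q \<alpha> \<beta>
    using assms by unfold_locales auto
  define \<kappa> where "\<kappa> = kappa_hat p \<alpha> \<beta>"
  define \<gamma> where "\<gamma> = gamma p \<alpha> \<beta>"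
  note par = L.stieltjes_parameters[folded \<kappa>_def \<gamma>_def]
  interpret lanczos_ladder m p \<alpha> \<beta> \<kappa> \<gamma>
  proof
    show "\<beta> i \<in> carrier_mat p p" if "2 \<le> i" "i \<le> m" for i
      using L.\<beta>0_carrier[of i] that by (simp add: L.\<beta>0_def)
  qed (use assms(3) par L.\<alpha>_carrier in \<open>auto simp: \<kappa>_def\<close>)
  note spd = full_ladder_sym_pos_def
  note i\<phi> = sym_pos_def_minv[OF assms(10)]
  let ?X = "cmat (minv \<phi>)"
  \<comment> \<open>Off the closed half-plane the fraction may hit a singular matrix, whose inverse is
    unspecified, so a matrix of the right size is put there.\<close>
  define H where "H z = (if 0 \<le> Re z then contfrac z (map cmat full_ladder) ?X else 0\<^sub>m p p)" for z
  have X: "accretive p ?X" by (rule accretive_cmat[OF i\<phi>])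
  have tX: "?X\<^sup>T = ?X" using sym_pos_def_transpose[OF i\<phi>] by (simp add: map_mat_transpose)
  have acc: "accretive p (H z)" if "0 \<le> Re z" for z
    using contfrac_accretive_closed[OF that spd X] that by (simp add: H_def)
  have Hc: "H z \<in> carrier_mat p p" for z
    using accretive_carrier[OF acc, of z] by (cases "0 \<le> Re z") (auto simp: H_def)
  have kn: "krein_nudelman m p \<alpha> \<beta> \<phi> s = (1 / csqrt s) \<cdot>\<^sub>m H (csqrt s)" if "s \<notin> \<real>\<^sub>\<le>\<^sub>0" for s
  proof -
    have "krein_nudelman m p \<alpha> \<beta> \<phi> s = krein_nudelman m p \<alpha> \<beta> \<phi> ((csqrt s)\<^sup>2)" by simp
    also have "\<dots> = (1 / csqrt s) \<cdot>\<^sub>m contfrac (csqrt s) (map cmat full_ladder) ?X"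
      unfolding krein_nudelman_def
      by (rule krein_nudelman_eq[OF Re_csqrt_pos[OF that] assms(10)])
        (simp add: delta_alpha_def Let_def \<kappa>_def \<gamma>_def)
    finally show ?thesis using Re_csqrt by (simp add: H_def)
  qed
  have cont: "continuous_on {z. 0 \<le> Re z} (\<lambda>z. H z $$ (i,j))" if "i < p" "j < p" for i j
    by (rule continuous_on_eq[OF contfrac_continuous_holomorphic(1)[OF spd X that]]) (simp add: H_def)
  have holo: "(\<lambda>z. H z $$ (i,j)) holomorphic_on {z. 0 < Re z}" if "i < p" "j < p" for i j
    by (rule holomorphic_transform[OF contfrac_continuous_holomorphic(2)[OF spd X that]]) (simp add: H_def)
  have decay: "((\<lambda>z. H z $$ (i,j) / z) \<longlongrightarrow> 0) at_infinity_right" if "i < p" "j < p" for i j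
    by (rule Lim_transform_eventually[OF contfrac_decay[OF spd X that]])
      (auto simp: eventually_inf_principal H_def)
  have cnjH: "H (cnj z) $$ (i,j) = cnj (H z $$ (i,j))" if "0 \<le> Re z" "i < p" "j < p" for z i j
    using contfrac_cnj[OF that(1) spd X] Hc[of z] that by (simp add: H_def)
  have symH: "H z $$ (i,j) = H z $$ (j,i)" if "0 \<le> Re z" "i < p" "j < p" for z i j
    using arg_cong[OF contfrac_transpose[OF that(1) spd X tX], of "\<lambda>M. M $$ (j,i)"] Hc[of z] that by (simp add: H_def)
  have herm: "quadratic_form p (H z) (\<lambda>i. complex_of_real (x i)) = (H z *\<^sub>v vec p (\<lambda>i. of_real (x i))) \<bullet>c vec p (\<lambda>i. of_real (x i))"
    for z x
    using Hc[of z]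
    by (auto simp: quadratic_form_def scalar_prod_def sum_distrib_left atLeast0LessThan ac_simps intro!: sum.cong)
  have pos: "0 \<le> Re (quadratic_form p (H (Complex 0 y)) (\<lambda>i. complex_of_real (x i)))" for y x
    unfolding herm using accretive_imp_semidef[OF acc] by (simp add: accretive_semidef_def)
  have "stieltjes_function p (krein_nudelman m p \<alpha> \<beta> \<phi>)"
    by (rule stieltjes_function_if_positive_real[OF Hc cont holo decay cnjH symH pos kn])
  moreover have "branch_cut_on_negative_reals p (krein_nudelman m p \<alpha> \<beta> \<phi>)"
  proof (rule branch_cut_if_strictly_positive_real[OF Hc cont holo cnjH _ _ kn])
    show "0 < Re (H (Complex 0 y) $$ (0,0))" for y
    proof -
      have "unit_vec p 0 \<noteq> (0\<^sub>v p :: complex vec)" using assms(2) by (auto simp: vec_eq_iff)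
      then have "0 < Re ((H (Complex 0 y) *\<^sub>v unit_vec p 0) \<bullet>c unit_vec p 0)"
        using acc[of "Complex 0 y"] by (simp add: accretive_def)
      also have "conjugate (unit_vec p 0) = (unit_vec p 0 :: complex vec)"
        by (rule eq_vecI) (auto simp: unit_vec_def)
      finally show ?thesis using Hc[of "Complex 0 y"] assms(2) by simp
    qed
  qed (use assms(2) in auto)
  moreover have "\<exists>F F_KN F_GR.
               block_gauss m p \<alpha> \<beta> (of_real s) = cmat F \<and>
               krein_nudelman m p \<alpha> \<beta> \<phi> (of_real s) = cmat F_KN \<and>
               block_gauss_radau m p \<alpha> \<beta> (of_real s) = cmat F_GR \<and>
               loewner_less p F F_KN \<and> loewner_less p F_KN F_GR" if s: "s > 0" for s :: real
  proof -
    define r where "r = sqrt s"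
    have r: "0 < r" "complex_of_real s = (of_real r)\<^sup>2" "0 < Re (complex_of_real r)"
      using s by (auto simp: r_def of_real_power[symmetric] simp del: of_real_power)
    let ?l = "ladder 1 (m - 1)"
    have spdl: "\<forall>M \<in> set ?l. sym_pos_def p M" using spd by (auto simp: full_ladder_def)
    have Z: "sym_pos_semidef p (0\<^sub>m p p)" by (auto simp: sym_pos_semidef_def scalar_prod_def)
    have Xs: "sym_pos_semidef p (minv \<phi>)" by (rule sym_pos_def_imp_semidef[OF i\<phi>])
    have cmat0: "cmat (0\<^sub>m p p) = 0\<^sub>m p p" by (rule eq_matI) auto
    have smult: "complex_of_real c \<cdot>\<^sub>m cmat M = cmat (c \<cdot>\<^sub>m M)" for c M by (rule eq_matI) auto
    define F where "F = (1 / r) \<cdot>\<^sub>m contfrac r full_ladder (0\<^sub>m p p)"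
    define F_KN where "F_KN = (1 / r) \<cdot>\<^sub>m contfrac r full_ladder (minv \<phi>)"
    define F_GR where "F_GR = (1 / r) \<cdot>\<^sub>m contfrac r ?l (0\<^sub>m p p)"
    have 1: "block_gauss m p \<alpha> \<beta> (of_real s) = cmat F"
      unfolding block_gauss_def r(2) gauss_eq[OF r(3)] F_def
      using contfrac_cmat[OF r(1) spd Z] smult[of "1 / r"] by (simp add: cmat0)
    have "complex_of_real s \<notin> \<real>\<^sub>\<le>\<^sub>0" using s by (simp add: complex_nonpos_Reals_iff)
    from kn[OF this] have 2: "krein_nudelman m p \<alpha> \<beta> \<phi> (of_real s) = cmat F_KN"
      unfolding F_KN_def
      using contfrac_cmat[OF r(1) spd Xs] smult[of "1 / r"] s r(1) by (simp add: H_def r_def)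
    have 3: "block_gauss_radau m p \<alpha> \<beta> (of_real s) = cmat F_GR"
      unfolding block_gauss_radau_def Let_def r(2) gauss_radau_eq[OF r(3), unfolded \<kappa>_def \<gamma>_def] F_GR_def
      using contfrac_cmat[OF r(1) spdl Z] smult[of "1 / r"] by (simp add: cmat0 \<kappa>_def \<gamma>_def)
    have nonempty: "full_ladder \<noteq> []" by (simp add: full_ladder_def)
    have spdF: "sym_pos_def p F" "sym_pos_def p F_KN" "sym_pos_def p F_GR"
      unfolding F_def F_KN_def F_GR_def using r(1) spd spdl Z Xs nonempty
      by (auto intro!: sym_pos_def_smult sym_pos_def_contfrac)
    have diff: "(1 / r) \<cdot>\<^sub>m M - (1 / r) \<cdot>\<^sub>m N = (1 / r) \<cdot>\<^sub>m (M - N)"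
      if "M \<in> carrier_mat p p" "N \<in> carrier_mat p p" for M N
      using that by (intro eq_matI) (auto simp: diff_divide_distrib)
    have cc: "contfrac r full_ladder Y \<in> carrier_mat p p" "contfrac r ?l Y \<in> carrier_mat p p" if "sym_pos_semidef p Y" for Y
      using sym_pos_def_carrier[OF sym_pos_def_contfrac[OF r(1) spd that nonempty]]
        sym_pos_def_carrier[OF sym_pos_def_contfrac[OF r(1) spdl that]] by auto
    have "even (length full_ladder)" by (simp add: full_ladder_def length_ladder)
    moreover have "sym_pos_def p (minv \<phi> - 0\<^sub>m p p)"
      using i\<phi> minus_zero_mat[OF sym_pos_def_carrier[OF i\<phi>]] by simp
    ultimately have "sym_pos_def p (contfrac r full_ladder (minv \<phi>) - contfrac r full_ladder (0\<^sub>m p p))"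
      using contfrac_strict_mono[OF r(1) spd Z Xs] by simp
    then have lt1: "sym_pos_def p (F_KN - F)"
      unfolding F_KN_def F_def diff[OF cc(1)[OF Xs] cc(1)[OF Z]] using r(1) by (intro sym_pos_def_smult) auto
    let ?Y = "minv (r \<cdot>\<^sub>m \<gamma> m + minv \<phi>)"
    have Y: "sym_pos_def p ?Y"
      using \<gamma>[of m] m r(1) Xs by (intro sym_pos_def_minv sym_pos_def_add_semidef sym_pos_def_smult) auto
    have "odd (length ?l)" by (simp add: length_ladder)
    moreover have "sym_pos_def p (?Y - 0\<^sub>m p p)"
      using Y minus_zero_mat[OF sym_pos_def_carrier[OF Y]] by simp
    ultimately have "sym_pos_def p (contfrac r ?l (0\<^sub>m p p) - contfrac r ?l ?Y)"
      using contfrac_strict_mono[OF r(1) spdl Z sym_pos_def_imp_semidef[OF Y]] by simp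
    moreover have "F_KN = (1 / r) \<cdot>\<^sub>m contfrac r ?l ?Y"
      by (simp add: F_KN_def full_ladder_def contfrac_append)
    ultimately have lt2: "sym_pos_def p (F_GR - F_KN)"
      unfolding F_GR_def using diff[OF cc(2)[OF Z] cc(2)[OF sym_pos_def_imp_semidef[OF Y]]] r(1)
      by (auto intro!: sym_pos_def_smult)
    have "loewner_less p F F_KN" "loewner_less p F_KN F_GR"
      using spdF lt1 lt2 by (auto simp: loewner_less_def dest: sym_pos_def_carrier sym_pos_def_transpose)
    then show ?thesis using 1 2 3 by blast
  qed
  ultimately show ?thesis by blast
qed

end
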